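(* Let $q$ be a prime power, $n\ge 3$, $V=\mathbb{F}_q^n$, and let $(a,b)$ be a pair with $1\le a,b\le n-1$, $a\ne b$, such that $(a,b)\neq(n/3,2n/3)$ and $(a,b)\ne(2n/3,n/3)$. Then $1/Z_c(X_2^{[(a,b)]}(V),u)$ is a product of factors of the form $(1-q^su^6)$ with $s\in\mathbb{Z}_{\ge0}$.
   Context: A directed flag in $V$ is an ordered pair $F=(W_1,W_2)$ of nonzero proper subspaces with $W_1\subsetneq W_2$ or $W_2\subsetneq W_1$; its multi-dimension is $(\dim W_1,\dim W_2)$. $X_2(V)$ is the digraph whose vertices are the directed flags, with a directed edge from $(W_1,W_2)$ to $(W_3,W_4)$ iff $W_2=W_3$ and either $W_1\oplus W_4=W_2$, or ($W_1\cap W_4=W_2$ and $W_1+W_4=V$). Define $f$ on $\{(a,b):1\le a,b\le n-1,a\ne b\}$ by $f(a,b)=(b,b-a)$ if $b>a$ and $f(a,b)=(b,n+b-a)$ if $b<a$; the class $[(a,b)]$ is $\{f^m(a,b):m\ge0\}$. $X_2^{[(a,b)]}(V)$ is the induced subdigraph of $X_2(V)$ on the directed flags whose multi-dimension lies in $[(a,b)]$. For a finite digraph $X$, $N_c(X,l)$ is the number of closed walks of length $l$ and $Z_c(X,u)=\exp\left(\sum_{l\ge1}\frac{N_c(X,l)}{l}u^l\right)$. *)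

theory Defs
  imports
    "HOL-Analysis.Analysis"
    "HOL-Library.Set_Algebras"
    "HOL-Computational_Algebra.Formal_Power_Series"
    "Graph_Theory.Graph_Theory"
begin

section \<open>Zeta function of a finite digraph\<close>

text \<open>
  A closed walk of positive length is represented by its list of arcs, so it has a distinguished
  starting point and cyclic shifts are counted separately.  (The number is then the trace of
  the corresponding power of the adjacency matrix.)  It is only used for \<open>l \<ge> 1\<close>, and
  only for finite digraphs, where the set of these walks is finite.
\<close>

definition num_closed_walks :: "('a, 'b) pre_digraph \<Rightarrow> nat \<Rightarrow> nat" where
  "num_closed_walks X l = card {p. (\<exists>u. pre_digraph.awalk X u p u) \<and> length p = l}"

text \<open>
  The zeta function is the formal power series \<open>exp (\<Sum>l\<ge>1. N l / l * u ^ l)\<close> in the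
  variable \<open>u = fps_X\<close>.  The inner series has constant term \<open>0\<close>, so the composition is
  meaningful.
\<close>

definition zeta_c :: "('a, 'b) pre_digraph \<Rightarrow> complex fps" where
  "zeta_c X = fps_exp 1 oo
     Abs_fps (\<lambda>l. if l = 0 then 0 else of_nat (num_closed_walks X l) / of_nat l)"


section \<open>Directed flags in \<open>V = 'k ^ 'n\<close>\<close>

type_synonym ('k, 'n) subspace_pair = "('k ^ 'n) set \<times> ('k ^ 'n) set"

definition proper_subspace :: "('k::field ^ 'n::finite) set \<Rightarrow> bool" where
  "proper_subspace W \<longleftrightarrow> vec.subspace W \<and> W \<noteq> {0} \<and> W \<noteq> UNIV"

definition directed_flags :: "('k::field, 'n::finite) subspace_pair set" where
  "directed_flags =
     {(W1, W2). proper_subspace W1 \<and> proper_subspace W2 \<and> (W1 \<subset> W2 \<or> W2 \<subset> W1)}"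

fun multidim :: "('k::field, 'n::finite) subspace_pair \<Rightarrow> nat \<times> nat" where
  "multidim (W1, W2) = (vec.dim W1, vec.dim W2)"

definition is_direct_sum :: "('k::field ^ 'n::finite) set \<Rightarrow> ('k ^ 'n) set \<Rightarrow> ('k ^ 'n) set \<Rightarrow> bool" where
  "is_direct_sum U W S \<longleftrightarrow> U + W = S \<and> U \<inter> W = {0}"

definition flag_arc :: "('k::field, 'n::finite) subspace_pair \<Rightarrow> ('k, 'n) subspace_pair \<Rightarrow> bool" where
  "flag_arc F G \<longleftrightarrow> (case (F, G) of ((W1, W2), (W3, W4)) \<Rightarrow>
     W2 = W3 \<and> (is_direct_sum W1 W4 W2 \<or> (W1 \<inter> W4 = W2 \<and> W1 + W4 = UNIV)))"

definition flag_digraph ::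
    "(('k::field, 'n::finite) subspace_pair, ('k, 'n) subspace_pair \<times> ('k, 'n) subspace_pair) pre_digraph" where
  "flag_digraph = with_proj
     \<lparr> pverts = directed_flags,
       parcs = {(F, G). F \<in> directed_flags \<and> G \<in> directed_flags \<and> flag_arc F G} \<rparr>"

text \<open>
  The step map is meant for pairs \<open>1 \<le> a, b \<le> n - 1\<close> with \<open>a \<noteq> b\<close>.  It maps this set
  to itself, and on it the subtractions of natural numbers do not truncate.
\<close>

fun dim_step :: "nat \<Rightarrow> nat \<times> nat \<Rightarrow> nat \<times> nat" where
  "dim_step n (a, b) = (if b > a then (b, b - a) else (b, n + b - a))"

definition dim_class :: "nat \<Rightarrow> nat \<times> nat \<Rightarrow> (nat \<times> nat) set" where
  "dim_class n ab = {(dim_step n ^^ m) ab | m. True}"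

definition class_flag_digraph :: "nat \<times> nat \<Rightarrow>
    (('k::field, 'n::finite) subspace_pair, ('k, 'n) subspace_pair \<times> ('k, 'n) subspace_pair) pre_digraph" where
  "class_flag_digraph ab =
     flag_digraph \<restriction> {F \<in> directed_flags. multidim F \<in> dim_class CARD('n) ab}"

lemma fin_digraph_class_flag_digraph:
  "fin_digraph (class_flag_digraph ab ::
     (('k::{field,finite}, 'n::finite) subspace_pair, ('k, 'n) subspace_pair \<times> ('k, 'n) subspace_pair) pre_digraph)"
  by unfold_locales (auto simp: class_flag_digraph_def flag_digraph_def)

end

(*
  The step map on multi-dimensions has order exactly 6 on the class, so closed walks have length
  6k, and up to the choice of the starting type they are counted by the trace of the k-th power of
  the six-step operator M on flags W1 < W2 of dimensions (a, b).  Three steps lead exactly to the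
  flags in general position with a given flag, so M = O^T O for an opposition relation O.
  Lifted to complete flags, M becomes, up to powers of q, the full twist T_{w0}^2 of the Iwahori-Hecke
  algebra.  The full twist is the product of the commuting Jucys-Murphy elements
  J_0 = 1, J_k = T_k J_{k-1} T_k, and the quadratic relation for T_k shows by induction that all
  their eigenvalues are powers of q.  Since M is an integer matrix, its nonzero eigenvalues are
  q^s with s >= 0, and 1/Z_c is the product of 1 - q^s u^6 over these eigenvalues.
*)
theory Submission
  imports Defs "Jordan_Normal_Form.Schur_Decomposition"
begin

text \<open>The generators of the Hecke algebra act on functions of complete flags, not of partial
  ones. An eigenvector of the six-step operator is therefore pulled back along the map sending a
  complete flag to its members of dimensions \<open>a\<close> and \<open>b\<close>. The number of
  refinements of a transversal partial flag opposite to a fixed complete flag is one power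
  \<open>q^e\<close>, so the pullback intertwines the operators only up to powers of
  \<open>q\<close>. An eigenvalue \<open>c\<close> then satisfies \<open>c * q^t = q^s\<close>,
  where nothing so far rules out \<open>t > s\<close>. Integrality settles this: \<open>c\<close> is
  rational and an algebraic integer, hence an integer. No diagonalisation is used. Common
  eigenvectors suffice for the spectrum of a product of commuting matrices, and multiplicities enter
  only through traces, read off a Schur form. The two excluded pairs form the type orbit of length
  2, where closed walks need only have even length. A pair with \<open>a > b\<close> shares its
  class with the ascending pair one step later.\<close>

hide_const (open) Matrix.mat
no_notation vec_index (infixl \<open>$\<close> 100)

section \<open>Matrices whose eigenvalues are powers of \<open>q\<close>\<close>

text \<open>The vector \<open>p(B) v\<close>, by Horner's scheme.\<close>

definition krylov :: "'a::field ^ 'x ^ 'x \<Rightarrow> 'a ^ 'x \<Rightarrow> 'a poly \<Rightarrow> 'a ^ 'x" where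
  "krylov B v p = fold_coeffs (\<lambda>a x. a *s v + B *v x) p 0"

lemma krylov_0 [simp]: "krylov B v 0 = 0"
  by (simp add: krylov_def)

lemma krylov_pCons [simp]: "krylov B v (pCons a p) = a *s v + B *v krylov B v p"
  by (cases "a = 0 \<and> p = 0") (auto simp: krylov_def)

lemma krylov_add: "krylov B v (p + r) = krylov B v p + krylov B v r"
  by (induction p r rule: poly_induct2)
    (simp_all add: matrix_vector_right_distrib vector_sadd_rdistrib)

lemma krylov_smult: "krylov B v (Polynomial.smult c p) = c *s krylov B v p"
  by (induction p) (simp_all add: vector_add_ldistrib matrix_vector_mult_scaleR vector_scalar_commute)

lemma krylov_monom: "krylov B v (Polynomial.monom c i) = c *s (((*v) B ^^ i) v)"
  by (induction i) (simp_all add: monom_0 monom_Suc vector_scalar_commute)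

lemma krylov_sum: "krylov B v (\<Sum>i\<in>I. p i) = (\<Sum>i\<in>I. krylov B v (p i))"
  by (induction I rule: infinite_finite_induct) (simp_all add: krylov_add)

lemma krylov_linear_factor:
  "krylov B v ([:-r, 1:] * p) = B *v krylov B v p - r *s krylov B v p"
proof -
  have "[:-r, 1:] * p = Polynomial.smult (-r) p + pCons 0 p"
    by simp
  then show ?thesis
    by (simp only: krylov_add krylov_smult krylov_pCons) simp
qed

lemma krylov_in_invariant_subspace:
  assumes "vec.subspace S" "v \<in> S" "\<And>x. x \<in> S \<Longrightarrow> B *v x \<in> S"
  shows "krylov B v p \<in> S"
  by (induction p) (auto intro: vec.subspace_0 vec.subspace_add vec.subspace_scale assms)

text \<open>The \<open>CARD('x) + 1\<close> iterates of \<open>v\<close> are too many to be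
  independent, and a linear relation among them is a polynomial.\<close>

lemma krylov_annihilator:
  fixes B :: "'a::field ^ 'x::finite ^ 'x"
  shows "\<exists>p. p \<noteq> 0 \<and> krylov B v p = 0"
proof -
  let ?N = "CARD('x)" and ?w = "\<lambda>i. ((*v) B ^^ i) v"
  show ?thesis
  proof (cases "inj_on ?w {..?N}")
    \<comment> \<open>Dependence is a property of a set, in which equal iterates merge; a repetition
      yields the annihilator \<open>x^i - x^j\<close> directly.\<close>
    case False
    then obtain i j where ij: "i \<noteq> j" "?w i = ?w j"
      by (auto simp: inj_on_def)
    have "poly.coeff (Polynomial.monom 1 i + Polynomial.monom (-1) j :: 'a poly) i = 1"
      using ij by simp
    then have "Polynomial.monom 1 i + Polynomial.monom (-1) j \<noteq> (0 :: 'a poly)"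
      by (metis coeff_0 zero_neq_one)
    moreover have "krylov B v (Polynomial.monom 1 i + Polynomial.monom (-1) j) = 0"
      using ij by (simp add: krylov_add krylov_monom)
    ultimately show ?thesis by blast
  next
    case True
    let ?W = "?w ` {..?N}"
    have "card ?W = Suc ?N"
      using True by (simp add: card_image)
    moreover have "vec.dim ?W \<le> ?N"
      using vec.dim_subset_UNIV[of ?W] by (simp add: vec.dimension_def card_cart_basis)
    ultimately have "vec.dependent ?W"
      using vec.independent_card_le_dim[of ?W ?W] by fastforce
    then obtain u x where u: "x \<in> ?W" "u x \<noteq> 0" "(\<Sum>w\<in>?W. u w *s w) = 0"
      by (auto simp: vec.dependent_finite)
    obtain i where i: "i \<le> ?N" "x = ?w i" using u by auto
    let ?p = "\<Sum>j\<le>?N. Polynomial.monom (u (?w j)) j"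
    have "krylov B v ?p = 0"
      using u True by (simp add: krylov_sum krylov_monom sum.reindex)
    moreover have "poly.coeff ?p i = u (?w i)"
      using i by (simp add: coeff_sum)
    then have "?p \<noteq> 0" using u i by (metis coeff_0)
    ultimately show ?thesis by blast
  qed
qed

text \<open>An annihilating polynomial of \<open>v\<close> of least degree splits off a linear
  factor over the complex numbers. By minimality the cofactor sends \<open>v\<close> to a nonzero
  vector, and the linear factor kills that vector. Polynomials in \<open>B\<close> preserve
  \<open>S\<close>, so the matrix never has to be restricted to a subspace.\<close>

lemma eigenvector_in_invariant_subspace:
  fixes B :: "complex ^ 'x::finite ^ 'x"
  assumes S: "vec.subspace S" "v \<in> S" "v \<noteq> 0" "\<And>x. x \<in> S \<Longrightarrow> B *v x \<in> S"
  obtains w b where "w \<in> S" "w \<noteq> 0" "B *v w = b *s w"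
proof -
  define d where "d = (LEAST d. \<exists>p. p \<noteq> 0 \<and> krylov B v p = 0 \<and> degree p = d)"
  obtain p where p: "p \<noteq> 0" "krylov B v p = 0" "degree p = d"
    unfolding d_def using krylov_annihilator[of B v] LeastI_ex[of "\<lambda>d. \<exists>p. p \<noteq> 0 \<and> krylov B v p = 0 \<and> degree p = d"]
    by auto
  have min: "d \<le> degree r" if "r \<noteq> 0" "krylov B v r = 0" for r
    unfolding d_def using that by (intro Least_le) auto
  have "degree p \<noteq> 0"
  proof
    assume "degree p = 0"
    then obtain c where "p = [:c:]" by (auto elim: degree_eq_zeroE)
    then show False using p S by (auto simp: vec_eq_iff)
  qed
  then obtain r where "poly p r = 0"
    using fundamental_theorem_of_algebra constant_degree by metis
  then obtain s where s: "p = [:-r, 1:] * s"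
    by (auto simp: poly_eq_0_iff_dvd)
  have "s \<noteq> 0" using p s by auto
  have "degree s < d"
    using p(3) s \<open>s \<noteq> 0\<close> degree_mult_eq[of "[:-r, 1:]" s] by simp
  then have "krylov B v s \<noteq> 0"
    using min[of s] \<open>s \<noteq> 0\<close> by auto
  moreover have "B *v krylov B v s = r *s krylov B v s"
    using p(2) unfolding s krylov_linear_factor by simp
  moreover have "krylov B v s \<in> S"
    by (rule krylov_in_invariant_subspace) (use S in auto)
  ultimately show thesis using that by blast
qed

text \<open>The eigenspace of \<open>A\<close> is invariant under \<open>B\<close> and thus contains
  an eigenvector of \<open>B\<close>.\<close>

lemma commuting_common_eigenvector:
  fixes A B :: "complex ^ 'x::finite ^ 'x"
  assumes AB: "A ** B = B ** A" and v: "v \<noteq> 0" "A *v v = a *s v"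
  obtains w b where "w \<noteq> 0" "A *v w = a *s w" "B *v w = b *s w"
proof -
  let ?S = "{w. A *v w = a *s w}"
  have "vec.subspace ?S"
    by (auto simp: vec.subspace_def matrix_vector_right_distrib vector_add_ldistrib
        vector_scalar_commute)
  moreover have "B *v x \<in> ?S" if "x \<in> ?S" for x
    using that AB by (metis (mono_tags, lifting) matrix_vector_mul_assoc mem_Collect_eq vector_scalar_commute)
  ultimately show thesis
    using eigenvector_in_invariant_subspace[of ?S v B] v that by blast
qed

text \<open>A statement about eigenvalues only: multiplicities and diagonalisability do not enter.
  For \<open>q > 0\<close> it excludes the eigenvalue 0.\<close>

definition power_spectrum :: "nat \<Rightarrow> complex ^ 'x ^ 'x \<Rightarrow> bool" where
  "power_spectrum q A \<longleftrightarrow> (\<forall>v c. v \<noteq> 0 \<longrightarrow> A *v v = c *s v \<longrightarrow> (\<exists>s::nat. c = of_nat q ^ s))"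

lemma power_spectrumD:
  "power_spectrum q A \<Longrightarrow> v \<noteq> 0 \<Longrightarrow> A *v v = c *s v \<Longrightarrow> \<exists>s::nat. c = of_nat q ^ s"
  by (auto simp: power_spectrum_def)

lemma power_spectrum_one: "power_spectrum q (mat 1)"
  unfolding power_spectrum_def
proof (intro allI impI)
  fix v :: "complex ^ 'a" and c
  assume v: "v \<noteq> 0" "mat 1 *v v = c *s v"
  then have "(1 - c) *s v = 0" by (simp add: vec.scale_left_diff_distrib)
  then have "c = 1" using v(1) by (simp only: vec.scale_eq_0_iff) simp
  then show "\<exists>s::nat. c = of_nat q ^ s" by (auto intro: exI[of _ 0])
qed

text \<open>\<open>B\<close> commutes with \<open>A ** B\<close>, so an eigenvalue \<open>c\<close>
  of the product has an eigenvector shared with \<open>B\<close>. If \<open>b\<close> is the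
  eigenvalue of \<open>B\<close> there, then \<open>b\<close> is nonzero and \<open>c / b\<close> is
  an eigenvalue of \<open>A\<close>.\<close>

lemma power_spectrum_mult:
  assumes q: "q > 0" and A: "power_spectrum q A" and B: "power_spectrum q B"
    and AB: "A ** B = B ** A"
  shows "power_spectrum q (A ** B)"
  unfolding power_spectrum_def
proof (intro allI impI)
  fix v :: "complex ^ 'a" and c
  assume v: "v \<noteq> 0" "(A ** B) *v v = c *s v"
  have "(A ** B) ** B = B ** (A ** B)" by (metis AB matrix_mul_assoc)
  from commuting_common_eigenvector[OF this v] obtain w b where
    w: "w \<noteq> 0" "(A ** B) *v w = c *s w" "B *v w = b *s w" .
  obtain s where s: "b = of_nat q ^ s" using power_spectrumD[OF B] w by blast
  have "b \<noteq> 0" using s q by simp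
  have "b *s (A *v w) = c *s w"
    using w by (metis matrix_vector_mul_assoc vector_scalar_commute)
  then have "(1/b) *s (b *s (A *v w)) = (1/b) *s (c *s w)" by simp
  then have "A *v w = (c / b) *s w" using \<open>b \<noteq> 0\<close> by simp
  then obtain t where "c / b = of_nat q ^ t" using power_spectrumD[OF A] w by blast
  then have "c = of_nat q ^ (t + s)" using \<open>b \<noteq> 0\<close> s by (simp add: field_simps power_add)
  then show "\<exists>s::nat. c = of_nat q ^ s" by blast
qed

text \<open>
  On a common eigenvector \<open>w\<close> with \<open>J w = x w\<close> and \<open>T J T w = y w\<close>, either \<open>T w = t w\<close> with
  \<open>t = q\<close> or \<open>t = -1\<close>, and \<open>y = t^2 x\<close>, or \<open>w\<close> and \<open>T w\<close> span a plane on which \<open>J\<close> has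
  the eigenvalues \<open>x\<close> and \<open>y / q\<close>.
\<close>

lemma power_spectrum_conjugate_step:
  fixes T J :: "complex ^ 'x::finite ^ 'x"
  assumes q: "q > 0" and J: "power_spectrum q J"
    and T: "\<And>x. T *v (T *v x) = (of_nat q - 1) *s (T *v x) + of_nat q *s x"
    and comm: "J ** (T ** J ** T) = (T ** J ** T) ** J"
  shows "power_spectrum q (T ** J ** T)"
  unfolding power_spectrum_def
proof (intro allI impI)
  let ?q = "of_nat q :: complex"
  fix v :: "complex ^ 'x" and y
  assume v: "v \<noteq> 0" "(T ** J ** T) *v v = y *s v"
  from commuting_common_eigenvector[OF comm[symmetric] v] obtain w x where
    w: "w \<noteq> 0" "(T ** J ** T) *v w = y *s w" "J *v w = x *s w" .
  obtain s where s: "x = ?q ^ s" using power_spectrumD[OF J] w by blast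
  define u where "u = T *v w"
  have TJ: "T *v (J *v u) = y *s w"
    using w(2) unfolding u_def by (simp add: matrix_vector_mul_assoc matrix_mul_assoc)
  show "\<exists>s::nat. y = ?q ^ s"
  proof (cases "\<exists>t. u = t *s w")
    case True
    then obtain t where t: "u = t *s w" by blast
    have "(t * t) *s w = ((?q - 1) * t + ?q) *s w"
      using T[of w] t unfolding u_def by (simp add: vector_scalar_commute vec.scale_left_distrib)
    then have "(t * t - ((?q - 1) * t + ?q)) *s w = 0" by (simp add: vec.scale_left_diff_distrib)
    then have "t * t - ((?q - 1) * t + ?q) = 0" using w(1) by (simp only: vec.scale_eq_0_iff) simp
    then have "(t - ?q) * (t + 1) = 0" by (simp add: algebra_simps)
    then have tt: "t * t = 1 \<or> t * t = ?q ^ 2"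
      by (auto simp: power2_eq_square add_eq_0_iff2)
    have "(x * t * t) *s w = y *s w"
      using TJ w(3) t unfolding u_def by (simp add: vector_scalar_commute mult_ac)
    then have "(x * t * t - y) *s w = 0" by (simp add: vec.scale_left_diff_distrib)
    then have "x * t * t - y = 0" using w(1) by (simp only: vec.scale_eq_0_iff) simp
    then have "y = x * (t * t)" by (simp add: mult.assoc)
    then show ?thesis using tt s by (metis mult.right_neutral power_add)
  next
    case False
    \<comment> \<open>The quadratic relation at \<open>J *v u\<close>, combined with
      \<open>T *v (J *v u) = y *s w\<close>, expresses \<open>J *v u\<close> by \<open>u\<close> and
      \<open>w\<close>.\<close>
    have "(?q - 1) *s (y *s w) + ?q *s (J *v u) = y *s u"
      using T[of "J *v u"] TJ by (simp add: vector_scalar_commute flip: u_def)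
    then have qJ: "?q *s (J *v u) = y *s u - (?q - 1) *s (y *s w)"
      by (simp add: eq_diff_eq add.commute)
    have "J *v u = (1 / ?q) *s (?q *s (J *v u))" using q by simp
    also have "\<dots> = (y / ?q) *s u - ((y / ?q) * (?q - 1)) *s w"
      unfolding qJ by (simp add: vector_ssub_ldistrib mult.commute)
    finally have Ju: "J *v u = (y / ?q) *s u - ((y / ?q) * (?q - 1)) *s w" .
    \<comment> \<open>If \<open>y / q = x\<close>, then \<open>J\<close> need not be diagonalisable
      on the plane, but \<open>x\<close> is already known to be a power. Otherwise \<alpha> solves
      the equation that makes \<open>e\<close> an eigenvector for \<open>y / q\<close>.\<close>
    have yq: "\<exists>t. y / ?q = ?q ^ t"
    proof (cases "y / ?q = x")
      case True
      then show ?thesis using s by blast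
    next
      case neq: False
      define \<alpha> where "\<alpha> = (y / ?q) * (?q - 1) / (x - y / ?q)"
      define e where "e = u + \<alpha> *s w"
      have "e \<noteq> 0"
      proof
        assume "e = 0"
        then have "u = (-\<alpha>) *s w" unfolding e_def by (simp add: eq_neg_iff_add_eq_0)
        then show False using False by blast
      qed
      have \<alpha>: "\<alpha> * x - (y / ?q) * (?q - 1) = (y / ?q) * \<alpha>"
      proof -
        have "\<alpha> * (x - y / ?q) = (y / ?q) * (?q - 1)" using neq by (simp add: \<alpha>_def)
        then show ?thesis by (simp add: algebra_simps)
      qed
      have "J *v e = (y / ?q) *s u - ((y / ?q) * (?q - 1)) *s w + (\<alpha> * x) *s w"
        unfolding e_def by (simp add: matrix_vector_right_distrib Ju vector_scalar_commute w(3))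
      also have "\<dots> = (y / ?q) *s u + (\<alpha> * x - (y / ?q) * (?q - 1)) *s w"
        by (simp only: vec.scale_left_diff_distrib) simp
      also have "\<dots> = (y / ?q) *s e"
        unfolding \<alpha> e_def by (simp add: vector_add_ldistrib)
      finally show ?thesis using power_spectrumD[OF J \<open>e \<noteq> 0\<close>] by blast
    qed
    then obtain t where "y / ?q = ?q ^ t" by blast
    then have "y = ?q ^ Suc t" using q by (simp add: field_simps)
    then show ?thesis by blast
  qed
qed

section \<open>Commutation and cancellation of matrices\<close>

lemma commutes_mult:
  fixes A X Y :: "'a::semiring_1 ^ 'x::finite ^ 'x"
  assumes "A ** X = X ** A" "A ** Y = Y ** A"
  shows "A ** (X ** Y) = (X ** Y) ** A"
proof -
  have "A ** (X ** Y) = X ** (A ** Y)" by (simp add: matrix_mul_assoc assms(1))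
  then show ?thesis by (simp add: matrix_mul_assoc assms(2))
qed

lemma matrix_left_cancel:
  fixes A X Y :: "'a::field ^ 'x::finite ^ 'x"
  assumes "\<And>x. A *v x = 0 \<Longrightarrow> x = 0" "A ** X = A ** Y"
  shows "X = Y"
proof -
  obtain B where B: "B ** A = mat 1" using assms(1) matrix_left_invertible_ker[of A] by auto
  have "(B ** A) ** X = (B ** A) ** Y" using assms(2) by (simp flip: matrix_mul_assoc)
  then show ?thesis by (simp add: B)
qed

lemma matrix_right_cancel:
  fixes A X Y :: "'a::field ^ 'x::finite ^ 'x"
  assumes "\<And>x. A *v x = 0 \<Longrightarrow> x = 0" "X ** A = Y ** A"
  shows "X = Y"
proof -
  obtain B where "B ** A = mat 1" using assms(1) matrix_left_invertible_ker[of A] by auto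
  then have B: "A ** B = mat 1" by (simp only: matrix_left_right_inverse)
  have "X ** (A ** B) = Y ** (A ** B)" using assms(2) by (simp add: matrix_mul_assoc)
  then show ?thesis by (simp add: B)
qed

section \<open>Full twists and Jucys-Murphy elements\<close>

primrec descending_product :: "(nat \<Rightarrow> 'a::semiring_1 ^ 'x ^ 'x) \<Rightarrow> nat \<Rightarrow> 'a ^ 'x ^ 'x" where
  "descending_product T 0 = mat 1"
| "descending_product T (Suc k) = T (Suc k) ** descending_product T k"

text \<open>
  \<open>T i\<close> plays the simple reflections and \<open>D k\<close> the longest element on the first \<open>k\<close> strands.
  The braid relations are not assumed: all commutation that is needed follows from \<open>D_T\<close>, the
  symmetry of the matrices and the invertibility of \<open>D k\<close>.
\<close>

locale hecke_tower =
  fixes q n :: nat and T D :: "nat \<Rightarrow> complex ^ 'x::finite ^ 'x"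
  assumes q_pos: "q > 0"
    and T_quadratic: "\<lbrakk>0 < i; i < n\<rbrakk> \<Longrightarrow> T i *v (T i *v x) = (of_nat q - 1) *s (T i *v x) + of_nat q *s x"
    and T_symmetric: "transpose (T i) = T i"
    and D_symmetric: "transpose (D k) = D k"
    and D_0: "D 0 = mat 1"
    and D_Suc: "k < n \<Longrightarrow> D (Suc k) = D k ** descending_product T k"
    and D_T: "\<lbrakk>0 < i; i < k; k \<le> n\<rbrakk> \<Longrightarrow> D k ** T i = T (k - i) ** D k"
begin

abbreviation "P \<equiv> descending_product T"

text \<open>As the \<open>T i\<close> are symmetric, transposition reverses the product, and this is
  \<open>T k ** ... ** T 1 ** T 1 ** ... ** T k\<close>.\<close>

definition "jm k = P k ** transpose (P k)"

definition "twist k = D k ** D k"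

lemma transpose_P_Suc: "transpose (P (Suc k)) = transpose (P k) ** T (Suc k)"
  by (simp add: matrix_transpose_mul T_symmetric)

lemma jm_Suc: "jm (Suc k) = T (Suc k) ** jm k ** T (Suc k)"
  unfolding jm_def transpose_P_Suc by (simp add: matrix_mul_assoc)

section \<open>Commutation relations in the tower\<close>

lemma commutes_P:
  assumes "\<And>i. 0 < i \<Longrightarrow> i \<le> k \<Longrightarrow> A ** T i = T i ** A"
  shows "A ** P k = P k ** A"
  using assms
proof (induction k)
  case (Suc k)
  then show ?case unfolding descending_product.simps by (intro commutes_mult) auto
qed simp

lemma commutes_transpose_P:
  assumes "\<And>i. 0 < i \<Longrightarrow> i \<le> k \<Longrightarrow> A ** T i = T i ** A"
  shows "A ** transpose (P k) = transpose (P k) ** A"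
  using assms
proof (induction k)
  case 0
  then show ?case by (simp add: transpose_mat)
next
  case (Suc k)
  then show ?case unfolding transpose_P_Suc by (intro commutes_mult) auto
qed

lemma commutes_jm:
  assumes "\<And>i. 0 < i \<Longrightarrow> i \<le> k \<Longrightarrow> A ** T i = T i ** A"
  shows "A ** jm k = jm k ** A"
  unfolding jm_def using assms by (intro commutes_mult commutes_P commutes_transpose_P)

text \<open>\<open>D k\<close> is built from the \<open>P j\<close> with \<open>j < k\<close>, hence
  from \<open>T 1\<close>, ..., \<open>T (k - 1)\<close>; this is the reason for the strict bound on
  \<open>i\<close>.\<close>

lemma commutes_D:
  assumes "\<And>i. 0 < i \<Longrightarrow> i < k \<Longrightarrow> A ** T i = T i ** A" "k \<le> n"
  shows "A ** D k = D k ** A"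
  using assms
proof (induction k)
  case 0
  then show ?case by (simp add: D_0)
next
  case (Suc k)
  then have "D (Suc k) = D k ** P k" by (simp add: D_Suc)
  moreover have "A ** D k = D k ** A" using Suc.prems by (intro Suc.IH) auto
  moreover have "A ** P k = P k ** A" using Suc.prems by (intro commutes_P) auto
  ultimately show ?case using commutes_mult[of A "D k" "P k"] by simp
qed

text \<open>Passing through one factor \<open>D k\<close> reflects \<open>i\<close> to
  \<open>k - i\<close>, and passing through the other reflects it back.\<close>

lemma twist_T:
  assumes "0 < i" "i < k" "k \<le> n"
  shows "twist k ** T i = T i ** twist k"
proof -
  have "twist k ** T i = D k ** (T (k - i) ** D k)"
    unfolding twist_def D_T[OF assms, symmetric] by (simp add: matrix_mul_assoc)
  also have "\<dots> = T i ** twist k"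
    unfolding twist_def using D_T[of "k - i" k] assms by (simp add: matrix_mul_assoc)
  finally show ?thesis .
qed

text \<open>If \<open>T i\<close> kills \<open>x\<close>, the quadratic relation reduces to
  \<open>q x = 0\<close>. Injectivity of \<open>P k\<close> and \<open>D k\<close> follows and
  permits cancelling them.\<close>

lemma T_ker: "\<lbrakk>0 < i; i < n; T i *v x = 0\<rbrakk> \<Longrightarrow> x = 0"
  using T_quadratic[of i x] q_pos by (simp add: matrix_vector_mult_0_right)

lemma P_ker: "\<lbrakk>k < n; P k *v x = 0\<rbrakk> \<Longrightarrow> x = 0"
proof (induction k)
  case (Suc k)
  then have "T (Suc k) *v (P k *v x) = 0" by (simp add: matrix_vector_mul_assoc)
  then have "P k *v x = 0" using Suc.prems T_ker[of "Suc k"] by simp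
  then show ?case using Suc by simp
qed simp

lemma D_ker: "\<lbrakk>k \<le> n; D k *v x = 0\<rbrakk> \<Longrightarrow> x = 0"
proof (induction k arbitrary: x)
  case (Suc k)
  then have "D k *v (P k *v x) = 0" by (simp add: matrix_vector_mul_assoc D_Suc)
  then have "P k *v x = 0" using Suc by simp
  then show ?case using Suc.prems P_ker[of k] by simp
qed (simp add: D_0)

text \<open>Transposing \<open>D (Suc k) = D k ** P k\<close> gives a second factorisation with
  \<open>D k\<close> on the right; one of the two is used for each factor of the twist.\<close>

lemma twist_Suc_conj:
  assumes "k < n"
  shows "twist (Suc k) = D k ** jm k ** D k"
proof -
  have "D (Suc k) = transpose (P k) ** D k"
    using D_symmetric[of "Suc k"] assms by (simp add: D_Suc matrix_transpose_mul D_symmetric)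
  then have "twist (Suc k) = (D k ** P k) ** (transpose (P k) ** D k)"
    unfolding twist_def by (rule arg_cong2[OF D_Suc[OF assms], of _ _ "(**)"])
  then show ?thesis by (simp add: jm_def matrix_mul_assoc)
qed

text \<open>\<open>twist (Suc k)\<close> commutes with \<open>T 1\<close>, ..., \<open>T k\<close>
  and hence with \<open>D k\<close>. Written out by \<open>twist_Suc_conj\<close>, this is the claim
  multiplied by \<open>D k\<close> on both sides.\<close>

lemma D_jm:
  assumes k: "k < n"
  shows "D k ** jm k = jm k ** D k"
proof -
  have "twist (Suc k) ** D k = D k ** twist (Suc k)"
    using k by (intro commutes_D twist_T) auto
  then have "D k ** (jm k ** D k ** D k) = D k ** (D k ** jm k ** D k)"
    unfolding twist_Suc_conj[OF k] by (simp add: matrix_mul_assoc)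
  then have "jm k ** D k ** D k = D k ** jm k ** D k"
    by (rule matrix_left_cancel[rotated]) (use k D_ker[of k] in simp)
  then have "jm k ** D k = D k ** jm k"
    by (rule matrix_right_cancel[rotated]) (use k D_ker[of k] in simp)
  then show ?thesis by simp
qed

lemma twist_Suc: "k < n \<Longrightarrow> twist (Suc k) = jm k ** twist k"
  using twist_Suc_conj[of k] D_jm[of k] by (simp add: twist_def matrix_mul_assoc)

lemma twist_jm: "\<lbrakk>k < n; k < m; m \<le> n\<rbrakk> \<Longrightarrow> twist m ** jm k = jm k ** twist m"
  by (intro commutes_jm twist_T) auto

text \<open>After multiplication by the invertible \<open>twist (Suc k)\<close>, the two sides
  become the two products of \<open>jm k\<close> with \<open>twist (Suc (Suc k))\<close>, and these
  two commute.\<close>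

lemma jm_commute:
  assumes k: "Suc k < n"
  shows "jm k ** jm (Suc k) = jm (Suc k) ** jm k"
proof -
  have "(jm k ** jm (Suc k)) ** twist (Suc k) = jm k ** twist (Suc (Suc k))"
    using k by (simp add: twist_Suc[of "Suc k"] matrix_mul_assoc)
  also have "\<dots> = twist (Suc (Suc k)) ** jm k"
    using k by (simp add: twist_jm)
  also have "\<dots> = jm (Suc k) ** (twist (Suc k) ** jm k)"
    using k by (simp add: twist_Suc[of "Suc k"] matrix_mul_assoc)
  also have "\<dots> = jm (Suc k) ** (jm k ** twist (Suc k))"
    using k twist_jm[of k "Suc k"] by simp
  also have "\<dots> = (jm (Suc k) ** jm k) ** twist (Suc k)"
    by (rule matrix_mul_assoc)
  finally have "(jm k ** jm (Suc k)) ** twist (Suc k) = (jm (Suc k) ** jm k) ** twist (Suc k)" .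
  moreover have "x = 0" if "twist (Suc k) *v x = 0" for x
    using that D_ker[of "Suc k"] k unfolding twist_def
    by (simp flip: matrix_vector_mul_assoc)
  ultimately show ?thesis by (rule matrix_right_cancel[rotated])
qed

lemma power_spectrum_jm: "k < n \<Longrightarrow> power_spectrum q (jm k)"
proof (induction k)
  case 0
  then show ?case by (simp add: jm_def transpose_mat power_spectrum_one)
next
  case (Suc k)
  then show ?case
    using power_spectrum_conjugate_step[of q "jm k" "T (Suc k)"] q_pos T_quadratic[of "Suc k"] jm_commute[of k]
    by (simp add: jm_Suc)
qed

theorem power_spectrum_twist: "k \<le> n \<Longrightarrow> power_spectrum q (twist k)"
proof (induction k)
  case 0
  then show ?case by (simp add: twist_def D_0 power_spectrum_one)
next
  case (Suc k)
  moreover have "jm k ** twist k = twist k ** jm k"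
    unfolding twist_def using Suc.prems D_jm[of k] by (intro commutes_mult) auto
  ultimately show ?case
    using power_spectrum_mult[OF q_pos power_spectrum_jm] by (simp add: twist_Suc)
qed

end

section \<open>Counting subspaces of a finite vector space\<close>

lemma dim_le_CARD: "vec.dim (W :: ('k::field ^ 'n::finite) set) \<le> CARD('n)"
  using vec.dim_subset_UNIV[of W] by (simp add: vec.dimension_def card_cart_basis)

declare card_cart_basis [simp]

lemma set_plus_eq_sums: "U + W = {x + y |x y. x \<in> U \<and> y \<in> W}"
  by (auto simp: set_plus_def)

lemma subspace_set_plus:
  "vec.subspace U \<Longrightarrow> vec.subspace W \<Longrightarrow> vec.subspace (U + W :: ('k::field ^ 'n) set)"
  unfolding set_plus_eq_sums by (rule vec.subspace_sums)

lemma dim_set_plus_Int: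
  fixes U W :: "('k::field ^ 'n::finite) set"
  assumes "vec.subspace U" "vec.subspace W"
  shows "vec.dim (U + W) + vec.dim (U \<inter> W) = vec.dim U + vec.dim W"
  unfolding set_plus_eq_sums by (rule vec.dim_sums_Int[OF assms])

lemma subset_set_plus_left: "vec.subspace W \<Longrightarrow> U \<subseteq> U + (W :: ('k::field ^ 'n) set)"
  using vec.subspace_0[of W] by (force simp: set_plus_def)

lemma subset_set_plus_right: "vec.subspace U \<Longrightarrow> W \<subseteq> U + (W :: ('k::field ^ 'n) set)"
  using vec.subspace_0[of U] by (force simp: set_plus_def)

lemma set_plus_subset:
  "vec.subspace C \<Longrightarrow> U \<subseteq> C \<Longrightarrow> W \<subseteq> C \<Longrightarrow> U + W \<subseteq> (C :: ('k::field ^ 'n) set)"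
  by (auto simp: set_plus_def intro: vec.subspace_add)

lemma subspace_eq_UNIV:
  "vec.subspace W \<Longrightarrow> CARD('n) \<le> vec.dim W \<Longrightarrow> W = (UNIV :: ('k::field ^ 'n::finite) set)"
  by (rule vec.subspace_dim_equal) auto

lemma subspace_eq_zero:
  "vec.subspace W \<Longrightarrow> vec.dim W = 0 \<Longrightarrow> W = ({0} :: ('k::field ^ 'n::finite) set)"
  using vec.subspace_0[of W] by auto

lemma card_subspace:
  fixes W :: "('k::{field,finite} ^ 'n::finite) set"
  assumes "vec.subspace W"
  shows "card W = CARD('k) ^ vec.dim W"
proof -
  obtain B where B: "finite B" "B \<subseteq> W" "vec.independent B" "vec.span B = W" "card B = vec.dim W"
    using vec.basis_subspace_exists[OF assms] by blast
  let ?f = "\<lambda>u. \<Sum>b\<in>B. u b *s b"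
  have "bij_betw ?f (PiE B (\<lambda>_. UNIV)) W"
    unfolding bij_betw_def
  proof
    show "inj_on ?f (PiE B (\<lambda>_. UNIV))"
    proof (rule inj_onI)
      fix u v
      assume uv: "u \<in> PiE B (\<lambda>_. UNIV)" "v \<in> PiE B (\<lambda>_. UNIV)" "?f u = ?f v"
      have "(\<Sum>b\<in>B. (u b - v b) *s b) = 0"
        using uv(3) by (simp add: vec.scale_left_diff_distrib sum_subtractf)
      then have "\<forall>b\<in>B. u b - v b = 0"
        using vec.independentD[OF B(3) B(1) order_refl, of "\<lambda>b. u b - v b"] by blast
      then show "u = v" by (intro PiE_ext[OF uv(1,2)]) auto
    qed
    have "?f ` (PiE B (\<lambda>_. UNIV)) = range ?f"
    proof (intro equalityI subsetI)
      fix x assume "x \<in> range ?f"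
      then obtain u where "x = ?f u" by auto
      then show "x \<in> ?f ` (PiE B (\<lambda>_. UNIV))"
        by (intro image_eqI[where x="restrict u B"]) auto
    qed auto
    then show "?f ` (PiE B (\<lambda>_. UNIV)) = W"
      using B by (simp add: vec.span_finite)
  qed
  then have "card (PiE B (\<lambda>_. UNIV :: 'k set)) = card W" by (rule bij_betw_same_card)
  then show ?thesis using B by (simp add: card_PiE)
qed

lemma span_insert_eq:
  fixes A U :: "('k::field ^ 'n::finite) set"
  assumes "vec.subspace A" "vec.subspace U" "A \<subseteq> U" "vec.dim U = Suc (vec.dim A)" "x \<in> U" "x \<notin> A"
  shows "U = vec.span (insert x A)"
proof (rule sym, rule vec.subspace_dim_equal)
  show "vec.span (insert x A) \<subseteq> U" using assms by (intro vec.span_minimal) auto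
  show "vec.dim (vec.span (insert x A)) \<ge> vec.dim U"
    using assms by (simp add: vec.dim_insert vec.span_eq_iff[THEN iffD2])
qed (use assms in auto)

lemma dim_span_insert:
  fixes A :: "('k::field ^ 'n::finite) set"
  assumes "vec.subspace A" "x \<notin> A"
  shows "vec.dim (vec.span (insert x A)) = Suc (vec.dim A)"
  using assms by (simp add: vec.dim_insert vec.span_eq_iff[THEN iffD2])

lemma extend_subspace:
  fixes A C :: "('k::field ^ 'n::finite) set"
  assumes "vec.subspace A" "vec.subspace C" "A \<subseteq> C" "vec.dim A < vec.dim C"
  obtains U where "vec.subspace U" "A \<subseteq> U" "U \<subseteq> C" "vec.dim U = Suc (vec.dim A)"
proof -
  obtain x where x: "x \<in> C" "x \<notin> A" using assms by (metis less_irrefl subsetI subset_antisym)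
  show thesis
  proof (rule that[of "vec.span (insert x A)"])
    show "A \<subseteq> vec.span (insert x A)" by (meson insertCI subsetI vec.span_base)
    show "vec.span (insert x A) \<subseteq> C" using assms x by (intro vec.span_minimal) auto
  qed (use assms x dim_span_insert in auto)
qed

text \<open>A one-step extension \<open>U\<close> of \<open>A\<close> is determined by any of its
  vectors outside \<open>A\<close>. So \<open>U\<close> meets \<open>H\<close> only in
  \<open>A\<close>, and the sets \<open>U - A\<close>, each with \<open>(q - 1) q^(dim A)\<close>
  elements, partition \<open>C - H\<close>. The product form avoids division of natural
  numbers.\<close>

lemma lines_outside_count:
  fixes A H C :: "('k::{field,finite} ^ 'n::finite) set"
  assumes A: "vec.subspace A" and H: "vec.subspace H" and C: "vec.subspace C"
    and AH: "A \<subseteq> H" and HC: "H \<subseteq> C"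
  shows "card {U. vec.subspace U \<and> A \<subseteq> U \<and> U \<subseteq> C \<and> \<not> U \<subseteq> H \<and> vec.dim U = Suc (vec.dim A)}
           * ((CARD('k) - 1) * CARD('k) ^ vec.dim A)
         = CARD('k) ^ vec.dim C - CARD('k) ^ vec.dim H"
proof -
  let ?S = "{U. vec.subspace U \<and> A \<subseteq> U \<and> U \<subseteq> C \<and> \<not> U \<subseteq> H \<and> vec.dim U = Suc (vec.dim A)}"
  have H_meet: "U \<inter> H \<subseteq> A" if U: "U \<in> ?S" for U
  proof
    fix x assume x: "x \<in> U \<inter> H"
    show "x \<in> A"
    proof (rule ccontr)
      assume "x \<notin> A"
      then have "U = vec.span (insert x A)" using span_insert_eq[of A U x] A U x by auto
      also have "\<dots> \<subseteq> H" using x AH H by (intro vec.span_minimal) auto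
      finally show False using U by auto
    qed
  qed
  have union: "(\<Union>U\<in>?S. U - A) = C - H"
  proof (intro equalityI subsetI)
    fix x assume "x \<in> (\<Union>U\<in>?S. U - A)"
    then show "x \<in> C - H" using H_meet by blast
  next
    fix x assume x: "x \<in> C - H"
    let ?U = "vec.span (insert x A)"
    have "x \<notin> A" using x AH by auto
    have "x \<in> ?U" by (simp add: vec.span_base)
    moreover have "A \<subseteq> ?U" by (meson insertCI subsetI vec.span_base)
    moreover have "?U \<subseteq> C" using x AH HC C by (intro vec.span_minimal) auto
    ultimately have "?U \<in> ?S" using x dim_span_insert[OF A \<open>x \<notin> A\<close>] by auto
    then show "x \<in> (\<Union>U\<in>?S. U - A)" using \<open>x \<in> ?U\<close> \<open>x \<notin> A\<close> by blast
  qed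
  have "card (\<Union>U\<in>?S. U - A) = (\<Sum>U\<in>?S. card (U - A))"
  proof (rule card_UN_disjoint)
    show "\<forall>U\<in>?S. \<forall>V\<in>?S. U \<noteq> V \<longrightarrow> (U - A) \<inter> (V - A) = {}"
    proof (intro ballI impI)
      fix U V assume UV: "U \<in> ?S" "V \<in> ?S" "U \<noteq> V"
      show "(U - A) \<inter> (V - A) = {}"
      proof (rule ccontr)
        assume "\<not> ?thesis"
        then obtain x where "x \<in> U" "x \<in> V" "x \<notin> A" by blast
        then have "U = vec.span (insert x A)" "V = vec.span (insert x A)"
          using span_insert_eq[of A _ x] A UV by auto
        then show False using UV(3) by simp
      qed
    qed
  qed auto
  also have "\<dots> = (\<Sum>U\<in>?S. (CARD('k) - 1) * CARD('k) ^ vec.dim A)"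
  proof (rule sum.cong[OF refl])
    fix U assume U: "U \<in> ?S"
    then have "card (U - A) = card U - card A" by (intro card_Diff_subset) auto
    then show "card (U - A) = (CARD('k) - 1) * CARD('k) ^ vec.dim A"
      using U A by (simp add: card_subspace diff_mult_distrib)
  qed
  finally have "card ?S * ((CARD('k) - 1) * CARD('k) ^ vec.dim A) = card (C - H)"
    unfolding union by simp
  also have "\<dots> = CARD('k) ^ vec.dim C - CARD('k) ^ vec.dim H"
    using HC C H by (simp add: card_Diff_subset card_subspace)
  finally show ?thesis .
qed

lemma CARD_field_ge_2: "CARD('k::{field,finite}) \<ge> 2"
proof -
  have "card {0, 1 :: 'k} \<le> CARD('k)" by (intro card_mono) auto
  then show ?thesis by simp
qed

text \<open>The points of a projective line: the general count with \<open>H = A\<close>, where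
  \<open>q^2 - 1 = (q + 1) (q - 1)\<close>.\<close>

lemma card_intermediate_subspaces:
  fixes A C :: "('k::{field,finite} ^ 'n::finite) set"
  assumes A: "vec.subspace A" and C: "vec.subspace C" and AC: "A \<subseteq> C"
    and dim: "vec.dim C = Suc (Suc (vec.dim A))"
  shows "card {U. vec.subspace U \<and> A \<subseteq> U \<and> U \<subseteq> C \<and> vec.dim U = Suc (vec.dim A)} = CARD('k) + 1"
proof -
  let ?q = "CARD('k)"
  have "{U. vec.subspace U \<and> A \<subseteq> U \<and> U \<subseteq> C \<and> vec.dim U = Suc (vec.dim A)}
      = {U. vec.subspace U \<and> A \<subseteq> U \<and> U \<subseteq> C \<and> \<not> U \<subseteq> A \<and> vec.dim U = Suc (vec.dim A)}" (is "?S = ?R")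
    using vec.dim_subset[of _ A] by fastforce
  then have "card ?S * ((?q - 1) * ?q ^ vec.dim A) = ?q ^ vec.dim C - ?q ^ vec.dim A"
    using lines_outside_count[OF A A C order_refl AC] by simp
  also have "\<dots> = (?q + 1) * ((?q - 1) * ?q ^ vec.dim A)"
    using CARD_field_ge_2[where 'k='k] unfolding dim
    by (simp add: algebra_simps diff_mult_distrib)
  finally have "card ?S * ((?q - 1) * ?q ^ vec.dim A) = (?q + 1) * ((?q - 1) * ?q ^ vec.dim A)" .
  moreover have "(?q - 1) * ?q ^ vec.dim A \<noteq> 0"
    using CARD_field_ge_2[where 'k='k] by simp
  ultimately show ?thesis by (simp only: mult_cancel2) simp
qed

text \<open>The points of a projective space off a hyperplane form an affine space.\<close>

lemma card_complementary_lines: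
  fixes A H C :: "('k::{field,finite} ^ 'n::finite) set"
  assumes A: "vec.subspace A" and H: "vec.subspace H" and C: "vec.subspace C"
    and AH: "A \<subseteq> H" and HC: "H \<subseteq> C" and dim: "vec.dim C = Suc (vec.dim H)"
  shows "card {U. vec.subspace U \<and> A \<subseteq> U \<and> U \<subseteq> C \<and> \<not> U \<subseteq> H \<and> vec.dim U = Suc (vec.dim A)}
         = CARD('k) ^ (vec.dim H - vec.dim A)" (is "card ?S = _")
proof -
  let ?q = "CARD('k)"
  have le: "vec.dim A \<le> vec.dim H" using AH by (rule vec.dim_subset)
  have "card ?S * ((?q - 1) * ?q ^ vec.dim A) = ?q ^ vec.dim C - ?q ^ vec.dim H"
    using lines_outside_count[OF A H C AH HC] .
  also have "\<dots> = ?q ^ (vec.dim H - vec.dim A) * ((?q - 1) * ?q ^ vec.dim A)"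
    using le unfolding dim by (simp add: algebra_simps diff_mult_distrib flip: power_add)
  finally have "card ?S * ((?q - 1) * ?q ^ vec.dim A) = ?q ^ (vec.dim H - vec.dim A) * ((?q - 1) * ?q ^ vec.dim A)" .
  moreover have "(?q - 1) * ?q ^ vec.dim A \<noteq> 0"
    using CARD_field_ge_2[where 'k='k] by simp
  ultimately show ?thesis by (simp only: mult_cancel2) simp
qed

section \<open>Complete flags\<close>

text \<open>Indices run over all natural numbers, and a flag stays at the whole space from dimension
  \<open>CARD('n)\<close> on; no length bound has to be carried along.\<close>

definition is_full_flag :: "(nat \<Rightarrow> ('k::field ^ 'n::finite) set) \<Rightarrow> bool" where
  "is_full_flag F \<longleftrightarrow> (\<forall>i. vec.subspace (F i) \<and> F i \<subseteq> F (Suc i) \<and> vec.dim (F i) = min i CARD('n))"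

text \<open>The members are chosen recursively. The invariant \<open>I\<close> keeps each one
  comparable with \<open>U\<close> and \<open>W\<close>, so that in the dimensions of
  \<open>U\<close> and \<open>W\<close> no other choice remains.\<close>

lemma full_flag_through:
  fixes U W :: "('k::field ^ 'n::finite) set"
  assumes UW: "vec.subspace U" "vec.subspace W" "U \<subseteq> W"
  shows "\<exists>F. is_full_flag F \<and> F (vec.dim U) = U \<and> F (vec.dim W) = W"
proof -
  define I where "I = (\<lambda>i X. vec.subspace X \<and> vec.dim X = min i CARD('n) \<and>
    (i \<le> vec.dim U \<longrightarrow> X \<subseteq> U) \<and> (vec.dim U \<le> i \<longrightarrow> U \<subseteq> X) \<and>
    (i \<le> vec.dim W \<longrightarrow> X \<subseteq> W) \<and> (vec.dim W \<le> i \<longrightarrow> W \<subseteq> X))"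
  have UWdim: "vec.dim U \<le> vec.dim W" using UW(3) by (rule vec.dim_subset)
  have "\<exists>F. \<forall>i. I i (F i) \<and> F i \<subseteq> F (Suc i)"
  proof (rule dependent_nat_choice[of I "\<lambda>_ X Y. X \<subseteq> Y"])
    have "I 0 {0}"
      using UW vec.subspace_0[of U] vec.subspace_0[of W] by (auto simp: I_def)
    then show "\<exists>X. I 0 X" by blast
  next
    fix X i assume X: "I i X"
    show "\<exists>Y. I (Suc i) Y \<and> X \<subseteq> Y"
    proof (cases "i < CARD('n)")
      case False
      then have "X = UNIV" using X by (intro subspace_eq_UNIV) (auto simp: I_def)
      then show ?thesis using X False dim_le_CARD[of U] dim_le_CARD[of W]
        by (intro exI[of _ X]) (auto simp: I_def)
    next
      case True
      \<comment> \<open>The next member has to stay inside the first of \<open>U\<close>,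
        \<open>W\<close> and the whole space whose dimension still exceeds \<open>i\<close>.\<close>
      define C where "C = (if i < vec.dim U then U else if i < vec.dim W then W else UNIV)"
      have C: "vec.subspace C" "X \<subseteq> C" "i < vec.dim C"
        using X UW True by (auto simp: C_def I_def)
      obtain Y where Y: "vec.subspace Y" "X \<subseteq> Y" "Y \<subseteq> C" "vec.dim Y = Suc (vec.dim X)"
        using extend_subspace[of X C] C X True by (auto simp: I_def)
      have dimY: "vec.dim Y = Suc i" using Y X True by (simp add: I_def)
      have YU: "Y = U" if "vec.dim U = Suc i"
        using that Y dimY UW by (intro vec.subspace_dim_equal) (auto simp: C_def)
      have YW: "Y = W" if "vec.dim W = Suc i" "vec.dim U \<noteq> Suc i"
        using that Y dimY UW UWdim by (intro vec.subspace_dim_equal) (auto simp: C_def split: if_splits)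
      have YW': "Y = W" if "vec.dim W = Suc i" "vec.dim U = Suc i"
        using YU that UW vec.subspace_dim_equal[of U W] by auto
      have "I (Suc i) Y"
        using X Y dimY True UW UWdim YU YW YW'
        unfolding I_def by (intro conjI impI) (auto simp: C_def le_Suc_eq Suc_le_eq split: if_splits)
      then show ?thesis using Y by blast
    qed
  qed
  then obtain F where F: "\<And>i. I i (F i)" "\<And>i. F i \<subseteq> F (Suc i)" by blast
  have "F (vec.dim U) = U" "F (vec.dim W) = W"
    using F(1)[of "vec.dim U"] F(1)[of "vec.dim W"] by (auto simp: I_def)
  then show ?thesis using F by (intro exI[of _ F]) (auto simp: is_full_flag_def I_def)
qed

text \<open>Complete flags are made a type, finite over a finite field, in order to index square
  matrices.\<close>

typedef (overloaded) ('k, 'n) fflag = "{F :: nat \<Rightarrow> ('k::field ^ 'n::finite) set. is_full_flag F}"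
  morphisms flag_at Abs_fflag
  using full_flag_through[of "{0}" "{0}"] by auto

lemma flag_at_subspace [simp]: "vec.subspace (flag_at F i)"
  and flag_at_dim: "vec.dim (flag_at (F :: ('k::field, 'n::finite) fflag) i) = min i CARD('n)"
  using flag_at[of F] by (auto simp: is_full_flag_def)

lemma flag_at_mono: "i \<le> j \<Longrightarrow> flag_at F i \<subseteq> flag_at F j"
  by (rule lift_Suc_mono_le[of "flag_at F"]) (use flag_at[of F] in \<open>auto simp: is_full_flag_def\<close>)

lemma flag_at_0 [simp]: "flag_at F 0 = {0}"
  by (rule subspace_eq_zero) (simp_all add: flag_at_dim)

lemma flag_at_top: "CARD('n) \<le> i \<Longrightarrow> flag_at (F :: ('k::field, 'n::finite) fflag) i = UNIV"
  by (rule subspace_eq_UNIV) (simp_all add: flag_at_dim)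

lemma fflag_eqI: "(\<And>i. flag_at F i = flag_at G i) \<Longrightarrow> F = G"
  by (simp add: flag_at_inject[symmetric] ext)

lemma ex_flag_at: "is_full_flag g \<Longrightarrow> \<exists>F. flag_at F = g"
  by (metis Abs_fflag_inverse mem_Collect_eq)

instance fflag :: ("{field,finite}", finite) finite
proof
  let ?r = "\<lambda>F :: ('a, 'b) fflag. restrict (flag_at F) {..CARD('b)}"
  have "inj ?r"
  proof (rule injI, rule fflag_eqI)
    fix F G :: "('a, 'b) fflag" and i
    assume "?r F = ?r G"
    then show "flag_at F i = flag_at G i"
      by (cases "i \<le> CARD('b)") (auto simp: flag_at_top dest: fun_cong[of _ _ i])
  qed
  moreover have "finite (range ?r)"
    by (rule finite_subset[of _ "PiE {..CARD('b)} (\<lambda>_. UNIV)"]) (auto intro: finite_PiE)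
  ultimately show "finite (UNIV :: ('a, 'b) fflag set)"
    using finite_imageD by blast
qed

section \<open>Panels and opposition of complete flags\<close>

lemma ex_flag_upd:
  fixes F :: "('k::field, 'n::finite) fflag"
  assumes i: "0 < i" "i < CARD('n)" and U: "vec.subspace U" "flag_at F (i - 1) \<subseteq> U" "U \<subseteq> flag_at F (Suc i)" "vec.dim U = i"
  shows "\<exists>G :: ('k, 'n) fflag. flag_at G = (flag_at F)(i := U)"
proof (rule ex_flag_at)
  have "flag_at F j \<subseteq> U" if "Suc j = i" for j using that U by auto
  then show "is_full_flag ((flag_at F)(i := U))"
    using i U flag_at[of F] by (auto simp: is_full_flag_def)
qed

definition panel :: "nat \<Rightarrow> ('k::field, 'n::finite) fflag \<Rightarrow> ('k, 'n) fflag set" where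
  "panel i F = {G. \<forall>j. j \<noteq> i \<longrightarrow> flag_at G j = flag_at F j}"

lemma self_in_panel [simp]: "F \<in> panel i F"
  by (simp add: panel_def)

lemma panel_eqI: "\<lbrakk>G \<in> panel i F; G' \<in> panel i F; flag_at G i = flag_at G' i\<rbrakk> \<Longrightarrow> G = G'"
proof (rule fflag_eqI)
  fix j
  assume "G \<in> panel i F" "G' \<in> panel i F" "flag_at G i = flag_at G' i"
  then show "flag_at G j = flag_at G' j" by (cases "j = i") (auto simp: panel_def)
qed

lemma panel_between:
  assumes "G \<in> panel i F" "0 < i"
  shows "flag_at F (i - 1) \<subseteq> flag_at G i" "flag_at G i \<subseteq> flag_at F (Suc i)"
  using assms flag_at_mono[of "i - 1" i G] flag_at_mono[of i "Suc i" G]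
  by (auto simp: panel_def)

text \<open>A member of the panel amounts to its \<open>i\<close>-th space, a point of the
  projective line of \<open>flag_at F (Suc i)\<close> modulo
  \<open>flag_at F (i - 1)\<close>.\<close>

lemma card_panel:
  fixes F :: "('k::{field,finite}, 'n::finite) fflag"
  assumes i: "0 < i" "i < CARD('n)"
  shows "card (panel i F) = CARD('k) + 1"
proof -
  let ?S = "{U. vec.subspace U \<and> flag_at F (i - 1) \<subseteq> U \<and> U \<subseteq> flag_at F (Suc i)
      \<and> vec.dim U = Suc (vec.dim (flag_at F (i - 1)))}"
  have "bij_betw (\<lambda>G. flag_at G i) (panel i F) ?S"
    unfolding bij_betw_def
  proof
    show "inj_on (\<lambda>G. flag_at G i) (panel i F)"
      by (rule inj_onI) (rule panel_eqI)
    show "(\<lambda>G. flag_at G i) ` panel i F = ?S"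
    proof (intro equalityI subsetI)
      fix U assume "U \<in> (\<lambda>G. flag_at G i) ` panel i F"
      then obtain G where "G \<in> panel i F" "U = flag_at G i" by blast
      then show "U \<in> ?S" using panel_between[of G i F] i by (simp add: flag_at_dim)
    next
      fix U assume U: "U \<in> ?S"
      then obtain G :: "('k, 'n) fflag" where G: "flag_at G = (flag_at F)(i := U)"
        using ex_flag_upd[of i U F] i by (auto simp: flag_at_dim)
      then have "G \<in> panel i F" by (simp add: panel_def)
      then show "U \<in> (\<lambda>G. flag_at G i) ` panel i F" using G by force
    qed
  qed
  then have "card (panel i F) = card ?S" by (rule bij_betw_same_card)
  also have "\<dots> = CARD('k) + 1"
    using i by (intro card_intermediate_subspaces flag_at_mono) (auto simp: flag_at_dim)
  finally show ?thesis .
qed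

definition adjacent :: "nat \<Rightarrow> ('k::field, 'n::finite) fflag \<Rightarrow> ('k, 'n) fflag \<Rightarrow> bool" where
  "adjacent i F G \<longleftrightarrow> F \<noteq> G \<and> G \<in> panel i F"

text \<open>Opposition of the parts of two flags below their common member of dimension \<open>k\<close>.\<close>

definition opposite :: "nat \<Rightarrow> ('k::field, 'n::finite) fflag \<Rightarrow> ('k, 'n) fflag \<Rightarrow> bool" where
  "opposite k F G \<longleftrightarrow> (\<forall>j\<ge>k. flag_at F j = flag_at G j) \<and>
     (\<forall>j\<le>k. flag_at F j \<inter> flag_at G (k - j) = {0})"

lemma adjacent_sym: "adjacent i F G \<longleftrightarrow> adjacent i G F"
  by (auto simp: adjacent_def panel_def)

lemma opposite_sym: "opposite k F G \<longleftrightarrow> opposite k G F"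
proof -
  have "opposite k G F" if "opposite k F G" for F G :: "('a, 'b) fflag"
  proof -
    have "flag_at G j \<inter> flag_at F (k - j) = {0}" if "j \<le> k" for j
    proof -
      have "flag_at F (k - j) \<inter> flag_at G (k - (k - j)) = {0}"
        using \<open>opposite k F G\<close> unfolding opposite_def by (meson diff_le_self)
      then show ?thesis using that by (simp add: Int_commute)
    qed
    then show ?thesis using \<open>opposite k F G\<close> by (auto simp: opposite_def)
  qed
  then show ?thesis by blast
qed

lemma zero_in_flag [simp]: "0 \<in> flag_at F i"
  by (rule vec.subspace_0) simp

lemma flag_meet_zero_iff: "flag_at F i \<inter> flag_at G j = {0} \<longleftrightarrow> flag_at F i \<inter> flag_at G j \<subseteq> {0}"
  by auto

lemma opposite_0: "opposite 0 F G \<longleftrightarrow> F = G"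
  by (auto simp: opposite_def intro: fflag_eqI)

text \<open>Within the panel, opposition can fail only between \<open>H\<close> and the
  \<open>i\<close>-th member. The intersection \<open>L\<close> of \<open>H\<close> with
  \<open>flag_at G (Suc i)\<close> has dimension 1, so failure means containing \<open>L\<close>,
  and only \<open>A + L\<close> does.\<close>

lemma card_panel_not_opposite:
  fixes F G :: "('k::{field,finite}, 'n::finite) fflag"
  assumes i: "0 < i" "i < k" "k \<le> CARD('n)"
    and top: "\<And>j. k \<le> j \<Longrightarrow> flag_at F j = flag_at G j"
    and opp: "\<And>j. j \<le> k \<Longrightarrow> j \<noteq> k - i \<Longrightarrow> flag_at F j \<inter> flag_at G (k - j) = {0}"
  shows "card {Y \<in> panel i G. \<not> opposite k F Y} = 1"
proof -
  define H where "H = flag_at F (k - i)"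
  define A where "A = flag_at G (i - 1)"
  define C where "C = flag_at G (Suc i)"
  define L where "L = H \<inter> C"
  have sub: "vec.subspace H" "vec.subspace A" "vec.subspace C" "vec.subspace L"
    by (auto simp: H_def A_def C_def L_def vec.subspace_inter)
  have dimH: "vec.dim H = k - i" and dimC: "vec.dim C = Suc i" and dimA: "vec.dim A = i - 1"
    using i by (simp_all add: H_def C_def A_def flag_at_dim)
  have AC: "A \<subseteq> C" unfolding A_def C_def by (intro flag_at_mono) simp
  \<comment> \<open>The dimensions of \<open>H\<close> and \<open>C\<close> add up to
    \<open>k + 1\<close>, but both lie in the common member of dimension \<open>k\<close>; hence
    \<open>L\<close> is nonzero.\<close>
  have "H + C \<subseteq> flag_at G k"
  proof (rule set_plus_subset)
    show "H \<subseteq> flag_at G k"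
      using flag_at_mono[of "k - i" k F] top[of k] by (simp add: H_def)
    show "C \<subseteq> flag_at G k" unfolding C_def using i by (intro flag_at_mono) simp
  qed simp
  then have "vec.dim (H + C) \<le> k"
    using vec.dim_subset[of "H + C" "flag_at G k"] i by (simp add: flag_at_dim)
  then have dimL_ge: "1 \<le> vec.dim L"
    using dim_set_plus_Int[OF sub(1,3)] dimH dimC i by (simp add: L_def)
  \<comment> \<open>A hyperplane of \<open>H\<close> that meets \<open>C\<close>, and so
    \<open>L\<close>, trivially; this bounds \<open>dim L\<close> by 1.\<close>
  let ?H' = "flag_at F (k - Suc i)"
  have "k - Suc i \<noteq> k - i" using i by arith
  then have "?H' \<inter> C = {0}" using opp[of "k - Suc i"] i by (simp add: C_def)
  then have "L \<inter> ?H' = {0}" using sub vec.subspace_0 by (auto simp: L_def)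
  moreover have "L + ?H' \<subseteq> H"
  proof (rule set_plus_subset[OF sub(1)])
    show "?H' \<subseteq> H" unfolding H_def by (intro flag_at_mono) simp
  qed (simp add: L_def)
  ultimately have "vec.dim L + vec.dim ?H' \<le> vec.dim H"
    using dim_set_plus_Int[of L ?H'] sub vec.dim_subset[of "L + ?H'" H] by simp
  then have dimL: "vec.dim L = 1"
    using dimL_ge i by (simp add: dimH flag_at_dim)
  \<comment> \<open>The index \<open>Suc k - i\<close> is one above that of \<open>H\<close>, and
    its partner is \<open>i - 1\<close>, the index of \<open>A\<close>.\<close>
  have "A \<inter> H \<subseteq> flag_at F (Suc k - i) \<inter> flag_at G (k - (Suc k - i))"
    unfolding A_def H_def using i by (intro Int_greatest le_infI1 le_infI2 flag_at_mono) auto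
  then have AH: "A \<inter> H = {0}"
  proof -
    have "Suc k - i \<le> k" "Suc k - i \<noteq> k - i" using i by arith+
    then have "flag_at F (Suc k - i) \<inter> flag_at G (k - (Suc k - i)) = {0}" by (rule opp)
    then show ?thesis using \<open>A \<inter> H \<subseteq> _\<close> sub(1,2)[THEN vec.subspace_0] by blast
  qed
  have "A \<inter> L \<subseteq> A \<inter> H" by (auto simp: L_def)
  then have "A \<inter> L = {0}" using AH sub vec.subspace_0 by auto
  then have dimAL: "vec.dim (A + L) = i"
    using dim_set_plus_Int[OF sub(2,4)] dimA dimL i by simp
  have subAL: "vec.subspace (A + L)" using sub by (intro subspace_set_plus)
  have AL_C: "A + L \<subseteq> C" using sub AC by (intro set_plus_subset) (auto simp: L_def)
  have A_AL: "A \<subseteq> A + L" "L \<subseteq> A + L"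
    using sub by (simp_all only: subset_set_plus_left subset_set_plus_right)
  have opp_iff: "opposite k F Y \<longleftrightarrow> H \<inter> flag_at Y i = {0}" if Y: "Y \<in> panel i G" for Y
  proof
    assume "opposite k F Y"
    then have "flag_at F (k - i) \<inter> flag_at Y (k - (k - i)) = {0}"
      by (auto simp only: opposite_def)
    then show "H \<inter> flag_at Y i = {0}" using i by (simp add: H_def)
  next
    assume HY: "H \<inter> flag_at Y i = {0}"
    have "flag_at F j \<inter> flag_at Y (k - j) = {0}" if "j \<le> k" for j
    proof (cases "j = k - i")
      case True
      then show ?thesis using HY i by (simp add: H_def)
    next
      case False
      then have "flag_at Y (k - j) = flag_at G (k - j)"
        using Y i that by (auto simp: panel_def)
      then show ?thesis using opp[OF that False] by simp
    qed
    moreover have "flag_at F j = flag_at Y j" if "k \<le> j" for j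
      using that top[OF that] Y i by (auto simp: panel_def)
    ultimately show "opposite k F Y" by (simp add: opposite_def)
  qed
  have not_opp: "\<not> opposite k F Y \<longleftrightarrow> flag_at Y i = A + L" if Y: "Y \<in> panel i G" for Y
  proof
    assume "flag_at Y i = A + L"
    then have "L \<subseteq> H \<inter> flag_at Y i" using A_AL by (auto simp: L_def)
    then have "H \<inter> flag_at Y i \<noteq> {0}" using dimL by (metis vec.dim_eq_0 zero_neq_one)
    then show "\<not> opposite k F Y" using opp_iff[OF Y] by simp
  next
    assume "\<not> opposite k F Y"
    then have ne: "H \<inter> flag_at Y i \<noteq> {0}" using opp_iff[OF Y] by simp
    have sHY: "vec.subspace (H \<inter> flag_at Y i)" using sub by (intro vec.subspace_inter) auto
    have "vec.dim (H \<inter> flag_at Y i) \<noteq> 0"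
      using ne subspace_eq_zero[OF sHY] by blast
    moreover have "H \<inter> flag_at Y i \<subseteq> L"
      using panel_between[OF Y i(1)] by (auto simp: L_def C_def)
    moreover have "vec.dim L \<le> vec.dim (H \<inter> flag_at Y i)"
      unfolding dimL using \<open>vec.dim (H \<inter> flag_at Y i) \<noteq> 0\<close> by arith
    ultimately have "H \<inter> flag_at Y i = L"
      using sHY sub by (intro vec.subspace_dim_equal)
    then have "A + L \<subseteq> flag_at Y i"
      using panel_between[OF Y i(1)] by (intro set_plus_subset) (auto simp: A_def)
    then have "A + L = flag_at Y i"
      using subAL dimAL i by (intro vec.subspace_dim_equal) (auto simp: flag_at_dim)
    then show "flag_at Y i = A + L" by simp
  qed
  obtain Y0 :: "('k, 'n) fflag" where Y0: "flag_at Y0 = (flag_at G)(i := A + L)"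
    using ex_flag_upd[of i "A + L" G] i subAL A_AL AL_C dimAL by (auto simp: A_def C_def)
  then have Y0_panel: "Y0 \<in> panel i G" by (simp add: panel_def)
  have Y0_at: "flag_at Y0 i = A + L" using Y0 by simp
  have "Y = Y0" if "Y \<in> panel i G" "\<not> opposite k F Y" for Y
    using that not_opp[of Y] Y0_at Y0_panel by (intro panel_eqI[of Y i G Y0]) simp_all
  moreover have "\<not> opposite k F Y0" using not_opp[OF Y0_panel] Y0_at by simp
  ultimately have "{Y \<in> panel i G. \<not> opposite k F Y} = {Y0}" using Y0_panel by blast
  then show ?thesis by simp
qed

lemma card_adjacent:
  fixes F :: "('k::{field,finite}, 'n::finite) fflag"
  assumes "0 < i" "i < CARD('n)"
  shows "card {G. adjacent i F G} = CARD('k)"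
proof -
  have "{G. adjacent i F G} = panel i F - {F}" by (auto simp: adjacent_def)
  then show ?thesis using card_panel[OF assms, of F] by simp
qed

text \<open>The count depends symmetrically on \<open>F\<close> and \<open>G\<close>, which gives \<open>D k ** T i = T (k - i) ** D k\<close>.\<close>

lemma card_adjacent_opposite:
  fixes F G :: "('k::{field,finite}, 'n::finite) fflag"
  assumes i: "0 < i" "i < k" "k \<le> CARD('n)"
    and top: "\<And>j. k \<le> j \<Longrightarrow> flag_at F j = flag_at G j"
    and opp: "\<And>j. j \<le> k \<Longrightarrow> j \<noteq> k - i \<Longrightarrow> flag_at F j \<inter> flag_at G (k - j) = {0}"
  shows "card {Y. opposite k F Y \<and> adjacent i Y G} = (if opposite k F G then CARD('k) - 1 else CARD('k))"
proof -
  let ?N = "{Y \<in> panel i G. \<not> opposite k F Y}"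
  have "{Y. opposite k F Y \<and> adjacent i Y G} = panel i G - insert G ?N"
    unfolding adjacent_sym[of i _ G] by (auto simp: adjacent_def)
  also have "card \<dots> = card (panel i G) - card (insert G ?N)"
    by (intro card_Diff_subset) auto
  also have "card (panel i G) = CARD('k) + 1" using i by (intro card_panel) auto
  \<comment> \<open>If \<open>G\<close> is opposite to \<open>F\<close>, the single non-opposite
    member of the panel is another flag; otherwise it is \<open>G\<close> itself.\<close>
  also have "card (insert G ?N) = (if opposite k F G then 2 else 1)"
    using card_panel_not_opposite[OF assms] by (simp add: card_insert_if)
  finally show ?thesis by simp
qed

lemma card_opposite_adjacent_swap:
  fixes F G :: "('k::{field,finite}, 'n::finite) fflag"
  assumes i: "0 < i" "i < k" "k \<le> CARD('n)"
  shows "card {Y. opposite k F Y \<and> adjacent i Y G} = card {Y. adjacent (k - i) F Y \<and> opposite k Y G}"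
proof -
  \<comment> \<open>Opposition with the pair at level \<open>k - i\<close> left open. It is
    necessary for either set to be nonempty, and exchanging \<open>F\<close> with \<open>G\<close>
    turns \<open>i\<close> into \<open>k - i\<close>.\<close>
  define P where "P = (\<lambda>(F :: ('k, 'n) fflag) (G :: ('k, 'n) fflag) i. (\<forall>j\<ge>k. flag_at F j = flag_at G j) \<and>
    (\<forall>j\<le>k. j \<noteq> k - i \<longrightarrow> flag_at F j \<inter> flag_at G (k - j) = {0}))"
  have P_I: "P F G i" if "opposite k F Y" "adjacent i Y G" "i < k" for F Y G :: "('k, 'n) fflag" and i
    unfolding P_def
  proof (intro conjI allI impI)
    fix j assume "k \<le> j"
    then show "flag_at F j = flag_at G j"
      using that by (auto simp: opposite_def adjacent_def panel_def)
  next
    fix j assume "j \<le> k" "j \<noteq> k - i"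
    then have "flag_at Y (k - j) = flag_at G (k - j)"
      using that by (auto simp: adjacent_def panel_def)
    moreover have "flag_at F j \<inter> flag_at Y (k - j) = {0}"
      using that \<open>j \<le> k\<close> by (simp add: opposite_def)
    ultimately show "flag_at F j \<inter> flag_at G (k - j) = {0}" by simp
  qed
  have P_sym: "P G F (k - i)" if "P F G i" "i < k" for F G :: "('k, 'n) fflag" and i
    unfolding P_def
  proof (intro conjI allI impI)
    fix j assume j: "j \<le> k" "j \<noteq> k - (k - i)"
    then have "k - j \<le> k" "k - j \<noteq> k - i" using that(2) by arith+
    then have "flag_at F (k - j) \<inter> flag_at G (k - (k - j)) = {0}"
      using that(1) unfolding P_def by blast
    then show "flag_at G j \<inter> flag_at F (k - j) = {0}" using j by (simp add: Int_commute)
  next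
    fix j assume "k \<le> j"
    then show "flag_at G j = flag_at F j" using that(1) by (simp add: P_def)
  qed
  have count: "card {Y. opposite k F Y \<and> adjacent i Y G} =
      (if P F G i then if opposite k F G then CARD('k) - 1 else CARD('k) else 0)"
    if "0 < i" "i < k" for F G :: "('k, 'n) fflag" and i
  proof (cases "P F G i")
    case True
    then show ?thesis
      using that i(3) card_adjacent_opposite[of i k F G] by (simp add: P_def)
  next
    case False
    then have "{Y. opposite k F Y \<and> adjacent i Y G} = {}" using P_I that by blast
    then show ?thesis using False by simp
  qed
  have "{Y. adjacent (k - i) F Y \<and> opposite k Y G} = {Y. opposite k G Y \<and> adjacent (k - i) Y F}"
    using adjacent_sym opposite_sym by blast
  moreover have "P F G i \<longleftrightarrow> P G F (k - i)"
    using P_sym[of F G i] P_sym[of G F "k - i"] i by auto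
  ultimately show ?thesis
    using count[of i F G] count[of "k - i" G F] i by (simp add: opposite_sym[of k G F])
qed

text \<open>The relation of the product \<open>T k ** ... ** T 1\<close> of panel adjacencies.\<close>

definition ladder :: "nat \<Rightarrow> ('k::field, 'n::finite) fflag \<Rightarrow> ('k, 'n) fflag \<Rightarrow> bool" where
  "ladder k F G \<longleftrightarrow> (\<forall>j>k. flag_at F j = flag_at G j) \<and>
     (\<forall>j. 0 < j \<and> j \<le> k \<longrightarrow> flag_at F (j - 1) \<subseteq> flag_at G j \<and> flag_at G j \<noteq> flag_at F j)"

lemma ladderD:
  assumes "ladder k F G" "0 < j" "j \<le> k"
  shows "flag_at F (j - 1) \<subseteq> flag_at G j" "flag_at G j \<noteq> flag_at F j"
  using assms by (simp_all add: ladder_def)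

lemma ladder_0: "ladder 0 F G \<longleftrightarrow> F = G"
proof
  assume *: "ladder 0 F G"
  show "F = G"
  proof (rule fflag_eqI)
    fix i show "flag_at F i = flag_at G i" using * by (cases i) (auto simp: ladder_def)
  qed
qed (auto simp: ladder_def)

text \<open>The intermediate flag is \<open>F\<close> with only its member of dimension
  \<open>Suc k\<close> replaced by that of \<open>G\<close>.\<close>

lemma ladder_Suc:
  fixes F G :: "('k::field, 'n::finite) fflag"
  assumes k: "Suc k < CARD('n)"
  shows "ladder (Suc k) F G \<longleftrightarrow> (\<exists>Y. adjacent (Suc k) F Y \<and> ladder k Y G)"
proof
  assume l: "ladder (Suc k) F G"
  have "flag_at F k \<subseteq> flag_at G (Suc k)" using ladderD(1)[OF l, of "Suc k"] by simp
  moreover have "flag_at G (Suc k) \<subseteq> flag_at F (Suc (Suc k))"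
    using l flag_at_mono[of "Suc k" "Suc (Suc k)" G] by (auto simp: ladder_def)
  ultimately obtain Y :: "('k, 'n) fflag" where Y: "flag_at Y = (flag_at F)(Suc k := flag_at G (Suc k))"
    using ex_flag_upd[of "Suc k" "flag_at G (Suc k)" F] k by (auto simp: flag_at_dim)
  have "flag_at Y (Suc k) \<noteq> flag_at F (Suc k)" using ladderD(2)[OF l, of "Suc k"] Y by simp
  then have "F \<noteq> Y" by auto
  then have "adjacent (Suc k) F Y" using Y by (simp add: adjacent_def panel_def)
  moreover have "ladder k Y G" using l Y by (auto simp: ladder_def)
  ultimately show "\<exists>Y. adjacent (Suc k) F Y \<and> ladder k Y G" by blast
next
  assume "\<exists>Y. adjacent (Suc k) F Y \<and> ladder k Y G"
  then obtain Y where Y: "adjacent (Suc k) F Y" "ladder k Y G" by blast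
  have FY: "flag_at Y j = flag_at F j" if "j \<noteq> Suc k" for j
    using Y(1) that by (simp add: adjacent_def panel_def)
  have G: "flag_at G (Suc k) = flag_at Y (Suc k)" using Y(2) by (simp add: ladder_def)
  have "flag_at Y (Suc k) \<noteq> flag_at F (Suc k)"
    using Y(1) panel_eqI[of Y "Suc k" F F] by (auto simp: adjacent_def)
  moreover have "flag_at F k \<subseteq> flag_at Y (Suc k)"
    using FY[of k] flag_at_mono[of k "Suc k" Y] by simp
  ultimately have step: "flag_at F k \<subseteq> flag_at G (Suc k)" "flag_at G (Suc k) \<noteq> flag_at F (Suc k)"
    using G by simp_all
  show "ladder (Suc k) F G"
    unfolding ladder_def
  proof (intro conjI allI impI)
    fix j assume "Suc k < j"
    then show "flag_at F j = flag_at G j" using Y(2) FY[of j] by (simp add: ladder_def)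
  next
    fix j assume j: "0 < j \<and> j \<le> Suc k"
    show "flag_at F (j - 1) \<subseteq> flag_at G j"
      using step ladderD(1)[OF Y(2), of j] FY[of "j - 1"] j by (cases "j = Suc k") auto
    show "flag_at G j \<noteq> flag_at F j"
      using step ladderD(2)[OF Y(2), of j] FY[of j] j by (cases "j = Suc k") auto
  qed
qed

text \<open>At the first \<open>m\<close> with \<open>flag_at G 1\<close> inside
  \<open>flag_at Y m\<close>, a vector of \<open>flag_at G 1\<close> outside
  \<open>flag_at Y (m - 1)\<close> extends the latter to both \<open>flag_at Y m\<close> and
  \<open>flag_at G m\<close>, which a ladder keeps different.\<close>

lemma ladder_first_step:
  fixes Y G :: "('k::field, 'n::finite) fflag"
  assumes l: "ladder k Y G" and k: "k < CARD('n)"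
  shows "\<not> flag_at G 1 \<subseteq> flag_at Y k"
proof
  assume "flag_at G 1 \<subseteq> flag_at Y k"
  define m where "m = (LEAST m. flag_at G 1 \<subseteq> flag_at Y m)"
  have m: "flag_at G 1 \<subseteq> flag_at Y m" and "m \<le> k"
    unfolding m_def using \<open>flag_at G 1 \<subseteq> flag_at Y k\<close>
    by (rule LeastI[of "\<lambda>m. flag_at G 1 \<subseteq> flag_at Y m"], rule Least_le)
  have "m \<noteq> 0"
  proof
    assume "m = 0"
    then have "vec.dim (flag_at G 1) \<le> 0"
      using vec.dim_subset[OF m] by (simp add: flag_at_dim)
    then show False by (simp add: flag_at_dim)
  qed
  have "\<not> flag_at G 1 \<subseteq> flag_at Y (m - 1)"
    using not_less_Least[of "m - 1" "\<lambda>m. flag_at G 1 \<subseteq> flag_at Y m"] \<open>m \<noteq> 0\<close> by (simp add: m_def)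
  then obtain x where x: "x \<in> flag_at G 1" "x \<notin> flag_at Y (m - 1)" by blast
  have dim: "vec.dim (flag_at Y m) = Suc (vec.dim (flag_at Y (m - 1)))" 
    "vec.dim (flag_at G m) = Suc (vec.dim (flag_at Y (m - 1)))"
    using \<open>m \<noteq> 0\<close> \<open>m \<le> k\<close> k by (simp_all add: flag_at_dim)
  have Gm: "flag_at Y (m - 1) \<subseteq> flag_at G m" "flag_at G m \<noteq> flag_at Y m"
    using l \<open>m \<noteq> 0\<close> \<open>m \<le> k\<close> by (auto simp: ladder_def)
  have "x \<in> flag_at G m" using x flag_at_mono[of 1 m G] \<open>m \<noteq> 0\<close> by auto
  then have "flag_at G m = vec.span (insert x (flag_at Y (m - 1)))"
    using x dim Gm by (intro span_insert_eq) auto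
  moreover have "flag_at Y m = vec.span (insert x (flag_at Y (m - 1)))"
    using x dim m by (intro span_insert_eq flag_at_mono) auto
  ultimately show False using Gm by simp
qed

text \<open>As \<open>flag_at G 1\<close> is not inside \<open>flag_at Y k\<close>, the intersection
  is proper in \<open>flag_at G (Suc j)\<close> and has dimension at most \<open>j\<close>.
  Consequently \<open>G\<close> and \<open>flag_at Y k\<close> determine the members of
  \<open>Y\<close> below \<open>k\<close>.\<close>

lemma ladder_meet:
  fixes Y G :: "('k::field, 'n::finite) fflag"
  assumes l: "ladder k Y G" and k: "k < CARD('n)" and j: "j < k"
  shows "flag_at G (Suc j) \<inter> flag_at Y k = flag_at Y j"
proof (rule sym, rule vec.subspace_dim_equal)
  show "flag_at Y j \<subseteq> flag_at G (Suc j) \<inter> flag_at Y k"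
    using ladderD(1)[OF l, of "Suc j"] j flag_at_mono[of j k Y] by simp
  let ?I = "flag_at G (Suc j) \<inter> flag_at Y k"
  have sub: "vec.subspace ?I" by (intro vec.subspace_inter) auto
  then show "vec.subspace ?I" .
  have "?I \<noteq> flag_at G (Suc j)"
    using ladder_first_step[OF l k] flag_at_mono[of 1 "Suc j" G] by auto
  then have "vec.dim ?I < vec.dim (flag_at G (Suc j))"
    using vec.subspace_dim_equal[OF sub, of "flag_at G (Suc j)"] by force
  then show "vec.dim ?I \<le> vec.dim (flag_at Y j)" using j k by (simp add: flag_at_dim)
qed simp

text \<open>The recursion for \<open>D\<close> on the level of relations. By
  \<open>ladder_meet\<close> the intermediate flag must be the trace of \<open>G\<close> on
  \<open>flag_at F k\<close>, with indices shifted by one because \<open>flag_at G 1\<close> meets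
  \<open>flag_at F k\<close> only in 0.\<close>

lemma opposite_Suc:
  fixes F G :: "('k::field, 'n::finite) fflag"
  assumes k: "k < CARD('n)"
  shows "opposite (Suc k) F G \<longleftrightarrow> (\<exists>Y. opposite k F Y \<and> ladder k Y G)"
proof
  assume o: "opposite (Suc k) F G"
  have top: "flag_at F j = flag_at G j" if "j > k" for j using o that by (auto simp: opposite_def)
  have meet: "flag_at F j \<inter> flag_at G (Suc k - j) = {0}" if "j \<le> Suc k" for j
    using o that by (auto simp: opposite_def)
  define g where "g = (\<lambda>j. if j < k then flag_at G (Suc j) \<inter> flag_at F k else flag_at F j)"
  have sub: "vec.subspace (g j)" for j unfolding g_def by (auto intro: vec.subspace_inter)
  have G1: "flag_at F k \<inter> flag_at G 1 = {0}" using meet[of k] by simp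
  have dim: "vec.dim (g j) = j" if "j < k" for j
  proof -
    \<comment> \<open>The lower bound is the dimension formula inside
      \<open>flag_at G (Suc k)\<close>. For the upper bound, \<open>g j\<close> and the line
      \<open>flag_at G 1\<close> are independent and both lie in
      \<open>flag_at G (Suc j)\<close>.\<close>
    have "flag_at F k + flag_at G (Suc j) \<subseteq> flag_at G (Suc k)"
      using flag_at_mono[of k "Suc k" F] top[of "Suc k"] that
      by (intro set_plus_subset flag_at_mono) auto
    then have "vec.dim (flag_at F k + flag_at G (Suc j)) \<le> Suc k"
      using vec.dim_subset[of _ "flag_at G (Suc k)"] k by (metis Suc_leI flag_at_dim min.absorb1)
    then have ge: "j \<le> vec.dim (g j)"
      using dim_set_plus_Int[of "flag_at F k" "flag_at G (Suc j)"] that k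
      by (simp add: g_def flag_at_dim Int_commute)
    have "g j \<inter> flag_at G 1 \<subseteq> {0}" using G1 that by (auto simp: g_def)
    then have "g j \<inter> flag_at G 1 = {0}" using sub[of j] vec.subspace_0 by auto
    moreover have "g j + flag_at G 1 \<subseteq> flag_at G (Suc j)"
      using that by (intro set_plus_subset flag_at_mono) (auto simp: g_def)
    ultimately have "vec.dim (g j) + 1 \<le> Suc j"
      using dim_set_plus_Int[OF sub[of j], of "flag_at G 1"]
        vec.dim_subset[of "g j + flag_at G 1" "flag_at G (Suc j)"] that k by (simp add: flag_at_dim)
    then show ?thesis using ge by simp
  qed
  have mono: "g j \<subseteq> g (Suc j)" for j
  proof -
    consider "Suc j < k" | "Suc j = k" | "k \<le> j" by linarith
    then show ?thesis
      using flag_at_mono[of "Suc j" "Suc (Suc j)" G] flag_at_mono[of j "Suc j" F]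
      by cases (auto simp: g_def)
  qed
  have "is_full_flag g"
    unfolding is_full_flag_def
  proof (intro allI conjI)
    fix j show "vec.dim (g j) = min j CARD('n)"
    proof (cases "j < k")
      case True
      then show ?thesis using dim[OF True] k by simp
    next
      case False
      then show ?thesis by (simp add: g_def flag_at_dim)
    qed
  qed (use sub mono in auto)
  then obtain Y :: "('k, 'n) fflag" where Y: "flag_at Y = g" using ex_flag_at by blast
  have "opposite k F Y"
    unfolding opposite_def
  proof (intro conjI allI impI)
    fix j assume j: "j \<le> k"
    show "flag_at F j \<inter> flag_at Y (k - j) = {0}"
    proof (cases "j = 0")
      case False
      then have "k - j < k" using j by simp
      then have "flag_at F j \<inter> flag_at Y (k - j) \<subseteq> flag_at F j \<inter> flag_at G (Suc k - j)"
        using j by (auto simp: Y g_def Suc_diff_le)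
      then show ?thesis using meet[of j] j unfolding flag_meet_zero_iff by auto
    qed auto
  qed (simp add: Y g_def)
  moreover have "ladder k Y G"
    unfolding ladder_def
  proof (intro conjI allI impI)
    fix j assume j: "0 < j \<and> j \<le> k"
    then show "flag_at Y (j - 1) \<subseteq> flag_at G j" by (auto simp: Y g_def)
    show "flag_at G j \<noteq> flag_at Y j"
    proof
      assume eq: "flag_at G j = flag_at Y j"
      have "flag_at G 1 \<subseteq> flag_at Y j" using j flag_at_mono[of 1 j G] eq by auto
      also have "\<dots> \<subseteq> flag_at F k"
        using j flag_at_mono[of j k F] by (auto simp: Y g_def)
      finally have "flag_at G 1 \<subseteq> {0}" using G1 by auto
      then have "vec.dim (flag_at G 1) = 0" by simp
      then show False by (simp add: flag_at_dim)
    qed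
  qed (simp add: Y g_def top)
  ultimately show "\<exists>Y. opposite k F Y \<and> ladder k Y G" by blast
next
  assume "\<exists>Y. opposite k F Y \<and> ladder k Y G"
  then obtain Y where o: "opposite k F Y" and l: "ladder k Y G" by blast
  show "opposite (Suc k) F G"
    unfolding opposite_def
  proof (intro conjI allI impI)
    fix j assume "Suc k \<le> j"
    then show "flag_at F j = flag_at G j" using o l by (auto simp: opposite_def ladder_def)
  next
    fix j assume j: "j \<le> Suc k"
    consider "j = 0" | "j = Suc k" | "0 < j" "j \<le> k" using j by linarith
    then show "flag_at F j \<inter> flag_at G (Suc k - j) = {0}"
    proof cases
      case 3
      have "flag_at F j \<subseteq> flag_at Y k"
        using flag_at_mono[of j k F] 3 o by (auto simp: opposite_def)
      moreover have "flag_at G (Suc (k - j)) \<inter> flag_at Y k = flag_at Y (k - j)"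
        using 3 by (intro ladder_meet[OF l k]) auto
      moreover have "flag_at F j \<inter> flag_at Y (k - j) = {0}" using o 3 by (auto simp: opposite_def)
      ultimately show ?thesis using 3 unfolding flag_meet_zero_iff by (auto simp: Suc_diff_le)
    qed auto
  qed
qed

lemma opposite_ladder_unique:
  fixes F G :: "('k::field, 'n::finite) fflag"
  assumes k: "k < CARD('n)" and Y: "opposite k F Y" "ladder k Y G" and Z: "opposite k F Z" "ladder k Z G"
  shows "Y = Z"
proof (rule fflag_eqI)
  fix j
  have eq: "flag_at Y j = flag_at Z j" if "k \<le> j" for j
    using Y(1) Z(1) that by (auto simp: opposite_def)
  show "flag_at Y j = flag_at Z j"
  proof (cases "j < k")
    case True
    then show ?thesis
      using ladder_meet[OF Y(2) k True] ladder_meet[OF Z(2) k True] eq[of k] by simp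
  qed (use eq in auto)
qed

lemma adjacent_ladder_unique:
  assumes "adjacent (Suc k) F Y" "ladder k Y G" "adjacent (Suc k) F Z" "ladder k Z G"
  shows "Y = Z"
  using assms by (intro panel_eqI[of Y "Suc k" F Z]) (auto simp: adjacent_def ladder_def)

section \<open>Matrices of relations on flags\<close>

definition rel_mat :: "('x \<Rightarrow> 'x \<Rightarrow> bool) \<Rightarrow> complex ^ 'x ^ 'x" where
  "rel_mat R = (\<chi> x y. of_bool (R x y))"

lemma rel_mat_nth [simp]: "rel_mat R $ x $ y = of_bool (R x y)"
  by (simp add: rel_mat_def)

lemma rel_mat_mult_nth:
  "(rel_mat R ** rel_mat S :: complex ^ 'x::finite ^ 'x) $ x $ z = of_nat (card {y. R x y \<and> S y z})"
proof -
  have "(rel_mat R ** rel_mat S :: complex ^ 'x ^ 'x) $ x $ z = (\<Sum>y\<in>UNIV. of_bool (R x y \<and> S y z))"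
    by (simp only: matrix_matrix_mult_def vec_lambda_beta rel_mat_nth of_bool_conj)
  also have "\<dots> = of_nat (card {y. R x y \<and> S y z})"
    by (simp del: of_bool_conj)
  finally show ?thesis .
qed

text \<open>Matrix entries count intermediate points, and uniqueness keeps the product a 0-1 matrix.
  This corresponds to multiplying basis elements of the Hecke algebra whose lengths add.\<close>

lemma rel_mat_mult:
  fixes R :: "'x::finite \<Rightarrow> 'x \<Rightarrow> bool"
  assumes "\<And>x z. Q x z \<longleftrightarrow> (\<exists>y. R x y \<and> S y z)"
    and "\<And>x y y' z. R x y \<Longrightarrow> S y z \<Longrightarrow> R x y' \<Longrightarrow> S y' z \<Longrightarrow> y = y'"
  shows "rel_mat R ** rel_mat S = rel_mat Q"
proof -
  have "card {y. R x y \<and> S y z} = of_bool (Q x z)" for x z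
  proof (cases "Q x z")
    case True
    then obtain y where "R x y" "S y z" using assms(1) by blast
    then have "{y. R x y \<and> S y z} = {y}" using assms(2) by blast
    then show ?thesis using True by simp
  next
    case False
    then have "{y. R x y \<and> S y z} = {}" using assms(1) by blast
    then show ?thesis using False by simp
  qed
  then show ?thesis by (simp add: Finite_Cartesian_Product.vec_eq_iff rel_mat_mult_nth)
qed

lemma transpose_rel_mat: "(\<And>x y. R x y \<longleftrightarrow> R y x) \<Longrightarrow> transpose (rel_mat R) = rel_mat R"
  by (simp add: Finite_Cartesian_Product.vec_eq_iff transpose_def)

lemma rel_mat_eq: "rel_mat (=) = mat 1"
  by (simp add: Finite_Cartesian_Product.vec_eq_iff Finite_Cartesian_Product.mat_def)

lemma descending_product_ladder:
  "k < CARD('n) \<Longrightarrow> descending_product (\<lambda>i. rel_mat (adjacent i)) k =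
     rel_mat (ladder k :: ('k::{field,finite}, 'n::finite) fflag \<Rightarrow> _)"
proof (induction k)
  case 0
  have "ladder 0 = ((=) :: ('k, 'n) fflag \<Rightarrow> _)" by (auto simp: ladder_0 fun_eq_iff)
  then show ?case by (simp add: rel_mat_eq)
next
  case (Suc k)
  have "rel_mat (adjacent (Suc k)) ** rel_mat (ladder k) =
      rel_mat (ladder (Suc k) :: ('k, 'n) fflag \<Rightarrow> _)"
    using ladder_Suc[OF Suc.prems] adjacent_ladder_unique by (intro rel_mat_mult) blast+
  then show ?case using Suc by simp
qed

text \<open>The quadratic relation \<open>T^2 = (q - 1) T + q\<close>, entry by entry: a panel has
  \<open>q + 1\<close> members, any two of them adjacent.\<close>

lemma card_adjacent_twice:
  fixes F G :: "('k::{field,finite}, 'n::finite) fflag"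
  assumes i: "0 < i" "i < CARD('n)"
  shows "card {Y. adjacent i F Y \<and> adjacent i Y G} =
    (if F = G then CARD('k) else if adjacent i F G then CARD('k) - 1 else 0)"
proof (cases "G \<in> panel i F")
  case True
  then have "{Y. adjacent i F Y \<and> adjacent i Y G} = {Y. adjacent i F Y} - {G}"
    by (auto simp: adjacent_def panel_def)
  then show ?thesis
    using True card_adjacent[OF i, of F] by (auto simp: adjacent_def)
next
  case False
  then have "{Y. adjacent i F Y \<and> adjacent i Y G} = {}"
    by (auto simp: adjacent_def panel_def)
  moreover have "F \<noteq> G" "\<not> adjacent i F G" using False by (auto simp: adjacent_def)
  ultimately show ?thesis by simp
qed

lemma hecke_tower_fflag:
  "hecke_tower CARD('k) CARD('n) (\<lambda>i. rel_mat (adjacent i))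
     (\<lambda>k. rel_mat (opposite k :: ('k::{field,finite}, 'n::finite) fflag \<Rightarrow> _))"
proof
  show "CARD('k) > 0" by simp
next
  fix i and x :: "complex ^ ('k, 'n) fflag"
  assume i: "0 < i" "i < CARD('n)"
  let ?q = "of_nat CARD('k) :: complex"
  define T where "T = (rel_mat (adjacent i) :: complex ^ ('k, 'n) fflag ^ ('k, 'n) fflag)"
  have nth: "(T ** T) $ F $ G = (?q - 1) * T $ F $ G + (if F = G then ?q else 0)" for F G
    unfolding T_def rel_mat_mult_nth card_adjacent_twice[OF i]
    by (auto simp: adjacent_def of_nat_diff)
  have "((T ** T) *v x) $ F = ((?q - 1) *s (T *v x) + ?q *s x) $ F" for F
    by (simp add: matrix_vector_mult_def nth distrib_right sum.distrib sum_distrib_left mult.assoc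
        left_diff_distrib sum_subtractf
        if_distrib[of "\<lambda>c. c * _"] cong: if_cong)
  then show "rel_mat (adjacent i) *v (rel_mat (adjacent i) *v x) =
      (?q - 1) *s (rel_mat (adjacent i) *v x) + ?q *s x"
    by (simp only: Finite_Cartesian_Product.vec_eq_iff matrix_vector_mul_assoc T_def) simp
next
  fix i show "transpose (rel_mat (adjacent i :: ('k, 'n) fflag \<Rightarrow> _)) = rel_mat (adjacent i)"
    by (rule transpose_rel_mat) (rule adjacent_sym)
next
  fix k show "transpose (rel_mat (opposite k :: ('k, 'n) fflag \<Rightarrow> _)) = rel_mat (opposite k)"
    by (rule transpose_rel_mat) (rule opposite_sym)
next
  have "opposite 0 = ((=) :: ('k, 'n) fflag \<Rightarrow> _)" by (auto simp: opposite_0 fun_eq_iff)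
  then show "rel_mat (opposite 0 :: ('k, 'n) fflag \<Rightarrow> _) = mat 1" by (simp add: rel_mat_eq)
next
  fix k assume k: "k < CARD('n)"
  have "rel_mat (opposite k) ** rel_mat (ladder k) = rel_mat (opposite (Suc k) :: ('k, 'n) fflag \<Rightarrow> _)"
    using opposite_Suc[OF k] opposite_ladder_unique[OF k] by (intro rel_mat_mult) blast+
  then show "rel_mat (opposite (Suc k) :: ('k, 'n) fflag \<Rightarrow> _) =
      rel_mat (opposite k) ** descending_product (\<lambda>i. rel_mat (adjacent i)) k"
    using descending_product_ladder[OF k, where 'k='k] by simp
next
  fix i k assume "0 < i" "i < k" "k \<le> CARD('n)"
  then show "rel_mat (opposite k :: ('k, 'n) fflag \<Rightarrow> _) ** rel_mat (adjacent i) =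
      rel_mat (adjacent (k - i)) ** rel_mat (opposite k)"
    by (simp add: Finite_Cartesian_Product.vec_eq_iff rel_mat_mult_nth card_opposite_adjacent_swap)
qed

theorem power_spectrum_opposite:
  fixes D :: "complex ^ ('k::{field,finite}, 'n::finite) fflag ^ ('k, 'n) fflag"
  defines "D \<equiv> rel_mat (opposite CARD('n))"
  shows "power_spectrum CARD('k) (D ** D)"
  using hecke_tower.power_spectrum_twist[OF hecke_tower_fflag[where 'k='k and 'n='n] order_refl]
  by (simp add: D_def hecke_tower.twist_def[OF hecke_tower_fflag])

section \<open>Partial flags\<close>

text \<open>\<open>A + H\<close> is a hyperplane of the whole space, and its trace \<open>K\<close>
  on \<open>C\<close> is a hyperplane of \<open>C\<close> because \<open>C + H\<close> is
  everything. Then \<open>U\<close> meets \<open>H\<close> trivially exactly if it is not contained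
  in \<open>K\<close>, and \<open>card_complementary_lines\<close> applies.\<close>

lemma card_transversal_extensions:
  fixes A C H :: "('k::{field,finite} ^ 'n::finite) set"
  assumes sub: "vec.subspace A" "vec.subspace C" "vec.subspace H" and AC: "A \<subseteq> C"
    and dimA: "vec.dim A = m" and dimH: "vec.dim H = CARD('n) - Suc m" and m: "m < CARD('n)"
    and AH: "H \<inter> A = {0}" and CH: "C + H = UNIV"
  shows "card {U. vec.subspace U \<and> A \<subseteq> U \<and> U \<subseteq> C \<and> vec.dim U = Suc m \<and> H \<inter> U = {0}}
         = CARD('k) ^ (vec.dim C - Suc m)"
proof -
  define K where "K = (A + H) \<inter> C"
  have subAH: "vec.subspace (A + H)" using sub by (intro subspace_set_plus)
  have subK: "vec.subspace K" unfolding K_def using subAH sub by (intro vec.subspace_inter)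
  have dimAH: "Suc (vec.dim (A + H)) = CARD('n)"
    using dim_set_plus_Int[OF sub(1,3)] AH dimA dimH m by (simp add: Int_commute)
  have A_AH: "A \<subseteq> A + H" and H_AH: "H \<subseteq> A + H"
    using sub by (simp_all only: subset_set_plus_left subset_set_plus_right)
  have "C \<subseteq> (A + H) + C" by (rule subset_set_plus_right[OF subAH])
  moreover have "H \<subseteq> (A + H) + C"
    using H_AH subset_set_plus_left[OF sub(2)] by (rule order.trans)
  ultimately have "C + H \<subseteq> (A + H) + C"
    using subAH sub by (intro set_plus_subset subspace_set_plus)
  then have "(A + H) + C = UNIV" using CH by auto
  then have dimC: "vec.dim C = Suc (vec.dim K)"
    using dim_set_plus_Int[OF subAH sub(2)] dimAH by (simp add: K_def)
  have "{U. vec.subspace U \<and> A \<subseteq> U \<and> U \<subseteq> C \<and> vec.dim U = Suc m \<and> H \<inter> U = {0}}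
      = {U. vec.subspace U \<and> A \<subseteq> U \<and> U \<subseteq> C \<and> \<not> U \<subseteq> K \<and> vec.dim U = Suc (vec.dim A)}"
  proof -
    have meet_iff: "H \<inter> U = {0} \<longleftrightarrow> \<not> U \<subseteq> K"
      if U: "vec.subspace U" "A \<subseteq> U" "U \<subseteq> C" "vec.dim U = Suc m" for U
    proof
      assume HU: "H \<inter> U = {0}"
      show "\<not> U \<subseteq> K"
      proof
        assume "U \<subseteq> K"
        then have "U + H \<subseteq> A + H" using H_AH subAH by (intro set_plus_subset) (auto simp: K_def)
        then have "vec.dim (U + H) \<le> vec.dim (A + H)" by (rule vec.dim_subset)
        then show False
          using dim_set_plus_Int[OF U(1) sub(3)] HU U(4) dimH dimAH m by (simp add: Int_commute)
      qed
    next
      assume UK: "\<not> U \<subseteq> K"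
      have "H \<inter> U \<subseteq> {0}"
      proof
        fix x assume x: "x \<in> H \<inter> U"
        show "x \<in> {0}"
        proof (rule ccontr)
          assume "x \<notin> {0}"
          then have "x \<notin> A" using x AH by blast
          then have "U = vec.span (insert x A)"
            using x U dimA sub by (intro span_insert_eq) auto
          also have "\<dots> \<subseteq> A + H"
            using x A_AH H_AH subAH by (intro vec.span_minimal) auto
          finally show False using UK U by (auto simp: K_def)
        qed
      qed
      then show "H \<inter> U = {0}" using vec.subspace_0 U sub by blast
    qed
    show ?thesis by (simp add: dimA meet_iff conj_commute cong: conj_cong)
  qed
  then show ?thesis
    using card_complementary_lines[OF sub(1) subK sub(2) _ _ dimC] A_AH AC dimA dimC
    by (simp add: K_def)
qed

text \<open>The smaller space always comes first; a descending directed flag is represented by its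
  swap.\<close>

definition partial_flags :: "nat \<Rightarrow> nat \<Rightarrow> ('k::field, 'n::finite) subspace_pair set" where
  "partial_flags a b = {(U, W). vec.subspace U \<and> vec.subspace W \<and> U \<subseteq> W \<and> vec.dim U = a \<and> vec.dim W = b}"

text \<open>Opposition of partial flags of types \<open>(a, b)\<close> and
  \<open>(n - b, n - a)\<close>: each of the two intersections is between spaces of complementary
  dimension.\<close>

fun transversal :: "('k::field, 'n::finite) subspace_pair \<Rightarrow> ('k, 'n) subspace_pair \<Rightarrow> bool" where
  "transversal (U, W) (U', W') \<longleftrightarrow> U \<inter> W' = {0} \<and> W \<inter> U' = {0}"

declare transversal.simps [simp del]

text \<open>
  Refinements of a partial flag to complete flags opposite to \<open>F\<close> are counted by choosing the
  members of dimension \<open>1, 2, ...\<close> successively; \<open>B j\<close> is the member of the partial flag that has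
  to contain the one of dimension \<open>j\<close>.
\<close>

definition bounded_flag_segments ::
    "('k::field, 'n::finite) fflag \<Rightarrow> (nat \<Rightarrow> ('k ^ 'n) set) \<Rightarrow> nat \<Rightarrow> (nat \<Rightarrow> ('k ^ 'n) set) set" where
  "bounded_flag_segments F B m =
    {g. (\<forall>j\<le>m. vec.subspace (g j) \<and> vec.dim (g j) = j \<and> g j \<subseteq> B j \<and> flag_at F (CARD('n) - j) \<inter> g j = {0}) \<and>
        (\<forall>j<m. g j \<subseteq> g (Suc j)) \<and> (\<forall>j>m. g j = UNIV)}"

text \<open>The number of ways to extend a segment by one member depends on the dimensions alone, so
  the exponents add up. Positions beyond \<open>m\<close> hold \<open>UNIV\<close>, which makes
  extension and truncation mutually inverse function updates.\<close>

lemma card_bounded_flag_segments: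
  fixes F :: "('k::{field,finite}, 'n::finite) fflag"
  assumes B: "\<And>j. vec.subspace (B j)" "\<And>j. B j \<subseteq> B (Suc j)" "\<And>j. j \<le> CARD('n) \<Longrightarrow> j \<le> vec.dim (B j)"
    "\<And>j. j \<le> CARD('n) \<Longrightarrow> flag_at F (CARD('n) - vec.dim (B j)) \<inter> B j = {0}"
    and m: "m \<le> CARD('n)"
  shows "card (bounded_flag_segments F B m) = CARD('k) ^ (\<Sum>j<m. vec.dim (B (Suc j)) - Suc j)"
  using m
proof (induction m)
  case 0
  have "bounded_flag_segments F B 0 = {\<lambda>j. if j = 0 then {0} else UNIV}"
    using vec.subspace_0[OF B(1)[of 0]]
    by (auto simp: bounded_flag_segments_def fun_eq_iff)
  then show ?case by simp
next
  case (Suc m)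
  let ?n = "CARD('n)" and ?S = "bounded_flag_segments F B m"
  let ?E = "\<lambda>g. {U. vec.subspace U \<and> g m \<subseteq> U \<and> U \<subseteq> B (Suc m) \<and> vec.dim U = Suc m
    \<and> flag_at F (?n - Suc m) \<inter> U = {0}}"
  have E: "card (?E g) = CARD('k) ^ (vec.dim (B (Suc m)) - Suc m)" if g: "g \<in> ?S" for g
  proof (rule card_transversal_extensions)
    let ?c = "vec.dim (B (Suc m))"
    have c: "?c \<le> ?n" "Suc m \<le> ?c" using B(3)[of "Suc m"] Suc.prems dim_le_CARD by auto
    show "vec.subspace (g m)" "vec.dim (g m) = m" using g by (auto simp: bounded_flag_segments_def)
    show "g m \<subseteq> B (Suc m)" using g B(2)[of m] by (auto simp: bounded_flag_segments_def)
    have "flag_at F (?n - Suc m) \<inter> g m \<subseteq> flag_at F (?n - m) \<inter> g m"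
      using flag_at_mono[OF diff_le_mono2[of m "Suc m" ?n], of F] by auto
    also have "\<dots> = {0}" using g by (auto simp: bounded_flag_segments_def)
    finally show "flag_at F (?n - Suc m) \<inter> g m = {0}"
      using \<open>vec.subspace (g m)\<close>[THEN vec.subspace_0] by auto
    \<comment> \<open>The member of \<open>F\<close> of complementary dimension already spans
      everything together with \<open>B (Suc m)\<close>, and \<open>flag_at F (?n - Suc m)\<close>
      contains it since \<open>Suc m \<le> ?c\<close>.\<close>
    have "vec.dim (B (Suc m) + flag_at F (?n - ?c)) = ?n"
      using dim_set_plus_Int[OF B(1)[of "Suc m"], of "flag_at F (?n - ?c)"] B(4)[of "Suc m"] Suc.prems c
      by (simp add: flag_at_dim Int_commute)
    then have "B (Suc m) + flag_at F (?n - ?c) = UNIV"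
      using B(1) by (intro subspace_eq_UNIV subspace_set_plus) auto
    moreover have "B (Suc m) + flag_at F (?n - ?c) \<subseteq> B (Suc m) + flag_at F (?n - Suc m)"
      using flag_at_mono[of "?n - ?c" "?n - Suc m" F] c by (intro set_plus_mono2) auto
    ultimately show "B (Suc m) + flag_at F (?n - Suc m) = UNIV" by auto
  qed (use Suc.prems B(1) in \<open>auto simp: flag_at_dim\<close>)
  have extended: "g(Suc m := U) \<in> bounded_flag_segments F B (Suc m)" if g: "g \<in> ?S" and U: "U \<in> ?E g" for g U
  proof -
    let ?h = "g(Suc m := U)"
    have "vec.subspace (?h j) \<and> vec.dim (?h j) = j \<and> ?h j \<subseteq> B j \<and> flag_at F (?n - j) \<inter> ?h j = {0}"
      if "j \<le> Suc m" for j
      using g U that by (cases "j = Suc m") (simp_all add: bounded_flag_segments_def)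
    moreover have "?h j \<subseteq> ?h (Suc j)" if "j < Suc m" for j
      using g U that by (cases "j = m") (simp_all add: bounded_flag_segments_def)
    moreover have "?h j = UNIV" if "j > Suc m" for j
      using g that by (simp add: bounded_flag_segments_def)
    ultimately show ?thesis unfolding bounded_flag_segments_def by blast
  qed
  have truncated: "g(Suc m := UNIV) \<in> ?S \<and> g (Suc m) \<in> ?E (g(Suc m := UNIV))"
    if g: "g \<in> bounded_flag_segments F B (Suc m)" for g
  proof -
    let ?h = "g(Suc m := UNIV)"
    have "vec.subspace (?h j) \<and> vec.dim (?h j) = j \<and> ?h j \<subseteq> B j \<and> flag_at F (?n - j) \<inter> ?h j = {0}"
      if "j \<le> m" for j
      using g that by (simp add: bounded_flag_segments_def)
    moreover have "?h j \<subseteq> ?h (Suc j)" if "j < m" for j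
      using g that by (simp add: bounded_flag_segments_def)
    moreover have "?h j = UNIV" if "j > m" for j
      using g that by (simp add: bounded_flag_segments_def)
    ultimately have "?h \<in> ?S" unfolding bounded_flag_segments_def by blast
    moreover have "g (Suc m) \<in> ?E ?h" using g by (simp add: bounded_flag_segments_def)
    ultimately show ?thesis ..
  qed
  have "bij_betw (\<lambda>(g, U). g(Suc m := U)) (SIGMA g:?S. ?E g) (bounded_flag_segments F B (Suc m))"
  proof (rule bij_betw_byWitness[where f'="\<lambda>g. (g(Suc m := UNIV), g (Suc m))"])
    show "\<forall>x\<in>SIGMA g:?S. ?E g. (\<lambda>g. (g(Suc m := UNIV), g (Suc m))) ((\<lambda>(g, U). g(Suc m := U)) x) = x"
      by (auto simp: bounded_flag_segments_def fun_eq_iff)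
    show "\<forall>g\<in>bounded_flag_segments F B (Suc m). (\<lambda>(g, U). g(Suc m := U)) (g(Suc m := UNIV), g (Suc m)) = g"
      by auto
    show "(\<lambda>(g, U). g(Suc m := U)) ` (SIGMA g:?S. ?E g) \<subseteq> bounded_flag_segments F B (Suc m)"
      using extended by auto
    show "(\<lambda>g. (g(Suc m := UNIV), g (Suc m))) ` bounded_flag_segments F B (Suc m) \<subseteq> (SIGMA g:?S. ?E g)"
      by (rule image_subsetI) (simp only: mem_Sigma_iff truncated)
  qed
  then have "card (bounded_flag_segments F B (Suc m)) = card (SIGMA g:?S. ?E g)"
    by (simp add: bij_betw_same_card)
  also have "\<dots> = (\<Sum>g\<in>?S. card (?E g))"
  proof (rule card_SigmaI)
    \<comment> \<open>Segments are functions on the natural numbers, so finiteness is not given by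
      the type; it follows from the nonzero cardinality in the induction hypothesis.\<close>
    have "card ?S \<noteq> 0" using Suc by simp
    then show "finite ?S" by (rule contrapos_np) simp
  qed auto
  also have "\<dots> = card ?S * CARD('k) ^ (vec.dim (B (Suc m)) - Suc m)"
    using E by simp
  also have "\<dots> = CARD('k) ^ (\<Sum>j<Suc m. vec.dim (B (Suc j)) - Suc j)"
    using Suc by (simp add: power_add)
  finally show ?case .
qed

text \<open>The exponent is fixed before \<open>F\<close> and \<open>P\<close> because it has to
  leave sums over flags as a common scalar.\<close>

lemma card_opposite_refinements:
  assumes ab: "a \<le> b" "b \<le> CARD('n::finite)"
  shows "\<exists>e. \<forall>(F :: ('k::{field,finite}, 'n) fflag) P. P \<in> partial_flags a b \<longrightarrow>
    transversal (flag_at F (CARD('n) - b), flag_at F (CARD('n) - a)) P \<longrightarrow>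
    card {G. opposite CARD('n) F G \<and> (flag_at G a, flag_at G b) = P} = CARD('k) ^ e"
proof (intro exI allI impI)
  let ?n = "CARD('n)"
  fix F :: "('k, 'n) fflag" and P
  assume P: "P \<in> partial_flags a b" and tr: "transversal (flag_at F (?n - b), flag_at F (?n - a)) P"
  obtain U W where UW: "P = (U, W)" "vec.subspace U" "vec.subspace W" "U \<subseteq> W" "vec.dim U = a" "vec.dim W = b"
    using P by (auto simp: partial_flags_def)
  \<comment> \<open>The smallest of \<open>U\<close>, \<open>W\<close> and the whole space with room
    for dimension \<open>j\<close>. In dimensions \<open>a\<close> and \<open>b\<close> containment
    becomes equality.\<close>
  define B where "B = (\<lambda>j. if j \<le> a then U else if j \<le> b then W else UNIV)"
  have dimB: "vec.dim (B j) = (if j \<le> a then a else if j \<le> b then b else ?n)" for j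
    using UW by (simp add: B_def)
  have meetB: "flag_at F (?n - vec.dim (B j)) \<inter> B j = {0}" for j
    using tr UW by (auto simp: dimB B_def transversal.simps)
  have "{G. opposite ?n F G \<and> (flag_at G a, flag_at G b) = P} =
      {G. flag_at G \<in> bounded_flag_segments F B ?n}"
  proof (intro Collect_cong iffI)
    fix G :: "('k, 'n) fflag"
    assume G: "opposite ?n F G \<and> (flag_at G a, flag_at G b) = P"
    have "flag_at F (?n - j) \<inter> flag_at G j = {0}" if "j \<le> ?n" for j
    proof -
      have "flag_at F (?n - j) \<inter> flag_at G (?n - (?n - j)) = {0}"
        using G unfolding opposite_def by (meson diff_le_self)
      then show ?thesis using that by simp
    qed
    moreover have "flag_at G j \<subseteq> B j" for j
      using G UW flag_at_mono[of j a G] flag_at_mono[of j b G] by (auto simp: B_def)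
    ultimately show "flag_at G \<in> bounded_flag_segments F B ?n"
      by (simp add: bounded_flag_segments_def flag_at_dim flag_at_top flag_at_mono)
  next
    fix G :: "('k, 'n) fflag"
    assume G: "flag_at G \<in> bounded_flag_segments F B ?n"
    have "flag_at F j \<inter> flag_at G (?n - j) = {0}" if "j \<le> ?n" for j
    proof -
      have "flag_at F (?n - (?n - j)) \<inter> flag_at G (?n - j) = {0}"
        using G by (simp add: bounded_flag_segments_def)
      then show ?thesis using that by simp
    qed
    then have "opposite ?n F G" by (auto simp: opposite_def flag_at_top)
    moreover have "flag_at G a = U"
    proof (rule vec.subspace_dim_equal)
      have "flag_at G a \<subseteq> B a" using G ab by (simp add: bounded_flag_segments_def)
      then show "flag_at G a \<subseteq> U" by (simp add: B_def)
    qed (use UW ab in \<open>auto simp: flag_at_dim\<close>)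
    moreover have "flag_at G b = W"
    proof (rule vec.subspace_dim_equal)
      have "flag_at G b \<subseteq> B b" using G ab by (simp add: bounded_flag_segments_def)
      then show "flag_at G b \<subseteq> W" using UW ab by (auto simp: B_def split: if_splits)
    qed (use UW ab in \<open>auto simp: flag_at_dim\<close>)
    ultimately show "opposite ?n F G \<and> (flag_at G a, flag_at G b) = P" using UW by simp
  qed
  moreover have "bij_betw flag_at {G. flag_at G \<in> bounded_flag_segments F B ?n} (bounded_flag_segments F B ?n)"
    unfolding bij_betw_def
  proof
    show "inj_on flag_at {G. flag_at G \<in> bounded_flag_segments F B ?n}"
      by (rule inj_onI) (simp add: flag_at_inject)
    have "is_full_flag g" if g: "g \<in> bounded_flag_segments F B ?n" for g
      unfolding is_full_flag_def
    proof (intro allI conjI)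
      have "g ?n = UNIV" using g by (intro subspace_eq_UNIV) (auto simp: bounded_flag_segments_def)
      then have top: "g j = UNIV" if "?n \<le> j" for j
        using that g by (cases "j = ?n") (auto simp: bounded_flag_segments_def)
      fix j
      show "vec.subspace (g j)"
        using g top[of j] by (cases "j \<le> ?n") (auto simp: bounded_flag_segments_def)
      show "g j \<subseteq> g (Suc j)"
        using g top[of "Suc j"] by (cases "j < ?n") (auto simp: bounded_flag_segments_def)
      show "vec.dim (g j) = min j ?n"
        using g top[of j] by (cases "j \<le> ?n") (auto simp: bounded_flag_segments_def)
    qed
    then show "flag_at ` {G. flag_at G \<in> bounded_flag_segments F B ?n} = bounded_flag_segments F B ?n"
      using ex_flag_at by blast
  qed
  ultimately have "card {G. opposite ?n F G \<and> (flag_at G a, flag_at G b) = P} = card (bounded_flag_segments F B ?n)"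
    by (simp add: bij_betw_same_card)
  also have "\<dots> = CARD('k) ^ (\<Sum>j<?n. vec.dim (B (Suc j)) - Suc j)"
  proof (rule card_bounded_flag_segments)
    show "vec.subspace (B j)" for j using UW by (simp add: B_def)
    show "B j \<subseteq> B (Suc j)" for j using UW ab by (auto simp: B_def)
    show "j \<le> vec.dim (B j)" if "j \<le> ?n" for j using that by (simp add: dimB)
  qed (use meetB in auto)
  finally show "card {G. opposite ?n F G \<and> (flag_at G a, flag_at G b) = P} =
      CARD('k) ^ (\<Sum>j<?n. (if Suc j \<le> a then a else if Suc j \<le> b then b else ?n) - Suc j)"
    by (simp only: dimB)
qed

lemma flag_pair_in_partial_flags:
  "a \<le> b \<Longrightarrow> b \<le> CARD('n) \<Longrightarrow> (flag_at G a, flag_at (G :: ('k::field, 'n::finite) fflag) b) \<in> partial_flags a b"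
  by (auto simp: partial_flags_def flag_at_dim intro: flag_at_mono[THEN subsetD])

lemma opposite_transversal:
  fixes F G :: "('k::field, 'n::finite) fflag"
  assumes "opposite CARD('n) F G" "a \<le> CARD('n)" "b \<le> CARD('n)"
  shows "transversal (flag_at F (CARD('n) - b), flag_at F (CARD('n) - a)) (flag_at G a, flag_at G b)"
  using assms opposite_def[of "CARD('n)" F G]
  by (metis diff_diff_cancel diff_le_self transversal.simps)

text \<open>Grouping the flags opposite to \<open>F\<close> by their members of dimensions
  \<open>a\<close> and \<open>b\<close> gives fibres of one size. Opposition therefore maps
  functions pulled back from type \<open>(a, b)\<close> to functions pulled back from type
  \<open>(n - b, n - a)\<close>.\<close>

lemma opposite_pushforward:
  fixes f :: "('k::{field,finite}, 'n::finite) subspace_pair \<Rightarrow> complex"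
  assumes ab: "a \<le> b" "b \<le> CARD('n)"
  shows "\<exists>e. \<forall>f F. (rel_mat (opposite CARD('n)) *v (\<chi> G. f (flag_at G a, flag_at G b))) $ F =
    of_nat CARD('k) ^ e * (\<Sum>P | P \<in> partial_flags a b \<and>
       transversal (flag_at (F :: ('k, 'n) fflag) (CARD('n) - b), flag_at F (CARD('n) - a)) P. f P :: complex)"
proof -
  let ?n = "CARD('n)"
  obtain e where e: "\<And>(F :: ('k, 'n) fflag) P. P \<in> partial_flags a b \<Longrightarrow>
    transversal (flag_at F (?n - b), flag_at F (?n - a)) P \<Longrightarrow>
    card {G. opposite ?n F G \<and> (flag_at G a, flag_at G b) = P} = CARD('k) ^ e"
    using card_opposite_refinements[OF ab, where 'k='k] by blast
  show ?thesis
  proof (intro exI allI)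
    fix f :: "('k, 'n) subspace_pair \<Rightarrow> complex" and F :: "('k, 'n) fflag"
    let ?T = "{P. P \<in> partial_flags a b \<and> transversal (flag_at F (?n - b), flag_at F (?n - a)) P}"
    let ?pi = "\<lambda>G :: ('k, 'n) fflag. (flag_at G a, flag_at G b)"
    have pi_in: "?pi G \<in> ?T" if "opposite ?n F G" for G
      using opposite_transversal[OF that, of a b] flag_pair_in_partial_flags[OF ab, of G] ab by simp
    have "(rel_mat (opposite ?n) *v (\<chi> G. f (?pi G))) $ F = (\<Sum>G | opposite ?n F G. f (?pi G))"
      by (simp add: matrix_vector_mult_def of_bool_def if_distrib[of "\<lambda>c. c * _"] sum.If_cases cong: if_cong)
    also have "\<dots> = (\<Sum>P\<in>?T. \<Sum>G\<in>{G \<in> {G. opposite ?n F G}. ?pi G = P}. f (?pi G))"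
      using pi_in by (intro sum.group[symmetric] image_subsetI) simp_all
    also have "\<dots> = (\<Sum>P\<in>?T. of_nat CARD('k) ^ e * f P)"
    proof (rule sum.cong[OF refl])
      fix P assume "P \<in> ?T"
      then have "card {G. opposite ?n F G \<and> ?pi G = P} = CARD('k) ^ e" using e by blast
      moreover have "(\<Sum>G\<in>{G \<in> {G. opposite ?n F G}. ?pi G = P}. f (?pi G)) =
          (\<Sum>G\<in>{G. opposite ?n F G \<and> ?pi G = P}. f P)"
        by (intro sum.cong) auto
      ultimately show "(\<Sum>G\<in>{G \<in> {G. opposite ?n F G}. ?pi G = P}. f (?pi G)) = of_nat CARD('k) ^ e * f P"
        by simp
    qed
    finally show "(rel_mat (opposite ?n) *v (\<chi> G. f (?pi G))) $ F = of_nat CARD('k) ^ e * sum f ?T"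
      by (simp add: sum_distrib_left)
  qed
qed

text \<open>Pulled back to complete flags, \<open>f\<close> becomes an eigenvector of
  \<open>D ** D\<close>: each application of \<open>D\<close> contributes a power of
  \<open>q\<close>, and the second one returns the type to \<open>(a, b)\<close>. Which of
  \<open>s\<close> and \<open>t\<close> is larger remains open here.\<close>

theorem transversal_eigenvalue:
  fixes f :: "('k::{field,finite}, 'n::finite) subspace_pair \<Rightarrow> complex"
  assumes ab: "a \<le> b" "b \<le> CARD('n)"
    and f: "P0 \<in> partial_flags a b" "f P0 \<noteq> 0"
    and eig: "\<And>P. P \<in> partial_flags a b \<Longrightarrow>
      (\<Sum>R | R \<in> partial_flags (CARD('n) - b) (CARD('n) - a) \<and> transversal P R.
        \<Sum>Q | Q \<in> partial_flags a b \<and> transversal R Q. f Q) = c * f P"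
  shows "\<exists>s t. c * of_nat CARD('k) ^ t = of_nat CARD('k) ^ s"
proof -
  let ?n = "CARD('n)" and ?q = "of_nat CARD('k) :: complex"
  let ?D = "rel_mat (opposite ?n) :: complex ^ ('k, 'n) fflag ^ ('k, 'n) fflag"
  define g where "g = (\<lambda>R. \<Sum>Q | Q \<in> partial_flags a b \<and> transversal R Q. f Q)"
  define h where "h = (\<chi> F :: ('k, 'n) fflag. f (flag_at F a, flag_at F b))"
  obtain e where e: "\<And>F. (?D *v h) $ F = ?q ^ e * g (flag_at F (?n - b), flag_at F (?n - a))"
    using opposite_pushforward[OF ab, where 'k='k] unfolding h_def g_def by blast
  obtain e' where e': "\<And>F. (?D *v (\<chi> G. g (flag_at G (?n - b), flag_at G (?n - a)))) $ F =
      ?q ^ e' * (\<Sum>R | R \<in> partial_flags (?n - b) (?n - a) \<and>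
        transversal (flag_at F (?n - (?n - a)), flag_at F (?n - (?n - b))) R. g R)"
    using opposite_pushforward[of "?n - b" "?n - a", where 'k='k and 'n='n] ab by fastforce
  have "?D *v h = ?q ^ e *s (\<chi> G. g (flag_at G (?n - b), flag_at G (?n - a)))"
    by (simp add: Finite_Cartesian_Product.vec_eq_iff e)
  then have "((?D ** ?D) *v h) $ F = ((c * ?q ^ (e + e')) *s h) $ F" for F
    using e'[of F] ab eig[of "(flag_at F a, flag_at F b)"] flag_pair_in_partial_flags[OF ab, of F]
    by (simp add: vector_scalar_commute h_def g_def power_add flip: matrix_vector_mul_assoc)
  then have "(?D ** ?D) *v h = (c * ?q ^ (e + e')) *s h"
    by (simp add: Finite_Cartesian_Product.vec_eq_iff)
  moreover have "h \<noteq> 0"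
  proof -
    \<comment> \<open>Every partial flag refines to a complete one, so a nonzero function has a
      nonzero pullback.\<close>
    obtain U W where UW: "P0 = (U, W)" "vec.subspace U" "vec.subspace W" "U \<subseteq> W" "vec.dim U = a" "vec.dim W = b"
      using f(1) by (auto simp: partial_flags_def)
    obtain g where "is_full_flag g" "g a = U" "g b = W"
      using full_flag_through[OF UW(2-4)] UW(5,6) by blast
    then obtain F :: "('k, 'n) fflag" where "flag_at F a = U" "flag_at F b = W"
      using ex_flag_at by metis
    then have "h $ F \<noteq> 0" using f(2) UW(1) by (simp add: h_def)
    then show ?thesis by auto
  qed
  ultimately show ?thesis
    using power_spectrumD[OF power_spectrum_opposite] by blast
qed

section \<open>Traces of powers\<close>

primrec matrix_power :: "'a::semiring_1 ^ 'x ^ 'x \<Rightarrow> nat \<Rightarrow> 'a ^ 'x ^ 'x" where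
  "matrix_power A 0 = mat 1"
| "matrix_power A (Suc k) = matrix_power A k ** A"

text \<open>Cyclicity of the trace, used to remove a conjugation.\<close>

lemma sum_diag_mult_commute:
  fixes X Y :: "'a::comm_semiring_0 Matrix.mat"
  assumes "X \<in> carrier_mat n n" "Y \<in> carrier_mat n n"
  shows "(\<Sum>i<n. (X * Y) $$ (i, i)) = (\<Sum>i<n. (Y * X) $$ (i, i))"
proof -
  have "(\<Sum>i<n. (X * Y) $$ (i, i)) = (\<Sum>i<n. \<Sum>l<n. X $$ (i, l) * Y $$ (l, i))"
    using assms by (auto simp: scalar_prod_def atLeast0LessThan intro!: sum.cong)
  also have "\<dots> = (\<Sum>l<n. \<Sum>i<n. Y $$ (l, i) * X $$ (i, l))"
    by (subst sum.swap) (simp add: mult.commute)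
  also have "\<dots> = (\<Sum>i<n. (Y * X) $$ (i, i))"
    using assms by (auto simp: scalar_prod_def atLeast0LessThan intro!: sum.cong)
  finally show ?thesis .
qed

lemma upper_triangular_pow:
  fixes B :: "'a::semiring_1 Matrix.mat"
  assumes B: "B \<in> carrier_mat n n" "upper_triangular B"
  shows "upper_triangular (B ^\<^sub>m k) \<and> (\<forall>i<n. (B ^\<^sub>m k) $$ (i, i) = (B $$ (i, i)) ^ k)"
proof (induction k)
  case 0
  then show ?case using B by auto
next
  case (Suc k)
  let ?A = "B ^\<^sub>m k"
  have A: "?A \<in> carrier_mat n n" using B by simp
  have nth: "(?A * B) $$ (i, j) = (\<Sum>l<n. ?A $$ (i, l) * B $$ (l, j))" if "i < n" "j < n" for i j
    using A B that by (simp add: scalar_prod_def atLeast0LessThan)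
  have low: "?A $$ (i, l) = 0" "B $$ (i, l) = 0" if "l < i" "i < n" for i l
    using Suc B A that by (auto simp: upper_triangular_def)
  have below: "(?A * B) $$ (i, j) = 0" if "j < i" "i < n" for i j
  proof -
    have "?A $$ (i, l) * B $$ (l, j) = 0" if "l < n" for l
      using low(1)[of l i] low(2)[of j l] that \<open>j < i\<close> \<open>i < n\<close> by (cases "l < i") auto
    then show ?thesis using nth that by simp
  qed
  have "upper_triangular (?A * B)"
    by (intro upper_triangularI below) (use A in auto)
  moreover have "(?A * B) $$ (i, i) = (B $$ (i, i)) ^ Suc k" if "i < n" for i
  proof -
    have "?A $$ (i, l) * B $$ (l, i) = (if l = i then (B $$ (i, i)) ^ Suc k else 0)" if "l < n" for l
    proof -
      consider "l < i" | "l = i" | "i < l" by linarith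
      then show ?thesis
      proof cases
        case 1
        then show ?thesis using low(1)[of l i] \<open>i < n\<close> by simp
      next
        case 2
        then show ?thesis using Suc \<open>i < n\<close> by (simp add: power_commutes)
      next
        case 3
        then show ?thesis using low(2)[of i l] that by simp
      qed
    qed
    then show ?thesis using nth[OF that that] that by simp
  qed
  ultimately show ?case by simp
qed

text \<open>The matrix is transported along an enumeration of the index type and triangularised. The
  list is the diagonal of the Schur form, so it records algebraic multiplicities. For integer
  entries the characteristic polynomial is monic with integer coefficients.\<close>

lemma trace_matrix_power_eigenvalues:
  fixes M :: "complex ^ 'x::finite ^ 'x"
  shows "\<exists>as. (\<forall>k. trace (matrix_power M k) = (\<Sum>a\<leftarrow>as. a ^ k)) \<and>
    (\<forall>a\<in>set as. (\<exists>v. v \<noteq> 0 \<and> M *v v = a *s v) \<and>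
       ((\<forall>i j. M $ i $ j \<in> \<int>) \<longrightarrow> algebraic_int a))"
proof -
  let ?N = "CARD('x)"
  obtain h where h: "bij_betw h {..<?N} (UNIV :: 'x set)"
    using ex_bij_betw_nat_finite[of "UNIV :: 'x set"] by (auto simp: atLeast0LessThan)
  define A where "A = Matrix.mat ?N ?N (\<lambda>(i, j). M $ h i $ h j)"
  have A: "A \<in> carrier_mat ?N ?N" by (simp add: A_def)
  have pow: "(A ^\<^sub>m k) $$ (i, j) = matrix_power M k $ h i $ h j" if "i < ?N" "j < ?N" for k i j
    using that
  proof (induction k arbitrary: j)
    case 0
    have "h i = h j \<longleftrightarrow> i = j" using h 0 by (auto simp: bij_betw_def inj_on_def)
    then show ?case using A 0 by (simp add: Finite_Cartesian_Product.mat_def)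
  next
    case (Suc k)
    have "(A ^\<^sub>m Suc k) $$ (i, j) = (\<Sum>l<?N. (A ^\<^sub>m k) $$ (i, l) * A $$ (l, j))"
      using A Suc.prems by (simp add: scalar_prod_def atLeast0LessThan)
    also have "\<dots> = (\<Sum>l<?N. matrix_power M k $ h i $ h l * M $ h l $ h j)"
      using Suc by (intro sum.cong) (auto simp: A_def)
    also have "\<dots> = (\<Sum>x\<in>UNIV. matrix_power M k $ h i $ x * M $ x $ h j)"
      by (rule sum.reindex_bij_betw[OF h])
    finally show ?case by (simp add: matrix_matrix_mult_def)
  qed
  obtain es where es: "char_poly A = (\<Prod>a\<leftarrow>es. [:- a, 1:])"
    using char_poly_factorized[OF A] by blast
  obtain B P Q where BPQ: "schur_decomposition A es = (B, P, Q)" by (cases "schur_decomposition A es")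
  have sim: "similar_mat_wit A B P Q" and up: "upper_triangular B" and diag: "diag_mat B = es"
    using schur_decomposition[OF A es BPQ] by auto
  have carr: "B \<in> carrier_mat ?N ?N" "P \<in> carrier_mat ?N ?N" "Q \<in> carrier_mat ?N ?N"
    and QP: "Q * P = 1\<^sub>m ?N"
    using similar_mat_witD2[OF A sim] by auto
  have trace: "trace (matrix_power M k) = (\<Sum>a\<leftarrow>es. a ^ k)" for k
  proof -
    have Bk: "B ^\<^sub>m k \<in> carrier_mat ?N ?N" using carr by simp
    have "trace (matrix_power M k) = (\<Sum>i<?N. matrix_power M k $ h i $ h i)"
      unfolding trace_def by (rule sum.reindex_bij_betw[OF h, symmetric])
    also have "\<dots> = (\<Sum>i<?N. (A ^\<^sub>m k) $$ (i, i))" by (simp add: pow)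
    also have "\<dots> = (\<Sum>i<?N. ((P * B ^\<^sub>m k) * Q) $$ (i, i))"
      by (simp only: similar_mat_wit_pow_id[OF sim])
    also have "\<dots> = (\<Sum>i<?N. (Q * (P * B ^\<^sub>m k)) $$ (i, i))"
      using carr Bk by (intro sum_diag_mult_commute) auto
    also have "Q * (P * B ^\<^sub>m k) = (Q * P) * B ^\<^sub>m k"
      by (rule assoc_mult_mat[symmetric, OF carr(3,2) Bk])
    also have "\<dots> = B ^\<^sub>m k" unfolding QP by (rule left_mult_one_mat[OF Bk])
    also have "(\<Sum>i<?N. (B ^\<^sub>m k) $$ (i, i)) = (\<Sum>i<?N. (B $$ (i, i)) ^ k)"
      using upper_triangular_pow[OF carr(1) up] by simp
    also have "\<dots> = (\<Sum>a\<leftarrow>es. a ^ k)"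
      unfolding diag[symmetric] diag_mat_def using carr(1)
      by (simp add: comp_def interv_sum_list_conv_sum_set_nat atLeast0LessThan)
    finally show ?thesis .
  qed
  have "(\<exists>v. v \<noteq> 0 \<and> M *v v = a *s v) \<and> ((\<forall>i j. M $ i $ j \<in> \<int>) \<longrightarrow> algebraic_int a)"
    if a: "a \<in> set es" for a
  proof
    have root: "poly (char_poly A) a = 0" using a unfolding es by (auto simp: poly_prod_list prod_list_zero_iff)
    then have "eigenvalue A a" using eigenvalue_root_char_poly[OF A] by simp
    then obtain w where w: "w \<in> carrier_vec ?N" "w \<noteq> 0\<^sub>v ?N" "A *\<^sub>v w = a \<cdot>\<^sub>v w"
      using A by (auto simp: eigenvalue_def eigenvector_def)
    define v where "v = (\<chi> x. vec_index w (inv_into {..<?N} h x))"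
    have vh: "v $ h i = vec_index w i" if "i < ?N" for i
      using h that by (simp add: v_def bij_betw_def inv_into_f_f)
    have hsurj: "\<exists>i<?N. x = h i" for x using h by (auto simp: bij_betw_def)
    have "(M *v v) $ x = (a *s v) $ x" for x
    proof -
      obtain i where i: "i < ?N" "x = h i" using hsurj by blast
      have "(M *v v) $ x = (\<Sum>l<?N. M $ h i $ h l * v $ h l)"
        unfolding i(2) matrix_vector_mult_def vec_lambda_beta by (rule sum.reindex_bij_betw[OF h, symmetric])
      also have "\<dots> = (\<Sum>l<?N. A $$ (i, l) * vec_index w l)"
        using i by (simp add: A_def vh)
      also have "\<dots> = vec_index (A *\<^sub>v w) i"
        using A w(1) i by (simp add: scalar_prod_def atLeast0LessThan)
      also have "\<dots> = (a *s v) $ x" using w i by (simp add: vh)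
      finally show ?thesis .
    qed
    moreover have "v \<noteq> 0"
    proof
      assume "v = 0"
      then have "vec_index w i = 0" if "i < ?N" for i using vh[OF that] by simp
      then have "w = 0\<^sub>v ?N" using w(1) by (intro eq_vecI) auto
      then show False using w by simp
    qed
    ultimately show "\<exists>v. v \<noteq> 0 \<and> M *v v = a *s v"
      by (intro exI[of _ v]) (simp add: Finite_Cartesian_Product.vec_eq_iff)
    show "(\<forall>i j. M $ i $ j \<in> \<int>) \<longrightarrow> algebraic_int a"
    proof
      assume ints: "\<forall>i j. M $ i $ j \<in> \<int>"
      \<comment> \<open>Rounding the real parts merely produces a matrix over the integers; on
        integer entries it changes nothing.\<close>
      define C where "C = Matrix.mat ?N ?N (\<lambda>(i, j). \<lfloor>Re (M $ h i $ h j)\<rfloor>)"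
      have C: "C \<in> carrier_mat ?N ?N" by (simp add: C_def)
      have "of_int \<lfloor>Re z\<rfloor> = z" if "z \<in> \<int>" for z :: complex using that by (auto elim: Ints_cases)
      then have "A = map_mat of_int C"
        using ints by (intro eq_matI) (auto simp: A_def C_def)
      then have cp: "char_poly A = map_poly of_int (char_poly C)"
        using of_int_hom.char_poly_hom[OF C] by simp
      show "algebraic_int a"
      proof (rule algebraic_int.intros)
        show "lead_coeff (char_poly A) = 1" using degree_monic_char_poly[OF A] by simp
        show "\<forall>i. coeff (char_poly A) i \<in> \<int>" unfolding cp by (simp add: coeff_map_poly)
      qed (rule root)
    qed
  qed
  then show ?thesis using trace by blast
qed

section \<open>Exponentials of power sums\<close>

text \<open>\<open>G\<close> is the sum of the series \<open>- log (1 - a u^6)\<close>, because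
  \<open>6 a^m / l = a^m / m\<close> for \<open>l = 6 m\<close>. Comparing derivatives avoids
  expanding the exponential: its product with \<open>Q as\<close> has derivative 0 and constant term
  1.\<close>

lemma fps_exp_power_sums:
  fixes as :: "complex list"
  defines "G \<equiv> Abs_fps (\<lambda>l. if l = 0 then 0 else (if 6 dvd l then 6 * (\<Sum>a\<leftarrow>as. a ^ (l div 6)) else 0) / of_nat l)"
  shows "inverse (fps_exp 1 oo G) = (\<Prod>a\<leftarrow>as. 1 - fps_const a * fps_X ^ 6)"
proof -
  define Q where "Q = (\<lambda>as :: complex list. \<Prod>a\<leftarrow>as. 1 - fps_const a * fps_X ^ 6)"
  \<comment> \<open>The derivative \<open>6 a u^5 / (1 - a u^6)\<close> of
    \<open>- log (1 - a u^6)\<close>; differentiation shifts the index, whence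
    \<open>Suc m\<close>.\<close>
  define g where "g = (\<lambda>a :: complex. Abs_fps (\<lambda>m. if 6 dvd Suc m then 6 * a ^ (Suc m div 6) else 0))"
  have g: "g a * (1 - fps_const a * fps_X ^ 6) = fps_const (6 * a) * fps_X ^ 5" for a
  proof (rule fps_ext)
    fix m
    have "fps_nth (g a * (fps_const a * fps_X ^ 6)) m = a * (if m < 6 then 0 else fps_nth (g a) (m - 6))"
      by (simp add: mult.left_commute[of "g a"] fps_X_power_mult_right_nth)
    moreover have "fps_nth (g a) m - a * (if m < 6 then 0 else fps_nth (g a) (m - 6)) = (if m = 5 then 6 * a else 0)"
    proof (cases "m < 6")
      case True
      then show ?thesis
        using nat_dvd_not_less[of "Suc m" 6] by (cases "m = 5") (auto simp: g_def)
    next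
      case False
      then obtain r where r: "m = r + 6" using le_Suc_ex[of 6 m] by (auto simp: add.commute)
      have "Suc m = Suc r + 6" using r by simp
      then have "6 dvd Suc m \<longleftrightarrow> 6 dvd Suc r" "Suc m div 6 = Suc (Suc r div 6)"
        by (metis dvd_add_left_iff dvd_refl) (use \<open>Suc m = Suc r + 6\<close> in simp)
      then show ?thesis using False r by (simp add: g_def)
    qed
    ultimately show "fps_nth (g a * (1 - fps_const a * fps_X ^ 6)) m = fps_nth (fps_const (6 * a) * fps_X ^ 5) m"
      by (simp add: right_diff_distrib fps_X_power_nth)
  qed
  have deriv_G: "fps_deriv G = (\<Sum>a\<leftarrow>as. g a)"
  proof (rule fps_ext)
    fix m
    have "fps_nth (\<Sum>a\<leftarrow>as. g a) m = (\<Sum>a\<leftarrow>as. fps_nth (g a) m)" by (induction as) auto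
    also have "\<dots> = (if 6 dvd Suc m then 6 * (\<Sum>a\<leftarrow>as. a ^ (Suc m div 6)) else 0)"
      by (induction as) (auto simp: g_def distrib_left)
    also have "\<dots> = fps_nth (fps_deriv G) m"
      unfolding G_def by (simp add: field_simps del: of_nat_Suc)
    finally show "fps_nth (fps_deriv G) m = fps_nth (\<Sum>a\<leftarrow>as. g a) m" ..
  qed
  have Qderiv: "(\<Sum>a\<leftarrow>as. g a) * Q as = - fps_deriv (Q as)"
  proof (induction as)
    case Nil
    then show ?case by (simp add: Q_def)
  next
    case (Cons a as)
    have Q: "Q (a # as) = (1 - fps_const a * fps_X ^ 6) * Q as" by (simp add: Q_def)
    have d: "fps_deriv (1 - fps_const a * fps_X ^ 6) = - (fps_const (6 * a) * fps_X ^ 5)"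
      by (simp add: fps_deriv_power fps_const_mult[symmetric] mult_ac del: fps_const_mult)
    have "(\<Sum>a\<leftarrow>a # as. g a) * Q (a # as) = (g a * (1 - fps_const a * fps_X ^ 6)) * Q as
        + (1 - fps_const a * fps_X ^ 6) * ((\<Sum>a\<leftarrow>as. g a) * Q as)"
      unfolding Q by (simp add: algebra_simps)
    also have "\<dots> = - fps_deriv (Q (a # as))"
      unfolding g Cons Q fps_deriv_mult d by (simp add: algebra_simps)
    finally show ?case .
  qed
  define Z where "Z = fps_exp 1 oo G"
  have G0: "fps_nth G 0 = 0" by (simp add: G_def)
  have "fps_deriv Z = Z * fps_deriv G"
    unfolding Z_def by (simp add: fps_compose_deriv[OF G0])
  then have "fps_deriv (Z * Q as) = Z * ((\<Sum>a\<leftarrow>as. g a) * Q as) + Z * fps_deriv (Q as)"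
    by (simp add: deriv_G algebra_simps)
  then have "fps_deriv (Z * Q as) = 0" unfolding Qderiv by simp
  then have "Z * Q as = fps_const (fps_nth (Z * Q as) 0)"
    by (simp only: fps_deriv_eq_0_iff)
  also have "fps_nth (Z * Q as) 0 = 1"
  proof -
    have "fps_nth (Q as) 0 = 1" by (induction as) (auto simp: Q_def)
    then show ?thesis by (simp add: Z_def)
  qed
  finally have "Z * Q as = 1" by simp
  then show ?thesis unfolding Z_def Q_def by (rule fps_inverse_unique)
qed

section \<open>Closed walks\<close>

lemma matrix_power_add: "matrix_power A (k + l) = matrix_power A k ** matrix_power (A :: 'a::semiring_1 ^ 'x::finite ^ 'x) l"
  by (induction l) (simp_all add: matrix_mul_assoc)

lemma matrix_power_Suc_left: "matrix_power A (Suc k) = A ** matrix_power (A :: 'a::semiring_1 ^ 'x::finite ^ 'x) k"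
  using matrix_power_add[of A 1 k] by simp

lemma matrix_power_Ints:
  fixes A :: "complex ^ 'x::finite ^ 'x"
  assumes "\<And>i j. A $ i $ j \<in> \<int>"
  shows "matrix_power A k $ i $ j \<in> \<int>"
  using assms
  by (induction k arbitrary: i j)
    (auto simp: Finite_Cartesian_Product.mat_def matrix_matrix_mult_def intro!: Ints_sum Ints_mult)

definition arc_mat :: "('a, 'a \<times> 'a) pre_digraph \<Rightarrow> complex ^ 'a ^ 'a" where
  "arc_mat X = rel_mat (\<lambda>u v. (u, v) \<in> arcs X)"

text \<open>Induction on the first arc. The start \<open>u\<close> must be a vertex already for
  length 0: the empty walk exists only at vertices, while the identity matrix has a diagonal entry 1
  at every index.\<close>

lemma card_awalks_eq_matrix_power:
  fixes X :: "('a::finite, 'a \<times> 'a) pre_digraph"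
  assumes X: "wf_digraph X" "tail X = fst" "head X = snd" and u: "u \<in> verts X"
  shows "of_nat (card {p. pre_digraph.awalk X u p v \<and> length p = l}) = matrix_power (arc_mat X) l $ u $ v"
  using u
proof (induction l arbitrary: u)
  case 0
  interpret wf_digraph X by (rule X)
  have "{p. awalk u p v \<and> length p = 0} = (if u = v then {[]} else {})"
    using 0 by (auto simp: awalk_def)
  then show ?case by (simp add: Finite_Cartesian_Product.mat_def)
next
  case (Suc l)
  interpret wf_digraph X by (rule X)
  let ?N = "{w. (u, w) \<in> arcs X}" and ?W = "\<lambda>w. {p. awalk w p v \<and> length p = l}"
  have fin: "finite (?W w)" for w
    by (rule finite_subset[OF _ finite_lists_length_eq[of "UNIV :: ('a \<times> 'a) set" l]]) auto
  have "bij_betw (\<lambda>(w, p). (u, w) # p) (SIGMA w:?N. ?W w) {p. awalk u p v \<and> length p = Suc l}"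
  proof (rule bij_betw_byWitness[where f' = "\<lambda>p. (snd (hd p), tl p)"])
    show "(\<lambda>(w, p). (u, w) # p) ` (SIGMA w:?N. ?W w) \<subseteq> {p. awalk u p v \<and> length p = Suc l}"
      using X by (auto simp: awalk_Cons_iff)
    show "(\<lambda>p. (snd (hd p), tl p)) ` {p. awalk u p v \<and> length p = Suc l} \<subseteq> (SIGMA w:?N. ?W w)"
      using X by (auto simp: awalk_Cons_iff length_Suc_conv)
    show "\<forall>p\<in>{p. awalk u p v \<and> length p = Suc l}. (\<lambda>(w, p). (u, w) # p) (snd (hd p), tl p) = p"
      using X by (auto simp: awalk_Cons_iff length_Suc_conv)
  qed auto
  then have "card {p. awalk u p v \<and> length p = Suc l} = card (SIGMA w:?N. ?W w)"
    by (simp add: bij_betw_same_card)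
  also have "\<dots> = (\<Sum>w\<in>?N. card (?W w))" using fin by (intro card_SigmaI) auto
  finally have "of_nat (card {p. awalk u p v \<and> length p = Suc l}) = (\<Sum>w\<in>?N. of_nat (card (?W w)) :: complex)"
    by simp
  also have "\<dots> = (\<Sum>w\<in>?N. matrix_power (arc_mat X) l $ w $ v)"
    using Suc.IH X head_in_verts by (intro sum.cong) force+
  also have "\<dots> = (\<Sum>w\<in>UNIV. arc_mat X $ u $ w * matrix_power (arc_mat X) l $ w $ v)"
    by (simp add: arc_mat_def)
  finally show ?case unfolding matrix_power_Suc_left by (simp add: matrix_matrix_mult_def)
qed

text \<open>A nonempty arc list has only one starting point, so the sets for different vertices are
  disjoint; the empty list would belong to all of them.\<close>

lemma num_closed_walks_eq_trace:
  fixes X :: "('a::finite, 'a \<times> 'a) pre_digraph"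
  assumes X: "wf_digraph X" "tail X = fst" "head X = snd" and l: "l > 0"
  shows "of_nat (num_closed_walks X l) = (\<Sum>u\<in>verts X. matrix_power (arc_mat X) l $ u $ u)"
proof -
  interpret wf_digraph X by (rule X)
  let ?W = "\<lambda>u. {p. awalk u p u \<and> length p = l}"
  have fin: "finite (?W w)" for w
    by (rule finite_subset[OF _ finite_lists_length_eq[of "UNIV :: ('a \<times> 'a) set" l]]) auto
  have "{p. (\<exists>u. awalk u p u) \<and> length p = l} = (\<Union>u\<in>verts X. ?W u)"
    by (auto simp: awalk_def)
  then have "num_closed_walks X l = card (\<Union>u\<in>verts X. ?W u)" by (simp add: num_closed_walks_def)
  also have "\<dots> = (\<Sum>u\<in>verts X. card (?W u))"
  proof (rule card_UN_disjoint)
    have "u = v" if "p \<in> ?W u" "p \<in> ?W v" for u v p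
      using that l by (cases p) (auto simp: awalk_Cons_iff)
    then show "\<forall>u\<in>verts X. \<forall>v\<in>verts X. u \<noteq> v \<longrightarrow> ?W u \<inter> ?W v = {}" by blast
  qed (use fin in auto)
  finally show ?thesis using card_awalks_eq_matrix_power[OF X] by simp
qed

section \<open>Walks of directed flags\<close>

text \<open>The second alternative of \<open>flag_arc\<close> would force
  \<open>W2 \<subseteq> W1\<close>.\<close>

lemma flag_arc_up:
  assumes "W1 \<subset> W2"
  shows "flag_arc (W1, W2) (W3, W4) \<longleftrightarrow> W3 = W2 \<and> W1 + W4 = W2 \<and> W1 \<inter> W4 = {0}"
  using assms by (auto simp: flag_arc_def is_direct_sum_def)

text \<open>A direct sum would force \<open>W1 \<subseteq> W2\<close>, since \<open>W4\<close>
  contains 0.\<close>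

lemma flag_arc_down:
  assumes "W2 \<subset> W1" "vec.subspace W4"
  shows "flag_arc (W1, W2) (W3, W4) \<longleftrightarrow> W3 = W2 \<and> W1 \<inter> W4 = W2 \<and> W1 + W4 = UNIV"
  using assms subset_set_plus_left[of W4 W1] by (auto simp: flag_arc_def is_direct_sum_def)

lemma psubset_dim_less:
  fixes U W :: "('k::field ^ 'n::finite) set"
  assumes "vec.subspace U" "vec.subspace W" "U \<subset> W"
  shows "vec.dim U < vec.dim W"
proof (rule ccontr)
  assume "\<not> vec.dim U < vec.dim W"
  then have "U = W" using assms by (intro vec.subspace_dim_equal) auto
  then show False using assms by simp
qed

lemma directed_flagsE:
  assumes "F \<in> directed_flags"
  obtains W1 W2 where "F = (W1, W2)" "vec.subspace W1" "vec.subspace W2" "W1 \<subset> W2 \<or> W2 \<subset> W1"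
  using assms by (auto simp: directed_flags_def proper_subspace_def)

lemma flag_arc_multidim:
  fixes F G :: "('k::field, 'n::finite) subspace_pair"
  assumes F: "F \<in> directed_flags" and G: "G \<in> directed_flags" and arc: "flag_arc F G"
  shows "multidim G = dim_step CARD('n) (multidim F)"
proof -
  obtain W1 W2 where W: "F = (W1, W2)" "vec.subspace W1" "vec.subspace W2" "W1 \<subset> W2 \<or> W2 \<subset> W1"
    using F by (rule directed_flagsE)
  obtain W3 W4 where W': "G = (W3, W4)" "vec.subspace W3" "vec.subspace W4"
    using G by (rule directed_flagsE)
  show ?thesis
  proof (cases "W1 \<subset> W2")
    case True
    then have "W3 = W2" "W1 + W4 = W2" "W1 \<inter> W4 = {0}" using arc unfolding W(1) W'(1) flag_arc_up[OF True] by simp_all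
    moreover have "vec.dim W1 < vec.dim W2" using W True by (intro psubset_dim_less)
    ultimately show ?thesis
      using dim_set_plus_Int[OF W(2) W'(3)] W(1) W'(1) by simp
  next
    case False
    then have "W2 \<subset> W1" using W by blast
    then have "W3 = W2" "W1 \<inter> W4 = W2" "W1 + W4 = UNIV" using arc unfolding W(1) W'(1) flag_arc_down[OF \<open>W2 \<subset> W1\<close> W'(3)] by simp_all
    moreover have "vec.dim W2 < vec.dim W1" using W \<open>W2 \<subset> W1\<close> by (intro psubset_dim_less)
    ultimately show ?thesis
      using dim_set_plus_Int[OF W(2) W'(3)] W(1) W'(1) by simp
  qed
qed

lemma proper_subspaceI:
  "\<lbrakk>vec.subspace W; 0 < vec.dim W; vec.dim W < CARD('n)\<rbrakk> \<Longrightarrow> proper_subspace (W :: ('k::field ^ 'n::finite) set)"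
  by (auto simp: proper_subspace_def)

lemma partial_flags_directed:
  fixes U W :: "('k::field ^ 'n::finite) set"
  assumes "0 < a" "a < b" "b < CARD('n)" "(U, W) \<in> partial_flags a b"
  shows "(U, W) \<in> directed_flags" "(W, U) \<in> directed_flags" "U \<subset> W"
proof -
  show "U \<subset> W" using assms by (auto simp: partial_flags_def)
  then show "(U, W) \<in> directed_flags" "(W, U) \<in> directed_flags"
    using assms by (auto simp: partial_flags_def directed_flags_def intro!: proper_subspaceI)
qed

lemma directed_flags_partial:
  "\<lbrakk>F \<in> directed_flags; multidim F = (a, b); a < b\<rbrakk> \<Longrightarrow> F \<in> partial_flags a b"
  "\<lbrakk>F \<in> directed_flags; multidim F = (b, a); a < b\<rbrakk> \<Longrightarrow> prod.swap F \<in> partial_flags a b"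
  by (auto elim!: directed_flagsE dest: psubset_dim_less simp: partial_flags_def)

text \<open>The space shared by \<open>x\<close> and \<open>y\<close> complements \<open>W1\<close>
  in \<open>W2\<close>, and the second arc identifies it as \<open>W2 \<inter> R1\<close>, so there
  is at most one walk. Transversality is exactly what makes this space work. The final flag is
  descending, hence the order \<open>(R2, R1)\<close>.\<close>

lemma three_arcs_up_iff:
  fixes W1 W2 R1 R2 :: "('k::field ^ 'n::finite) set"
  assumes ab: "0 < a" "a < b" "b < CARD('n)" and W: "(W1, W2) \<in> partial_flags a b"
  shows "{(x, y). x \<in> directed_flags \<and> y \<in> directed_flags \<and> (R1, R2) \<in> directed_flags \<and>
      flag_arc (W1, W2) x \<and> flag_arc x y \<and> flag_arc y (R1, R2)} =
    (if (R2, R1) \<in> partial_flags (CARD('n) - b) (CARD('n) - a) \<and> transversal (W1, W2) (R2, R1)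
     then {((W2, W2 \<inter> R1), (W2 \<inter> R1, R1))} else {})" (is "?L = ?R")
proof -
  let ?n = "CARD('n)"
  have subW: "vec.subspace W1" "vec.subspace W2" and dimW: "vec.dim W1 = a" "vec.dim W2 = b"
    and W12: "W1 \<subset> W2"
    using W partial_flags_directed[OF ab W] by (auto simp: partial_flags_def)
  have fwd: "(R2, R1) \<in> partial_flags (?n - b) (?n - a) \<and> transversal (W1, W2) (R2, R1) \<and>
      x = (W2, W2 \<inter> R1) \<and> y = (W2 \<inter> R1, R1)"
    if dir: "x \<in> directed_flags" "y \<in> directed_flags" "(R1, R2) \<in> directed_flags"
      and arcs: "flag_arc (W1, W2) x" "flag_arc x y" "flag_arc y (R1, R2)" for x y
  proof -
    \<comment> \<open>The types propagate along the arcs and tell which flags are ascending, hence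
      which alternative of \<open>flag_arc\<close> applies.\<close>
    have mx: "multidim x = (b, b - a)"
      using flag_arc_multidim[OF partial_flags_directed(1)[OF ab W] dir(1) arcs(1)] dimW ab by simp
    then have "multidim y = (b - a, ?n - a)"
      using flag_arc_multidim[OF dir(1,2) arcs(2)] ab by simp
    then have mr: "multidim (R1, R2) = (?n - a, ?n - b)"
      using flag_arc_multidim[OF dir(2,3) arcs(3)] ab by simp
    obtain X1 W4 where x4: "x = (X1, W4)" "vec.subspace W4" using dir(1) by (rule directed_flagsE)
    obtain Y1 Y2 where y12: "y = (Y1, Y2)" using dir(2) by (rule directed_flagsE)
    have "X1 = W2" "Y1 = W4" "Y2 = R1" using arcs unfolding x4(1) y12 by (simp_all add: flag_arc_def)
    then have x: "x = (W2, W4)" and y: "y = (W4, R1)" and W4: "vec.subspace W4" "vec.dim W4 = b - a"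
      using x4 y12 mx by simp_all
    have R: "(R2, R1) \<in> partial_flags (?n - b) (?n - a)"
      using directed_flags_partial(2)[OF dir(3) mr] ab by auto
    then have subR: "vec.subspace R1" "vec.subspace R2" "R2 \<subseteq> R1" by (auto simp: partial_flags_def)
    have 1: "W1 + W4 = W2" "W1 \<inter> W4 = {0}" using arcs(1) unfolding x flag_arc_up[OF W12] by simp_all
    have "vec.dim W4 < vec.dim W2" using W4 dimW ab by simp
    moreover have "W4 \<subseteq> W2" using 1 subset_set_plus_right[OF subW(1)] by blast
    ultimately have "W4 \<subset> W2" by auto
    then have 2: "W2 \<inter> R1 = W4" "W2 + R1 = UNIV"
      using arcs(2) unfolding x y flag_arc_down[OF \<open>W4 \<subset> W2\<close> subR(1)] by simp_all
    have "vec.dim W4 < vec.dim R1" using W4 R ab by (auto simp: partial_flags_def)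
    then have "W4 \<subset> R1" using 2 by auto
    then have 3: "W4 + R2 = R1" "W4 \<inter> R2 = {0}" using arcs(3) unfolding y flag_arc_up[OF \<open>W4 \<subset> R1\<close>] by simp_all
    have "W1 \<inter> R1 = {0}" using 1 2 W12 by blast
    moreover have "W2 \<inter> R2 = {0}" using 2 3 subR by blast
    ultimately show ?thesis using R x y 2 by (simp add: transversal.simps)
  qed
  show ?thesis
  proof (cases "(R2, R1) \<in> partial_flags (?n - b) (?n - a) \<and> transversal (W1, W2) (R2, R1)")
    case False
    have "p \<notin> ?L" for p
      using fwd[of "fst p" "snd p"] False unfolding mem_Collect_eq case_prod_beta by blast
    then have "?L = {}" by blast
    then show ?thesis using False by (simp only: if_False)
  next
    case True
    then have R: "(R2, R1) \<in> partial_flags (?n - b) (?n - a)" by blast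
    have subR: "vec.subspace R1" "vec.subspace R2" and dimR: "vec.dim R1 = ?n - a" "vec.dim R2 = ?n - b"
      using R by (auto simp: partial_flags_def)
    have ab': "0 < ?n - b" "?n - b < ?n - a" "?n - a < ?n" using ab by auto
    note Rdir = partial_flags_directed[OF ab' R]
    have tr: "W1 \<inter> R1 = {0}" "W2 \<inter> R2 = {0}" using True by (auto simp: transversal.simps)
    define W4 where "W4 = W2 \<inter> R1"
    have sub4: "vec.subspace W4" unfolding W4_def using subW subR by (intro vec.subspace_inter)
    \<comment> \<open>Complementary dimensions turn a trivial intersection into a spanning sum;
      enlarging \<open>W1\<close> to \<open>W2\<close> then yields
      \<open>dim W4 = b - a\<close>.\<close>
    have "W1 + R1 = UNIV"
      using dim_set_plus_Int[OF subW(1) subR(1)] tr dimW dimR ab subW subR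
      by (intro subspace_eq_UNIV subspace_set_plus) auto
    moreover have "W1 + R1 \<subseteq> W2 + R1" using W12 by (intro set_plus_mono2) auto
    ultimately have 2: "W2 + R1 = UNIV" by auto
    then have dim4: "vec.dim W4 = b - a"
      using dim_set_plus_Int[OF subW(2) subR(1)] dimW dimR ab by (simp add: W4_def)
    have W14: "W1 \<inter> W4 = {0}" using tr W12 subW(1)[THEN vec.subspace_0] sub4[THEN vec.subspace_0] by (auto simp: W4_def)
    have 1: "W1 + W4 = W2"
    proof (rule vec.subspace_dim_equal)
      show "W1 + W4 \<subseteq> W2" using subW W12 by (intro set_plus_subset) (auto simp: W4_def)
      show "vec.dim (W1 + W4) \<ge> vec.dim W2"
        using dim_set_plus_Int[OF subW(1) sub4] W14 dimW dim4 ab by simp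
    qed (use subW sub4 subspace_set_plus in auto)
    have W48: "W4 \<inter> R2 = {0}" using tr subR(2)[THEN vec.subspace_0] sub4[THEN vec.subspace_0] by (auto simp: W4_def)
    have 3: "W4 + R2 = R1"
    proof (rule vec.subspace_dim_equal)
      show "W4 + R2 \<subseteq> R1" using subR Rdir(3) by (intro set_plus_subset) (auto simp: W4_def)
      show "vec.dim (W4 + R2) \<ge> vec.dim R1"
        using dim_set_plus_Int[OF sub4 subR(2)] W48 dimR dim4 ab by simp
    qed (use subR sub4 subspace_set_plus in auto)
    have p4: "(W4, W2) \<in> partial_flags (b - a) b" "(W4, R1) \<in> partial_flags (b - a) (?n - a)"
      using sub4 subW subR dim4 dimW dimR by (auto simp: partial_flags_def W4_def)
    have d42: "(W2, W4) \<in> directed_flags" "W4 \<subset> W2"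
      using partial_flags_directed[of "b - a" b W4 W2] p4 ab by auto
    have d4R: "(W4, R1) \<in> directed_flags" "W4 \<subset> R1"
      using partial_flags_directed[of "b - a" "?n - a" W4 R1] p4 ab by auto
    have "flag_arc (W1, W2) (W2, W4)" using W12 1 W14 by (simp add: flag_arc_up)
    moreover have "flag_arc (W2, W4) (W4, R1)" using d42 2 subR by (simp add: flag_arc_down W4_def)
    moreover have "flag_arc (W4, R1) (R1, R2)" using d4R 3 W48 by (simp add: flag_arc_up)
    ultimately have "((W2, W4), (W4, R1)) \<in> ?L" using d42 d4R Rdir by simp
    moreover have "?L \<subseteq> {((W2, W2 \<inter> R1), (W2 \<inter> R1, R1))}"
    proof
      fix p assume "p \<in> ?L"
      then show "p \<in> {((W2, W2 \<inter> R1), (W2 \<inter> R1, R1))}"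
        using fwd[of "fst p" "snd p"] unfolding mem_Collect_eq case_prod_beta by (simp add: prod_eq_iff)
    qed
    ultimately have "?L = {((W2, W2 \<inter> R1), (W2 \<inter> R1, R1))}" unfolding W4_def by blast
    then show ?thesis using True by (simp only: if_True simp_thms)
  qed
qed

text \<open>The dual situation: the arcs start at descending, ascending and descending flags, and
  the join \<open>R2 + W1\<close> replaces the meet.\<close>

lemma three_arcs_down_iff:
  fixes R1 R2 W1 W2 :: "('k::field ^ 'n::finite) set"
  assumes ab: "0 < a" "a < b" "b < CARD('n)" and R: "(R2, R1) \<in> partial_flags (CARD('n) - b) (CARD('n) - a)"
  shows "{(x, y). x \<in> directed_flags \<and> y \<in> directed_flags \<and> (W1, W2) \<in> directed_flags \<and>
      flag_arc (R1, R2) x \<and> flag_arc x y \<and> flag_arc y (W1, W2)} =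
    (if (W1, W2) \<in> partial_flags a b \<and> transversal (R2, R1) (W1, W2)
     then {((R2, R2 + W1), (R2 + W1, W1))} else {})" (is "?L = ?R")
proof -
  let ?n = "CARD('n)"
  have ab': "0 < ?n - b" "?n - b < ?n - a" "?n - a < ?n" using ab by auto
  note Rdir = partial_flags_directed[OF ab' R]
  have subR: "vec.subspace R1" "vec.subspace R2" and dimR: "vec.dim R1 = ?n - a" "vec.dim R2 = ?n - b"
    using R by (auto simp: partial_flags_def)
  have fwd: "(W1, W2) \<in> partial_flags a b \<and> transversal (R2, R1) (W1, W2) \<and>
      x = (R2, R2 + W1) \<and> y = (R2 + W1, W1)"
    if dir: "x \<in> directed_flags" "y \<in> directed_flags" "(W1, W2) \<in> directed_flags"
      and arcs: "flag_arc (R1, R2) x" "flag_arc x y" "flag_arc y (W1, W2)" for x y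
  proof -
    have mx: "multidim x = (?n - b, ?n - b + a)"
      using flag_arc_multidim[OF Rdir(2) dir(1) arcs(1)] dimR ab by simp
    then have "multidim y = (?n - b + a, a)"
      using flag_arc_multidim[OF dir(1,2) arcs(2)] ab by simp
    then have mw: "multidim (W1, W2) = (a, b)"
      using flag_arc_multidim[OF dir(2,3) arcs(3)] ab by simp
    obtain X1 W4 where x4: "x = (X1, W4)" "vec.subspace W4" using dir(1) by (rule directed_flagsE)
    obtain Y1 Y2 where y12: "y = (Y1, Y2)" using dir(2) by (rule directed_flagsE)
    have "X1 = R2" "Y1 = W4" "Y2 = W1" using arcs unfolding x4(1) y12 by (simp_all add: flag_arc_def)
    then have x: "x = (R2, W4)" and y: "y = (W4, W1)" and W4: "vec.subspace W4" "vec.dim W4 = ?n - b + a"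
      using x4 y12 mx by simp_all
    have W: "(W1, W2) \<in> partial_flags a b"
      using directed_flags_partial(1)[OF dir(3) mw] ab by auto
    then have subW: "vec.subspace W1" "vec.subspace W2" "W1 \<subseteq> W2" and dimW: "vec.dim W1 = a"
      by (auto simp: partial_flags_def)
    have 1: "R1 \<inter> W4 = R2" "R1 + W4 = UNIV"
      using arcs(1) unfolding x flag_arc_down[OF Rdir(3) W4(1)] by simp_all
    have "vec.dim R2 < vec.dim W4" using W4 dimR ab by simp
    then have "R2 \<subset> W4" using 1 by auto
    then have 2: "R2 + W1 = W4" "R2 \<inter> W1 = {0}" using arcs(2) unfolding x y flag_arc_up[OF \<open>R2 \<subset> W4\<close>] by simp_all
    have "vec.dim W1 < vec.dim W4" using W4 dimW ab by simp
    moreover have "W1 \<subseteq> W4" using 2 subset_set_plus_right[OF subR(2)] by blast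
    ultimately have "W1 \<subset> W4" by auto
    then have 3: "W4 \<inter> W2 = W1" using arcs(3) unfolding y flag_arc_down[OF \<open>W1 \<subset> W4\<close> subW(2)] by simp
    have "R2 \<inter> W2 = {0}" using 2 3 \<open>R2 \<subset> W4\<close> by blast
    moreover have "R1 \<inter> W1 = {0}" using 1 2 \<open>W1 \<subset> W4\<close> by blast
    ultimately show ?thesis using W x y 2 by (simp add: transversal.simps)
  qed
  show ?thesis
  proof (cases "(W1, W2) \<in> partial_flags a b \<and> transversal (R2, R1) (W1, W2)")
    case False
    have "p \<notin> ?L" for p
      using fwd[of "fst p" "snd p"] False unfolding mem_Collect_eq case_prod_beta by blast
    then have "?L = {}" by blast
    then show ?thesis using False by (simp only: if_False)
  next
    case True
    then have W: "(W1, W2) \<in> partial_flags a b" by blast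
    have subW: "vec.subspace W1" "vec.subspace W2" and dimW: "vec.dim W1 = a" "vec.dim W2 = b"
      using W by (auto simp: partial_flags_def)
    note Wdir = partial_flags_directed[OF ab W]
    have tr: "R2 \<inter> W2 = {0}" "R1 \<inter> W1 = {0}" using True by (auto simp: transversal.simps)
    define W4 where "W4 = R2 + W1"
    have sub4: "vec.subspace W4" unfolding W4_def using subW subR by (intro subspace_set_plus)
    have RW: "R2 \<inter> W1 = {0}" using tr Wdir(3) subR(2)[THEN vec.subspace_0] subW(1)[THEN vec.subspace_0] by auto
    have dim4: "vec.dim W4 = ?n - b + a"
      using dim_set_plus_Int[OF subR(2) subW(1)] RW dimW dimR by (simp add: W4_def)
    have R24: "R2 \<subseteq> W4" and W14: "W1 \<subseteq> W4"
      unfolding W4_def using subR subW by (simp_all only: subset_set_plus_left subset_set_plus_right)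
    have "R1 + W1 = UNIV"
      using dim_set_plus_Int[OF subR(1) subW(1)] tr dimW dimR ab subW subR
      by (intro subspace_eq_UNIV subspace_set_plus) auto
    moreover have "R1 + W1 \<subseteq> R1 + W4" using W14 by (intro set_plus_mono2) auto
    ultimately have 1: "R1 + W4 = UNIV" by auto
    have meet2: "R1 \<inter> W4 = R2"
    proof (rule sym, rule vec.subspace_dim_equal)
      show "R2 \<subseteq> R1 \<inter> W4" using R24 Rdir(3) by auto
      show "vec.dim (R1 \<inter> W4) \<le> vec.dim R2"
        using dim_set_plus_Int[OF subR(1) sub4] 1 dimR dim4 ab by simp
    qed (use subR sub4 vec.subspace_inter in auto)
    have "R2 + W2 = UNIV"
      using dim_set_plus_Int[OF subR(2) subW(2)] tr dimW dimR ab subW subR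
      by (intro subspace_eq_UNIV subspace_set_plus) auto
    moreover have "R2 + W2 \<subseteq> W4 + W2" using R24 by (intro set_plus_mono2) auto
    ultimately have 3: "W4 + W2 = UNIV" by auto
    have meet1: "W4 \<inter> W2 = W1"
    proof (rule sym, rule vec.subspace_dim_equal)
      show "W1 \<subseteq> W4 \<inter> W2" using W14 Wdir(3) by auto
      show "vec.dim (W4 \<inter> W2) \<le> vec.dim W1"
        using dim_set_plus_Int[OF sub4 subW(2)] 3 dimW dim4 ab by simp
    qed (use subW sub4 vec.subspace_inter in auto)
    have p4: "(R2, W4) \<in> partial_flags (?n - b) (?n - b + a)" "(W1, W4) \<in> partial_flags a (?n - b + a)"
      using sub4 subW subR dim4 dimW dimR R24 W14 by (auto simp: partial_flags_def)
    have d2: "(R2, W4) \<in> directed_flags" "R2 \<subset> W4"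
      using partial_flags_directed[of "?n - b" "?n - b + a" R2 W4] p4 ab by auto
    have d1: "(W4, W1) \<in> directed_flags" "W1 \<subset> W4"
      using partial_flags_directed[of a "?n - b + a" W1 W4] p4 ab by auto
    have "flag_arc (R1, R2) (R2, W4)" using Rdir(3) 1 meet2 sub4 by (simp add: flag_arc_down)
    moreover have "flag_arc (R2, W4) (W4, W1)" using d2 RW by (simp add: flag_arc_up W4_def)
    moreover have "flag_arc (W4, W1) (W1, W2)" using d1 3 meet1 subW by (simp add: flag_arc_down)
    ultimately have "((R2, W4), (W4, W1)) \<in> ?L" using d1 d2 Wdir by simp
    moreover have "?L \<subseteq> {((R2, R2 + W1), (R2 + W1, W1))}"
    proof
      fix p assume "p \<in> ?L"
      then show "p \<in> {((R2, R2 + W1), (R2 + W1, W1))}"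
        using fwd[of "fst p" "snd p"] unfolding mem_Collect_eq case_prod_beta by (simp add: prod_eq_iff)
    qed
    ultimately have "?L = {((R2, R2 + W1), (R2 + W1, W1))}" unfolding W4_def by blast
    then show ?thesis using True by (simp only: if_True simp_thms)
  qed
qed

section \<open>The class digraph and three-step walks\<close>

lemma matrix_power_3_nth:
  fixes E :: "'x::finite \<Rightarrow> 'x \<Rightarrow> bool"
  shows "matrix_power (rel_mat E) 3 $ u $ v = of_nat (card {(x, y). E u x \<and> E x y \<and> E y v})"
proof -
  have "matrix_power (rel_mat E) 3 = rel_mat E ** rel_mat E ** rel_mat E"
    by (simp add: numeral_3_eq_3)
  then have "matrix_power (rel_mat E) 3 $ u $ v = (\<Sum>y\<in>UNIV. (\<Sum>x\<in>UNIV. rel_mat E $ u $ x * rel_mat E $ x $ y) * rel_mat E $ y $ v)"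
    by (simp only: matrix_matrix_mult_def vec_lambda_beta)
  also have "\<dots> = (\<Sum>y\<in>UNIV. \<Sum>x\<in>UNIV. of_bool (E u x \<and> E x y \<and> E y v))"
    by (simp only: rel_mat_nth sum_distrib_right of_bool_conj mult.assoc)
  also have "\<dots> = (\<Sum>p\<in>UNIV. of_bool (E u (fst p) \<and> E (fst p) (snd p) \<and> E (snd p) v))"
    by (subst sum.swap) (simp only: sum.cartesian_product UNIV_Times_UNIV case_prod_unfold)
  also have "\<dots> = of_nat (card {p. E u (fst p) \<and> E (fst p) (snd p) \<and> E (snd p) v})"
    by (simp del: of_bool_conj)
  finally show ?thesis by (simp add: case_prod_unfold)
qed

lemma wf_class_flag_digraph:
  "wf_digraph (class_flag_digraph ab :: (('k::{field,finite}, 'n::finite) subspace_pair, _) pre_digraph)"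
  using fin_digraph_class_flag_digraph[of ab] by (rule fin_digraph.axioms(1))

lemma class_flag_digraph_simps:
  "verts (class_flag_digraph ab :: (('k::field, 'n::finite) subspace_pair, _) pre_digraph) =
     {F \<in> directed_flags. multidim F \<in> dim_class CARD('n) ab}"
  "tail (class_flag_digraph ab :: (('k, 'n) subspace_pair, _) pre_digraph) = fst"
  "head (class_flag_digraph ab :: (('k, 'n) subspace_pair, _) pre_digraph) = snd"
  "(F, G) \<in> arcs (class_flag_digraph ab :: (('k, 'n) subspace_pair, _) pre_digraph) \<longleftrightarrow>
     F \<in> directed_flags \<and> G \<in> directed_flags \<and> flag_arc F G \<and>
     multidim F \<in> dim_class CARD('n) ab \<and> multidim G \<in> dim_class CARD('n) ab"
  by (auto simp: class_flag_digraph_def flag_digraph_def)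

section \<open>The orbit of a multi-dimension\<close>

locale dim_orbit =
  fixes n a b :: nat
  assumes ab: "0 < a" "a < b" "b < n" and not_third: "\<not> (3 * a = n \<and> 3 * b = 2 * n)"
begin

abbreviation "step \<equiv> dim_step n"

lemma steps:
  "(step ^^ 1) (a, b) = (b, b - a)" "(step ^^ 2) (a, b) = (b - a, n - a)"
  "(step ^^ 3) (a, b) = (n - a, n - b)" "(step ^^ 4) (a, b) = (n - b, n - b + a)"
  "(step ^^ 5) (a, b) = (n - b + a, a)" "(step ^^ 6) (a, b) = (a, b)"
proof -
  show 1: "(step ^^ 1) (a, b) = (b, b - a)" using ab by simp
  have "(step ^^ 2) (a, b) = step ((step ^^ 1) (a, b))" by (simp add: numeral_2_eq_2)
  then show 2: "(step ^^ 2) (a, b) = (b - a, n - a)" unfolding 1 using ab by simp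
  have "(step ^^ 3) (a, b) = step ((step ^^ 2) (a, b))" by (simp add: numeral_3_eq_3 numeral_2_eq_2)
  then show 3: "(step ^^ 3) (a, b) = (n - a, n - b)" unfolding 2 using ab by simp
  have "(step ^^ 4) (a, b) = step ((step ^^ 3) (a, b))"
    using funpow.simps(2)[of 3 step] by (simp add: eval_nat_numeral)
  then show 4: "(step ^^ 4) (a, b) = (n - b, n - b + a)" unfolding 3 using ab by simp
  have "(step ^^ 5) (a, b) = step ((step ^^ 4) (a, b))"
    using funpow.simps(2)[of 4 step] by (simp add: eval_nat_numeral)
  then show 5: "(step ^^ 5) (a, b) = (n - b + a, a)" unfolding 4 using ab by simp
  have "(step ^^ 6) (a, b) = step ((step ^^ 5) (a, b))"
    using funpow.simps(2)[of 5 step] by (simp add: eval_nat_numeral)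
  then show "(step ^^ 6) (a, b) = (a, b)" unfolding 5 using ab by simp
qed

lemma step_mod: "(step ^^ m) (a, b) = (step ^^ (m mod 6)) (a, b)"
  by (rule funpow_mod_eq[symmetric]) (rule steps)

text \<open>Remainders 2 and 4 fix the pair only if \<open>b = 2 a\<close> and
  \<open>n = 3 a\<close>, the excluded orbit of length 2; odd remainders contradict
  \<open>a < b < n\<close>.\<close>

lemma step_fixed_iff: "(step ^^ m) (a, b) = (a, b) \<longleftrightarrow> 6 dvd m"
proof
  assume fixed: "(step ^^ m) (a, b) = (a, b)"
  have "m mod 6 < 6" by simp
  then consider "m mod 6 = 0" | "m mod 6 = 1" | "m mod 6 = 2" | "m mod 6 = 3" | "m mod 6 = 4" | "m mod 6 = 5"
    by linarith
  then show "6 dvd m"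
    using fixed step_mod[of m] steps ab not_third by cases (auto simp: dvd_eq_mod_eq_0)
next
  assume "6 dvd m"
  then show "(step ^^ m) (a, b) = (a, b)" using step_mod[of m] by (auto simp: dvd_eq_mod_eq_0)
qed

lemma dim_class_altdef: "dim_class n (a, b) = (\<lambda>i. (step ^^ i) (a, b)) ` {..<6}"
proof (intro equalityI subsetI)
  fix t assume "t \<in> dim_class n (a, b)"
  then obtain m where "t = (step ^^ (m mod 6)) (a, b)" using step_mod by (auto simp: dim_class_def)
  then show "t \<in> (\<lambda>i. (step ^^ i) (a, b)) ` {..<6}" by auto
qed (auto simp: dim_class_def)

lemma step_period: "t \<in> dim_class n (a, b) \<Longrightarrow> (step ^^ 6) t = t"
proof -
  assume "t \<in> dim_class n (a, b)"
  then obtain m where m: "t = (step ^^ m) (a, b)" by (auto simp: dim_class_def)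
  then have "(step ^^ 6) t = (step ^^ (m + 6)) (a, b)" by (simp add: funpow_add add.commute[of m] del: funpow.simps)
  also have "\<dots> = t" using m steps(6) by (simp only: funpow_add o_apply)
  finally show ?thesis .
qed

lemma step_in_class: "t \<in> dim_class n (a, b) \<Longrightarrow> step t \<in> dim_class n (a, b)"
proof -
  assume "t \<in> dim_class n (a, b)"
  then obtain m where "t = (step ^^ m) (a, b)" by (auto simp: dim_class_def)
  then have "step t = (step ^^ Suc m) (a, b)" by simp
  then show ?thesis unfolding dim_class_def by blast
qed

text \<open>On the class the sixth iterate is the identity, so the fifth iterate undoes
  \<open>step\<close>.\<close>

lemma step_inj_on: "inj_on step (dim_class n (a, b))"
proof (rule inj_onI)
  fix s t assume st: "s \<in> dim_class n (a, b)" "t \<in> dim_class n (a, b)" "step s = step t"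
  have "(step ^^ 5) (step s) = (step ^^ 5) (step t)" using st(3) by simp
  then have "(step ^^ 6) s = (step ^^ 6) t"
    using funpow_Suc_right[of 5 step] by (simp add: eval_nat_numeral)
  then show "s = t" using step_period st by simp
qed

lemma card_dim_class: "card (dim_class n (a, b)) = 6"
proof -
  have "inj_on (\<lambda>i. (step ^^ i) (a, b)) {..<6}"
  proof (rule linorder_inj_onI)
    fix i j :: nat assume ij: "i < j" "j \<in> {..<6}"
    show "(step ^^ i) (a, b) \<noteq> (step ^^ j) (a, b)"
    proof
      assume eq: "(step ^^ i) (a, b) = (step ^^ j) (a, b)"
      \<comment> \<open>Another \<open>6 - i\<close> steps turn the coincidence into a return to
        \<open>(a, b)\<close>.\<close>
      have "(step ^^ (6 - i + j)) (a, b) = (step ^^ (6 - i)) ((step ^^ j) (a, b))"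
        by (simp only: funpow_add o_apply)
      also have "\<dots> = (step ^^ (6 - i + i)) (a, b)" by (simp only: funpow_add o_apply eq)
      also have "\<dots> = (a, b)" using steps(6) ij by simp
      finally have "6 dvd 6 - i + j" using step_fixed_iff by blast
      moreover have "6 - i + j = 6 + (j - i)" using ij by simp
      ultimately have "6 dvd j - i" by (metis dvd_add_triv_left_iff)
      then show False using ij by (auto dest: dvd_imp_le)
    qed
  qed (rule nat_le_linear)
  then show ?thesis unfolding dim_class_altdef by (simp add: card_image)
qed

end

section \<open>The zeta function of a class\<close>

lemma inverse_zeta_class_flag_digraph:
  fixes X :: "(('k::{field,finite}, 'n::finite) subspace_pair,
               ('k, 'n) subspace_pair \<times> ('k, 'n) subspace_pair) pre_digraph"
  assumes ab: "0 < a" "a < b" "b < CARD('n)" and third: "\<not> (3 * a = CARD('n) \<and> 3 * b = 2 * CARD('n))"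
    and X: "X = class_flag_digraph (a, b)"
  shows "\<exists>ss :: nat list.
    inverse (zeta_c X) = (\<Prod>s\<leftarrow>ss. 1 - fps_const (of_nat (CARD('k) ^ s)) * fps_X ^ 6)"
proof -
  let ?n = "CARD('n)"
  interpret dim_orbit ?n a b by unfold_locales (use ab third in auto)
  define T where "T = dim_class ?n (a, b)"
  define V where "V = (\<lambda>t. {F :: ('k, 'n) subspace_pair. F \<in> directed_flags \<and> multidim F = t})"
  define A where "A = arc_mat X"
  define pw where "pw = matrix_power A"
  have wf: "wf_digraph X" "tail X = fst" "head X = snd"
    unfolding X by (rule wf_class_flag_digraph class_flag_digraph_simps)+
  have verts: "verts X = (\<Union>t\<in>T. V t)" unfolding X class_flag_digraph_simps V_def T_def by auto
  have arc: "(F, G) \<in> arcs X \<longleftrightarrow> F \<in> directed_flags \<and> G \<in> directed_flags \<and> flag_arc F G \<and> multidim F \<in> T"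
    for F G
    unfolding X class_flag_digraph_simps T_def using flag_arc_multidim[of F G] step_in_class[of "multidim F"]
    by (auto simp del: dim_step.simps)
  have A_nz: "(F, G) \<in> arcs X" if "A $ F $ G \<noteq> 0" for F G
    using that by (simp add: A_def arc_mat_def split: if_splits)
  have A_step: "multidim G = step (multidim F)" "multidim F \<in> T" "F \<in> directed_flags" "G \<in> directed_flags"
    if "A $ F $ G \<noteq> 0" for F G
    using A_nz[OF that] flag_arc_multidim[of F G] by (auto simp: arc)
  have pw_step: "multidim G = (step ^^ l) (multidim F) \<and> (F \<in> directed_flags \<longrightarrow> G \<in> directed_flags)"
    if "pw l $ F $ G \<noteq> 0" for l F G
    using that
  proof (induction l arbitrary: G)
    case 0
    then show ?case by (simp add: pw_def Finite_Cartesian_Product.mat_def split: if_splits)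
  next
    case (Suc l)
    then have "(\<Sum>w\<in>UNIV. pw l $ F $ w * A $ w $ G) \<noteq> 0"
      by (simp add: pw_def matrix_matrix_mult_def)
    then obtain w where "pw l $ F $ w * A $ w $ G \<noteq> 0" by (rule sum.not_neutral_contains_not_neutral)
    then have "pw l $ F $ w \<noteq> 0" "A $ w $ G \<noteq> 0" by auto
    then show ?case using Suc.IH[of w] A_step[of w G] by simp
  qed
  define S where "S = (\<lambda>l t. \<Sum>u\<in>V t. pw l $ u $ u)"
  \<comment> \<open>Moving the first arc of a closed walk to its end changes the starting type from
    \<open>t\<close> to \<open>step t\<close>, and by injectivity of \<open>step\<close> arcs into
    type \<open>step t\<close> come only from type \<open>t\<close>. The length is positive so that
    there is an arc to move.\<close>
  have S_step: "S (Suc l) t = S (Suc l) (step t)" if t: "t \<in> T" for l t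
  proof -
    have "S (Suc l) t = (\<Sum>u\<in>V t. \<Sum>w\<in>UNIV. A $ u $ w * pw l $ w $ u)"
      unfolding S_def pw_def matrix_power_Suc_left by (simp add: matrix_matrix_mult_def)
    also have "\<dots> = (\<Sum>u\<in>V t. \<Sum>w\<in>V (step t). A $ u $ w * pw l $ w $ u)"
      using A_step by (intro sum.cong sum.mono_neutral_right) (auto simp: V_def)
    also have "\<dots> = (\<Sum>w\<in>V (step t). \<Sum>u\<in>V t. pw l $ w $ u * A $ u $ w)"
      by (subst sum.swap) (simp add: mult.commute)
    also have "\<dots> = (\<Sum>w\<in>V (step t). \<Sum>u\<in>UNIV. pw l $ w $ u * A $ u $ w)"
    proof (rule sum.cong[OF refl])
      fix w assume w: "w \<in> V (step t)"
      show "(\<Sum>u\<in>V t. pw l $ w $ u * A $ u $ w) = (\<Sum>u\<in>UNIV. pw l $ w $ u * A $ u $ w)"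
      proof (rule sum.mono_neutral_left)
        have "u \<in> V t" if nz: "A $ u $ w \<noteq> 0" for u
        proof -
          have "step (multidim u) = step t" "multidim u \<in> T" "u \<in> directed_flags"
            using A_step[OF nz] w by (simp_all only: V_def mem_Collect_eq)
          then show ?thesis using inj_onD[OF step_inj_on, of "multidim u" t] t by (simp add: T_def V_def)
        qed
        then show "\<forall>u\<in>UNIV - V t. pw l $ w $ u * A $ u $ w = 0" by auto
      qed auto
    qed
    also have "\<dots> = S (Suc l) (step t)"
      unfolding S_def pw_def by (simp add: matrix_matrix_mult_def)
    finally show ?thesis .
  qed
  have S_const: "S (Suc l) t = S (Suc l) (a, b)" if t: "t \<in> T" for l t
  proof -
    obtain m where "t = (step ^^ m) (a, b)" using t unfolding T_def dim_class_def by blast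
    moreover have "S (Suc l) ((step ^^ m) (a, b)) = S (Suc l) (a, b)"
    proof (induction m)
      case (Suc m)
      have "(step ^^ m) (a, b) \<in> T" unfolding T_def dim_class_def by blast
      then show ?case using S_step[of "(step ^^ m) (a, b)" l] Suc by simp
    qed simp
    ultimately show ?thesis by simp
  qed
  have N: "of_nat (num_closed_walks X l) = 6 * S l (a, b)" if "l > 0" for l
  proof -
    have "of_nat (num_closed_walks X l) = (\<Sum>u\<in>(\<Union>t\<in>T. V t). pw l $ u $ u)"
      unfolding num_closed_walks_eq_trace[OF wf that] verts pw_def A_def ..
    also have "\<dots> = (\<Sum>t\<in>T. S l t)"
      unfolding S_def by (rule sum.UNION_disjoint) (auto simp: V_def T_def dim_class_altdef)
    also have "\<dots> = (\<Sum>t\<in>T. S l (a, b))"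
      using S_const[of _ "l - 1"] that by (intro sum.cong) auto
    finally show ?thesis using card_dim_class by (simp add: T_def)
  qed
  have V0: "V (a, b) = partial_flags a b"
  proof (intro equalityI subsetI)
    fix F assume "F \<in> V (a, b)"
    then show "F \<in> partial_flags a b" using directed_flags_partial(1)[of F a b] ab by (simp add: V_def)
  next
    fix F :: "('k, 'n) subspace_pair" assume F: "F \<in> partial_flags a b"
    obtain U W where UW: "F = (U, W)" by (cases F)
    show "F \<in> V (a, b)"
      using F partial_flags_directed(1)[OF ab F[unfolded UW]] unfolding UW V_def by (simp add: partial_flags_def)
  qed
  \<comment> \<open>The index type consists of all pairs of sets, so the six-step operator is padded
    by zero rows; this only adds eigenvalues 0.\<close>
  define M where "M = (\<chi> u v. if u \<in> V (a, b) then pw 6 $ u $ v else 0)"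
  have pw6_V: "v \<in> V (a, b)" if "pw 6 $ u $ v \<noteq> 0" "u \<in> V (a, b)" for u v
    using pw_step[OF that(1)] that(2) steps(6) by (auto simp: V_def)
  \<comment> \<open>Positive powers only: the power 0 of \<open>M\<close> is the identity on all
    pairs, not just on flags of type \<open>(a, b)\<close>.\<close>
  have M_pow: "matrix_power M (Suc k) $ u $ v = (if u \<in> V (a, b) then pw (6 * Suc k) $ u $ v else 0)" for k u v
  proof (induction k arbitrary: v)
    case 0
    then show ?case by (simp add: M_def)
  next
    case (Suc k)
    have "matrix_power M (Suc (Suc k)) $ u $ v = (\<Sum>w\<in>UNIV. matrix_power M (Suc k) $ u $ w * M $ w $ v)"
      unfolding matrix_power.simps(2)[of M "Suc k"] matrix_matrix_mult_def vec_lambda_beta ..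
    also have "\<dots> = (\<Sum>w\<in>UNIV. if u \<in> V (a, b) then pw (6 * Suc k) $ u $ w * pw 6 $ w $ v else 0)"
    proof (rule sum.cong[OF refl])
      fix w
      have "w \<in> V (a, b)" if "u \<in> V (a, b)" "pw (6 * Suc k) $ u $ w \<noteq> 0"
      proof -
        have "(step ^^ (6 * Suc k)) (a, b) = (a, b)" using step_fixed_iff by (meson dvd_triv_left)
        then show ?thesis using pw_step[OF that(2)] that(1) unfolding V_def by (metis (mono_tags, lifting) mem_Collect_eq)
      qed
      then show "matrix_power M (Suc k) $ u $ w * M $ w $ v =
          (if u \<in> V (a, b) then pw (6 * Suc k) $ u $ w * pw 6 $ w $ v else 0)"
        unfolding Suc by (auto simp: M_def)
    qed
    also have "\<dots> = (if u \<in> V (a, b) then pw (6 * Suc k + 6) $ u $ v else 0)"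
      unfolding pw_def matrix_power_add by (simp add: matrix_matrix_mult_def)
    finally show ?case by (simp add: add.commute)
  qed
  have S6: "S (6 * Suc k) (a, b) = trace (matrix_power M (Suc k))" for k
    unfolding S_def trace_def M_pow by (simp add: sum.If_cases)
  obtain as where as: "\<And>k. trace (matrix_power M k) = (\<Sum>c\<leftarrow>as. c ^ k)"
    and eig: "\<And>c. c \<in> set as \<Longrightarrow> \<exists>v. v \<noteq> 0 \<and> M *v v = c *s v"
    and int: "\<And>c. c \<in> set as \<Longrightarrow> (\<forall>i j. M $ i $ j \<in> \<int>) \<Longrightarrow> algebraic_int c"
    using trace_matrix_power_eigenvalues[of M] by blast
  have S_other: "S l (a, b) = 0" if "\<not> 6 dvd l" for l
  proof -
    have "pw l $ u $ u = 0" if "u \<in> V (a, b)" for u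
      using pw_step[of l u u] step_fixed_iff[of l] \<open>\<not> 6 dvd l\<close> that by (auto simp: V_def)
    then show ?thesis unfolding S_def by simp
  qed
  have zeta: "inverse (zeta_c X) = (\<Prod>c\<leftarrow>as. 1 - fps_const c * fps_X ^ 6)"
  proof -
    have "of_nat (num_closed_walks X l) = (if 6 dvd l then 6 * (\<Sum>c\<leftarrow>as. c ^ (l div 6)) else 0)"
      if l: "l > 0" for l
    proof (cases "6 dvd l")
      case True
      then obtain k where "l = 6 * Suc k" using l by (metis dvdE gr0_conv_Suc mult_0_right neq0_conv)
      then show ?thesis using N[OF l] S6[of k] as[of "Suc k"] True by simp
    next
      case False
      then show ?thesis using N[OF l] S_other by simp
    qed
    then have "Abs_fps (\<lambda>l. if l = 0 then 0 else of_nat (num_closed_walks X l) / of_nat l) =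
        Abs_fps (\<lambda>l. if l = 0 then 0 else (if 6 dvd l then 6 * (\<Sum>c\<leftarrow>as. c ^ (l div 6)) else 0) / (of_nat l :: complex))"
      by (intro arg_cong[where f = Abs_fps] ext) auto
    then show ?thesis unfolding zeta_c_def fps_exp_power_sums[symmetric] by simp
  qed
  \<comment> \<open>The class is closed under \<open>step\<close>, so a walk of directed flags that
    starts in the class stays in the digraph.\<close>
  have three: "pw 3 $ u $ r = of_nat (card {(x, y). x \<in> directed_flags \<and> y \<in> directed_flags \<and>
      r \<in> directed_flags \<and> flag_arc u x \<and> flag_arc x y \<and> flag_arc y r})"
    if u: "u \<in> directed_flags" "multidim u \<in> T" for u r
  proof -
    have next_T: "multidim G \<in> T"
      if "F \<in> directed_flags" "G \<in> directed_flags" "flag_arc F G" "multidim F \<in> T"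
      for F G :: "('k, 'n) subspace_pair"
      using flag_arc_multidim[OF that(1-3)] that(4) step_in_class unfolding T_def by simp
    have "(u, x) \<in> arcs X \<and> (x, y) \<in> arcs X \<and> (y, r) \<in> arcs X \<longleftrightarrow>
      x \<in> directed_flags \<and> y \<in> directed_flags \<and> r \<in> directed_flags \<and> flag_arc u x \<and> flag_arc x y \<and> flag_arc y r"
      for x y
      unfolding arc using u next_T[of u x] next_T[of x y] by blast
    then show ?thesis unfolding pw_def A_def arc_mat_def matrix_power_3_nth by simp
  qed
  have T_mem: "(a, b) \<in> T" "(?n - a, ?n - b) \<in> T"
    using steps(3,6) unfolding T_def dim_class_def by (metis (mono_tags, lifting) mem_Collect_eq)+
  have rows: "pw 3 $ u $ r = of_bool (prod.swap r \<in> partial_flags (?n - b) (?n - a) \<and> transversal u (prod.swap r))"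
    if u: "u \<in> partial_flags a b" for u r
  proof -
    obtain W1 W2 where W: "u = (W1, W2)" by (cases u)
    obtain R1 R2 where R: "r = (R1, R2)" by (cases r)
    have "u \<in> directed_flags" "multidim u \<in> T"
      using u partial_flags_directed(1)[OF ab] T_mem unfolding W by (auto simp: partial_flags_def)
    from three[OF this, of r] show ?thesis
      unfolding W R three_arcs_up_iff[OF ab u[unfolded W]] by simp
  qed
  have rows': "pw 3 $ r $ v = of_bool (v \<in> partial_flags a b \<and> transversal (prod.swap r) v)"
    if r: "prod.swap r \<in> partial_flags (?n - b) (?n - a)" for r v
  proof -
    obtain W1 W2 where W: "v = (W1, W2)" by (cases v)
    obtain R1 R2 where R: "r = (R1, R2)" by (cases r)
    have r': "(R2, R1) \<in> partial_flags (?n - b) (?n - a)" using r R by simp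
    have "r \<in> directed_flags" "multidim r \<in> T"
      using r' partial_flags_directed(2)[OF _ _ _ r'] ab T_mem unfolding R by (auto simp: partial_flags_def)
    from three[OF this, of v] show ?thesis
      unfolding W R three_arcs_down_iff[OF ab r'] by simp
  qed
  have eigenvalue: "\<exists>s. c = of_nat CARD('k) ^ s" if c: "c \<in> set as" "c \<noteq> 0" for c
  proof -
    let ?q = "of_nat CARD('k) :: complex"
    obtain v where v: "v \<noteq> 0" "M *v v = c *s v" using eig[OF c(1)] by blast
    \<comment> \<open>Since \<open>c\<close> is nonzero, the zero rows of \<open>M\<close> force the
      eigenvector to vanish outside type \<open>(a, b)\<close>.\<close>
    have "v $ u = 0" if "u \<notin> V (a, b)" for u
    proof -
      have "(M *v v) $ u = 0" using that by (simp add: M_def matrix_vector_mult_def)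
      then show ?thesis using v(2) c(2) by simp
    qed
    then obtain P0 where P0: "P0 \<in> partial_flags a b" "v $ P0 \<noteq> 0"
      using v(1) unfolding V0 by (auto simp: Finite_Cartesian_Product.vec_eq_iff)
    have "(\<Sum>R | R \<in> partial_flags (?n - b) (?n - a) \<and> transversal P R.
        \<Sum>Q | Q \<in> partial_flags a b \<and> transversal R Q. v $ Q) = c * v $ P" if P: "P \<in> partial_flags a b" for P
    proof -
      have "c * v $ P = (\<Sum>w\<in>UNIV. pw 6 $ P $ w * v $ w)"
        using arg_cong[OF v(2), of "\<lambda>x. x $ P"] P by (simp add: matrix_vector_mult_def M_def V0)
      also have "\<dots> = (\<Sum>w\<in>UNIV. (\<Sum>r\<in>UNIV. pw 3 $ P $ r * pw 3 $ r $ w) * v $ w)"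
        unfolding pw_def matrix_power_add[of A 3 3, simplified] by (simp add: matrix_matrix_mult_def)
      also have "\<dots> = (\<Sum>w\<in>UNIV. \<Sum>r\<in>UNIV. pw 3 $ P $ r * (pw 3 $ r $ w * v $ w))"
        by (simp add: sum_distrib_right mult.assoc)
      also have "\<dots> = (\<Sum>r\<in>UNIV. \<Sum>w\<in>UNIV. pw 3 $ P $ r * (pw 3 $ r $ w * v $ w))"
        by (rule sum.swap)
      \<comment> \<open>The flag reached after three steps is descending; its swap is a partial flag
        of type \<open>(?n - b, ?n - a)\<close>.\<close>
      also have "\<dots> = (\<Sum>R\<in>UNIV. \<Sum>w\<in>UNIV. pw 3 $ P $ (prod.swap R) * (pw 3 $ (prod.swap R) $ w * v $ w))"
        by (rule sum.reindex_bij_betw[symmetric]) (auto intro!: bij_betw_byWitness[of _ prod.swap])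
      also have "\<dots> = (\<Sum>R\<in>UNIV. if R \<in> partial_flags (?n - b) (?n - a) \<and> transversal P R
          then \<Sum>Q | Q \<in> partial_flags a b \<and> transversal R Q. v $ Q else 0)"
      proof (rule sum.cong[OF refl])
        fix R :: "('k, 'n) subspace_pair"
        show "(\<Sum>w\<in>UNIV. pw 3 $ P $ (prod.swap R) * (pw 3 $ (prod.swap R) $ w * v $ w)) =
          (if R \<in> partial_flags (?n - b) (?n - a) \<and> transversal P R
          then \<Sum>Q | Q \<in> partial_flags a b \<and> transversal R Q. v $ Q else 0)"
        proof (cases "R \<in> partial_flags (?n - b) (?n - a) \<and> transversal P R")
          case True
          then have "pw 3 $ (prod.swap R) $ w = of_bool (w \<in> partial_flags a b \<and> transversal R w)" for w
            using rows'[of "prod.swap R" w] by simp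
          then show ?thesis using True rows[OF P, of "prod.swap R"]
            by (simp add: of_bool_def if_distrib[of "\<lambda>x. x * _"] sum.If_cases cong: if_cong)
        next
          case False
          then show ?thesis using rows[OF P, of "prod.swap R"] by auto
        qed
      qed
      also have "\<dots> = (\<Sum>R | R \<in> partial_flags (?n - b) (?n - a) \<and> transversal P R.
        \<Sum>Q | Q \<in> partial_flags a b \<and> transversal R Q. v $ Q)"
        by (simp add: sum.If_cases)
      finally show ?thesis ..
    qed
    then obtain s t where st: "c * ?q ^ t = ?q ^ s"
      using transversal_eigenvalue[of a b P0 "\<lambda>P. v $ P" c] ab P0 by auto
    have "M $ i $ j \<in> \<int>" for i j
      unfolding M_def pw_def A_def arc_mat_def
      by (auto simp: of_bool_def intro!: matrix_power_Ints)
    then have "algebraic_int c" using int[OF c(1)] by blast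
    moreover have "c \<in> \<rat>"
    proof -
      have "c = ?q ^ s / ?q ^ t" using st by (simp add: field_simps)
      then show ?thesis by (simp add: Rats_divide Rats_power)
    qed
    ultimately have "c \<in> \<int>" by (rule rational_algebraic_int_is_int)
    then obtain z where z: "c = of_int z" by (elim Ints_cases)
    have "(of_int (z * int CARD('k) ^ t) :: complex) = of_int (int CARD('k) ^ s)"
      using st z by simp
    then have zq: "z * int CARD('k) ^ t = int CARD('k) ^ s" by (simp only: of_int_eq_iff)
    have q2: "int CARD('k) \<ge> 2" using CARD_field_ge_2[where 'k='k] by simp
    \<comment> \<open>For \<open>t > s\<close>, a power of \<open>q\<close> with positive exponent
      would divide 1 in the integers.\<close>
    have "t \<le> s"
    proof (rule ccontr)
      assume "\<not> t \<le> s"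
      then have "int CARD('k) ^ t = int CARD('k) ^ s * int CARD('k) ^ (t - s)"
        by (simp flip: power_add)
      then have "z * int CARD('k) ^ (t - s) = 1" using zq q2 by simp
      then have "int CARD('k) ^ (t - s) = 1"
        using q2 zmult_eq_1_iff[of z "int CARD('k) ^ (t - s)"] zero_le_power[of "int CARD('k)" "t - s"] by linarith
      then show False using \<open>\<not> t \<le> s\<close> q2 one_less_power[of "int CARD('k)" "t - s"] by simp
    qed
    then have "?q ^ s = ?q ^ (s - t) * ?q ^ t" by (simp flip: power_add)
    then have "c = ?q ^ (s - t)" using st by simp
    then show ?thesis by blast
  qed
  \<comment> \<open>An eigenvalue 0 contributes the factor 1 and is dropped. The induction runs over
    lists with entries in \<open>as\<close>, where \<open>eigenvalue\<close> is available.\<close>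
  have "\<exists>ss :: nat list. (\<Prod>c\<leftarrow>cs. 1 - fps_const c * fps_X ^ 6) =
      (\<Prod>s\<leftarrow>ss. 1 - fps_const (of_nat (CARD('k) ^ s)) * fps_X ^ 6)"
    if "set cs \<subseteq> set as" for cs
    using that
  proof (induction cs)
    case Nil
    then show ?case by (intro exI[of _ "[]"]) simp
  next
    case (Cons c cs)
    then obtain ss :: "nat list" where ss: "(\<Prod>c\<leftarrow>cs. 1 - fps_const c * fps_X ^ 6) =
      (\<Prod>s\<leftarrow>ss. 1 - fps_const (of_nat (CARD('k) ^ s)) * fps_X ^ 6)" by auto
    show ?case
    proof (cases "c = 0")
      case True
      then show ?thesis using ss by auto
    next
      case False
      then obtain s where "c = of_nat CARD('k) ^ s" using eigenvalue Cons.prems by auto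
      then show ?thesis using ss by (intro exI[of _ "s # ss"]) simp
    qed
  qed
  from this[of as] show ?thesis unfolding zeta by simp
qed

text \<open>One step makes a descending pair ascending. The orbit is cyclic, with
  \<open>(a, b)\<close> recurring as the fifth iterate, so the later start loses nothing.\<close>

lemma dim_class_eq_next:
  assumes ab: "b < a" "a < n" "0 < b" and third: "\<not> (3 * a = 2 * n \<and> 3 * b = n)"
  shows "dim_class n (a, b) = dim_class n (b, n + b - a)"
proof -
  interpret dim_orbit n b "n + b - a" by unfold_locales (use ab third in auto)
  have first: "(a, b) = (step ^^ 5) (b, n + b - a)" unfolding steps(5) using ab by simp
  have "(b, n + b - a) = (step ^^ 1) (a, b)" using ab by simp
  then have "(step ^^ m) (b, n + b - a) = (step ^^ (m + 1)) (a, b)" for m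
    by (simp only: funpow_add o_apply)
  moreover have "(step ^^ m) (a, b) = (step ^^ (m + 5)) (b, n + b - a)" for m
    by (subst first) (simp only: funpow_add o_apply)
  ultimately show ?thesis unfolding dim_class_def by blast
qed

theorem theorem7p2p1:
  fixes q n a b :: nat
    and X :: "(('k::{field,finite}, 'n::finite) subspace_pair,
               ('k, 'n) subspace_pair \<times> ('k, 'n) subspace_pair) pre_digraph"
  assumes q: "q = CARD('k)"
    and n: "n = CARD('n)" "n \<ge> 3"
    and ab: "1 \<le> a" "a \<le> n - 1" "1 \<le> b" "b \<le> n - 1" "a \<noteq> b"
    and not_third: "(real a, real b) \<noteq> (real n / 3, 2 * real n / 3)"
                   "(real a, real b) \<noteq> (2 * real n / 3, real n / 3)"
    and X: "X = class_flag_digraph (a, b)"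
  shows "\<exists>ss :: nat list.
           inverse (zeta_c X) = (\<Prod>s\<leftarrow>ss. 1 - fps_const (of_nat (q ^ s)) * fps_X ^ 6)"
proof (cases "a < b")
  case True
  have "\<not> (3 * a = n \<and> 3 * b = 2 * n)" using not_third(1) by (auto simp flip: of_nat_mult)
  then show ?thesis
    unfolding q using True ab n by (intro inverse_zeta_class_flag_digraph[of a b X, OF _ _ _ _ X]) auto
next
  case False
  have third: "\<not> (3 * a = 2 * n \<and> 3 * b = n)" using not_third(2) by auto
  \<comment> \<open>The digraph depends on the pair only through its class; the excluded pair
    \<open>(2n/3, n/3)\<close> is the one that steps to \<open>(n/3, 2n/3)\<close>.\<close>
  have "X = class_flag_digraph (b, n + b - a)"
    unfolding X class_flag_digraph_def using dim_class_eq_next[of b a n] third False ab n by simp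
  then show ?thesis
    unfolding q using False ab n third by (intro inverse_zeta_class_flag_digraph[of b "n + b - a" X]) auto
qed

end
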